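(* Let $0<a\leq 1$, let $N\geq 1$ be an integer, $m\in\{1,\ldots,N\}$, $k\in\{1,\ldots,m+1\}$. Let $\Sigma_1$ be a simple positively oriented closed contour around $a$ but not enclosing $-1/a$, and $\Sigma_2$ a simple positively oriented closed contour encircling $\Sigma_1$ and $0$. Then the following Riemann–Hilbert problem for $U$ is uniquely solvable: (a) $U:\mathbb C\setminus(\Sigma_1\cup\Sigma_2)\to\mathbb C^{2\times2}$ is analytic. (b) $U$ admits continuous boundary values $U_\pm(z)$ as $z\in\Sigma_1\cup\Sigma_2$ is approached from the left ($+$) or right ($-$) according to the orientation of the contour, and $U_+(z)=U_-(z)J_U(z)$ for $z\in\Sigma_1\cup\Sigma_2$, with $$J_U(z)=\begin{pmatrix}1&\frac{z^{N-m+k}}{(z-a)^{N-m+1}(1+az)^m}\\0&1\end{pmatrix},\ z\in\Sigma_1,\qquad J_U(z)=\begin{pmatrix}1&0\\-\frac{(z-a)^{N-m+1}(1+az)^m}{z^{N-m+k}}&1\end{pmatrix},\ z\in\Sigma_2.$$ (c) $U(z)=I_2+O(z^{-1})$ as $z\to\infty$. Moreover, its solution satisfies $$\frac{\det\left(1-1_{\mathbb Z\cap[k+1,+\infty)}K_{N,m}\right)}{\det\left(1-1_{\mathbb Z\cap[k,+\infty)}K_{N,m}\right)}=U_{11}(0),$$ where the determinants are Fredholm determinants on $\ell^2(\mathbb Z)$.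
   Context: The kernel is $$K_{N,m}(n,n')=\frac{1}{(2\pi i)^2}\int_{\Sigma_2}du\int_{\Sigma_1}dv\,\frac{u^{-n-1}v^{n'}}{u-v}\,\frac{W(v)}{W(u)},\quad n,n'\in\mathbb Z,\qquad W(z)=\frac{z^{N-m}}{(z-a)^{N-m+1}(1+az)^m},$$ with contours $\Sigma_1,\Sigma_2$ as in the claim. $1_{\mathbb Z\cap[k,+\infty)}$ is the projection onto sequences supported on $\{k,k+1,\ldots\}$, and $$\det(1-1_{\mathbb Z\cap[k,+\infty)}K)_{\ell^2(\mathbb Z)}=1+\sum_{p=1}^\infty\frac{(-1)^p}{p!}\sum_{n_1,\ldots,n_p\geq k}\det\left(K(n_i,n_j)\right)_{i,j=1}^p .$$ The first column of $U$ has no jump across $\Sigma_1$, so $U_{11}(0)$ is unambiguous even if $0\in\Sigma_1$. *)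

theory Defs
  imports
    "HOL-Complex_Analysis.Complex_Analysis"
    "HOL-Library.Landau_Symbols"
    "Jordan_Normal_Form.Determinant"
begin

(* The infix is also used for vectors and formal power series; here it selects from complex ^ 2. *)
no_notation Matrix.vec_index (infixl "$" 100) and fps_nth (infixl "$" 75)
unbundle vec_syntax

text \<open>A simple positively oriented closed contour, parametrised on the unit interval.\<close>

definition positive_contour :: "(real \<Rightarrow> complex) \<Rightarrow> bool" where
  "positive_contour \<gamma> \<longleftrightarrow>
     valid_path \<gamma> \<and> simple_path \<gamma> \<and> pathfinish \<gamma> = pathstart \<gamma> \<and>
     (\<forall>z \<in> inside (path_image \<gamma>). winding_number \<gamma> z = 1)"

definition W :: "real \<Rightarrow> nat \<Rightarrow> nat \<Rightarrow> complex \<Rightarrow> complex" where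
  "W a N m z =
     z ^ (N - m) / ((z - of_real a) ^ (N - m + 1) * (1 + of_real a * z) ^ m)"

text \<open>
  The inner integral, in \<open>v\<close>, is over the inner contour \<open>\<gamma>1\<close>; the outer one, in \<open>u\<close>, is over \<open>\<gamma>2\<close>.
\<close>

definition K :: "real \<Rightarrow> nat \<Rightarrow> nat \<Rightarrow> (real \<Rightarrow> complex) \<Rightarrow> (real \<Rightarrow> complex) \<Rightarrow> int \<Rightarrow> int \<Rightarrow> complex"
  where
  "K a N m \<gamma>1 \<gamma>2 n n' =
     1 / (2 * of_real pi * \<i>) ^ 2 *
     contour_integral \<gamma>2 (\<lambda>u. contour_integral \<gamma>1 (\<lambda>v.
       u powi (- n - 1) * v powi n' / (u - v) * (W a N m v / W a N m u)))"

text \<open>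
  The Fredholm determinant of \<open>1 - 1\<^bsub>\<int> \<inter> [k, \<infinity>)\<^esub> L\<close> on \<open>\<ell>\<^sup>2(\<int>)\<close>, defined by its series.  The summation
  index \<open>q\<close> is \<open>p - 1\<close> where \<open>p \<ge> 1\<close> is the size of the minors; a tuple of \<open>p\<close> integers \<open>\<ge> k\<close> is an
  extensional function on \<open>{0..<p}\<close>.
\<close>

definition fredholm_minor_sum :: "(int \<Rightarrow> int \<Rightarrow> complex) \<Rightarrow> int \<Rightarrow> nat \<Rightarrow> complex" where
  "fredholm_minor_sum L k p =
     (\<Sum>\<^sub>\<infinity> n \<in> {0..<p} \<rightarrow>\<^sub>E {k..}. Determinant.det (Matrix.mat p p (\<lambda>(i, j). L (n i) (n j))))"

definition fredholm_det :: "(int \<Rightarrow> int \<Rightarrow> complex) \<Rightarrow> int \<Rightarrow> complex" where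
  "fredholm_det L k =
     1 + (\<Sum>q. (- 1) ^ Suc q / fact (Suc q) * fredholm_minor_sum L k (Suc q))"

definition J_inner :: "real \<Rightarrow> nat \<Rightarrow> nat \<Rightarrow> nat \<Rightarrow> complex \<Rightarrow> complex ^ 2 ^ 2" where
  "J_inner a N m k z =
     vector [vector [1, z ^ (N - m + k) / ((z - of_real a) ^ (N - m + 1) * (1 + of_real a * z) ^ m)],
             vector [0, 1]]"

definition J_outer :: "real \<Rightarrow> nat \<Rightarrow> nat \<Rightarrow> nat \<Rightarrow> complex \<Rightarrow> complex ^ 2 ^ 2" where
  "J_outer a N m k z =
     vector [vector [1, 0],
             vector [- ((z - of_real a) ^ (N - m + 1) * (1 + of_real a * z) ^ m / z ^ (N - m + k)), 1]]"

text \<open>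
  The Riemann--Hilbert problem.  For a positively oriented simple closed contour the left (\<open>+\<close>) side
  is the inside and the right (\<open>-\<close>) side the outside of the curve; this also makes sense at corners,
  where a piecewise smooth contour has no normal.  In the intended use the two curves are disjoint,
  so that near a point of one curve the filters below do not meet the other one.
\<close>

definition RHP_solution ::
  "real \<Rightarrow> nat \<Rightarrow> nat \<Rightarrow> nat \<Rightarrow> complex set \<Rightarrow> complex set \<Rightarrow> (complex \<Rightarrow> complex ^ 2 ^ 2) \<Rightarrow> bool"
  where
  "RHP_solution a N m k \<Sigma>1 \<Sigma>2 U \<longleftrightarrow>
     (\<forall>i j. (\<lambda>z. U z $ i $ j) analytic_on - (\<Sigma>1 \<union> \<Sigma>2)) \<and>
     (\<exists>Up Um.
        continuous_on (\<Sigma>1 \<union> \<Sigma>2) Up \<and> continuous_on (\<Sigma>1 \<union> \<Sigma>2) Um \<and>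
        (\<forall>z \<in> \<Sigma>1. (U \<longlongrightarrow> Up z) (at z within inside \<Sigma>1) \<and>
                  (U \<longlongrightarrow> Um z) (at z within outside \<Sigma>1) \<and>
                  Up z = Um z ** J_inner a N m k z) \<and>
        (\<forall>z \<in> \<Sigma>2. (U \<longlongrightarrow> Up z) (at z within inside \<Sigma>2) \<and>
                  (U \<longlongrightarrow> Um z) (at z within outside \<Sigma>2) \<and>
                  Up z = Um z ** J_outer a N m k z)) \<and>
     (\<forall>i j. (\<lambda>z. U z $ i $ j - (Finite_Cartesian_Product.mat 1 :: complex ^ 2 ^ 2) $ i $ j) \<in> O[at_infinity](\<lambda>z. 1 / z))"

end

theory Submission
  imports Defs
begin

text \<open>
  Write \<open>d = N - m\<close>, \<open>f(z) = z^(d+k) / ((z-a)^(d+1) (1+az)^m)\<close> and \<open>g = 1/f\<close>.  All jumps are rational,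
  so a row \<open>(u\<^sub>1, u\<^sub>2)\<close> of a solution is encoded by two polynomials.  Undoing the jump on the inner
  contour by subtracting \<open>f u\<^sub>1\<close> from \<open>u\<^sub>2\<close> inside it, the second entry becomes \<open>P(z) / (z-a)^(d+1)\<close>
  on the whole plane, with \<open>degree P \<le> d\<close>; undoing the jump on the outer contour by subtracting
  \<open>g u\<^sub>2\<close> from \<open>u\<^sub>1\<close> outside it, the first entry becomes a polynomial \<open>Y\<close>.  With
  \<open>Q = (1+az)^m P + z^(d+k) Y\<close> the remaining conditions say that \<open>(z-a)^(d+1)\<close> divides \<open>Q\<close>, because
  \<open>u\<^sub>2\<close> is regular at \<open>a\<close>, and that \<open>u\<^sub>1 = Q / z^(d+k)\<close> outside the outer contour, so the leading
  behaviour of \<open>Q\<close> in degrees \<open>\<ge> d + k\<close> is prescribed by the normalisation at infinity.  This is a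
  Pade approximation problem for \<open>(z-a)^(d+1) / (1+az)^m\<close> at the origin.

  Uniqueness (\<open>pade_trivial\<close>): if \<open>degree Q < d + k\<close>, the Moebius substitution \<open>w = z / (1+az)\<close> turns
  \<open>Q\<close> into a polynomial in \<open>w\<close> supported in the degrees \<open>0, ..., d\<close> and \<open>d+k, ..., d+m\<close>, which
  vanishes to order \<open>d+1\<close> at \<open>a / (1+a^2)\<close> and to order \<open>m-k+1\<close> at \<open>1/a\<close>.  A nonzero real polynomial
  has fewer positive roots, counted with multiplicity, than nonzero coefficients (the weak form of
  Descartes' rule, \<open>positive_root_orders_less_terms\<close>), and here there are as many roots as possible
  coefficients, so \<open>Q = 0\<close>.

  The same linear system contains the kernel.  Evaluating the two contour integrals shows that
  \<open>K(n,n')\<close> is the coefficient of \<open>z^(n+d)\<close> in \<open>(1+az)^m p(z)\<close>, where \<open>p / (z-a)^(d+1)\<close> is the principal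
  part at \<open>a\<close> of \<open>z^n' W(z)\<close> (\<open>kernel_eq_coeff\<close>).  So the rows \<open>n > m\<close> vanish, the Fredholm
  determinants are finite determinants (\<open>fredholm_det_eq_det\<close>), and for \<open>Y = \<Sum> x\<^sub>j z^j\<close> and
  \<open>P = - \<Sum> x\<^sub>j p\<^sub>j\<close> the vector \<open>(1 - K) x\<close> lists the coefficients of \<open>Q\<close> in degrees \<open>\<ge> d + k\<close>
  (\<open>coeff_residual_of\<close>).  Uniqueness for the Pade problem makes the determinant nonzero, hence the
  problem solvable, and Cramer's rule identifies \<open>U\<^sub>1\<^sub>1(0) = Y(0) = x\<^sub>0\<close> with the quotient of
  consecutive determinants.

  Passing from a solution to \<open>P\<close> and \<open>Y\<close> needs that a function which is continuous across a
  piecewise smooth simple curve and holomorphic off it is holomorphic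
  (\<open>holomorphic_on_across_simple_path\<close>); the rest is Liouville's theorem.
\<close>

section \<open>Real polynomials with few terms\<close>

text \<open>
  Rolle's theorem between consecutive points of \<open>A\<close>.  The new critical points avoid \<open>A\<close>, so that they
  can be counted in addition to the orders which the derivative keeps at the points of \<open>A\<close>.
\<close>

lemma rolle_points:
  fixes p :: "real poly"
  assumes "finite A" "A \<noteq> {}" "\<forall>x\<in>A. 0 < x \<and> poly p x = 0"
  shows "\<exists>B. finite B \<and> Suc (card B) = card A \<and> B \<inter> A = {} \<and>
             (\<forall>y\<in>B. 0 < y \<and> y < Max A \<and> poly (pderiv p) y = 0)"
  using assms
proof (induction A rule: finite_linorder_max_induct)
  case empty
  then show ?case by simp
next
  case (insert b A)
  show ?case
  proof (cases "A = {}")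
    case True
    then show ?thesis by (intro exI[of _ "{}"]) auto
  next
    case False
    with insert obtain B where B: "finite B" "Suc (card B) = card A" "B \<inter> A = {}"
      "\<forall>y\<in>B. 0 < y \<and> y < Max A \<and> poly (pderiv p) y = 0" by auto
    have mA: "Max A \<in> A" using False insert by simp
    then have less: "Max A < b" using insert by blast
    have "\<exists>y>Max A. y < b \<and> poly p b - poly p (Max A) = (b - Max A) * poly (pderiv p) y"
      using poly_MVT[OF less] by blast
    then obtain y where y: "Max A < y" "y < b" "poly (pderiv p) y = 0"
      using insert.prems mA less by auto
    have Mb: "Max (insert b A) = b"
      using insert less by (intro Max_eqI) (auto intro: less_imp_le)
    have yA: "y \<notin> A" using y insert.hyps(1) by (meson Max_ge not_le)
    have yB: "y \<notin> B" using B(4) y by auto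
    have bB: "b \<notin> B" using B(4) less by auto
    have "0 < Max A" using mA insert.prems by auto
    then show ?thesis
      using B y yA yB bB insert.hyps(1,2) less Mb
      by (intro exI[of _ "insert y B"]) (auto intro: less_trans)
  qed
qed

text \<open>
  Descartes' bound without the sign changes.  Dividing by the variable alters neither the positive
  roots nor the number of terms, so the constant term may be assumed nonzero.  Then differentiation
  loses exactly one term, and by Rolle it loses at most one root: each root drops in order by one, and
  the gaps between the roots win back all but one of these losses.
\<close>

lemma positive_root_orders_less_terms:
  fixes p :: "real poly"
  assumes "p \<noteq> 0" "finite A" "\<forall>x\<in>A. 0 < x"
  shows "(\<Sum>x\<in>A. order x p) < card {i. coeff p i \<noteq> 0}"
  using assms
proof (induction "degree p" arbitrary: p A rule: less_induct)
  case less
  have fin: "finite {i. coeff p i \<noteq> 0}" for p :: "real poly"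
    using MOST_coeff_eq_0[of p] by (simp add: eventually_cofinite)
  show ?case
  proof (cases "coeff p 0 = 0")
    case True
    then obtain q where q: "p = pCons 0 q" by (cases p) auto
    with less.prems have q0: "q \<noteq> 0" by auto
    have p: "p = [:0, 1:] * q" using q by simp
    have ord: "order x p = order x q" if "x \<in> A" for x
    proof -
      have "order x [:0, 1:] = 0" using that less.prems by (intro order_0I) auto
      then show ?thesis unfolding p by (subst order_mult) (use q0 in auto)
    qed
    have "{i. coeff p i \<noteq> 0} = Suc ` {i. coeff q i \<noteq> 0}"
    proof (rule Set.set_eqI)
      fix i show "i \<in> {i. coeff p i \<noteq> 0} \<longleftrightarrow> i \<in> Suc ` {i. coeff q i \<noteq> 0}"
        by (cases i) (auto simp: q)
    qed
    then have "card {i. coeff p i \<noteq> 0} = card {i. coeff q i \<noteq> 0}"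
      by (simp add: card_image)
    moreover have "degree q < degree p" using q q0 by simp
    ultimately show ?thesis using less.hyps[of q A] less.prems q0 ord by simp
  next
    case False
    define A' where "A' = {x \<in> A. poly p x = 0}"
    have "(\<Sum>x\<in>A. order x p) = (\<Sum>x\<in>A'. order x p)"
      unfolding A'_def using less.prems by (intro sum.mono_neutral_right) (auto simp: order_root)
    moreover have "(\<Sum>x\<in>A'. order x p) < card {i. coeff p i \<noteq> 0}"
    proof (cases "A' = {}")
      case True
      then show ?thesis using False fin by (auto simp: card_gt_0_iff)
    next
      case ne: False
      have A': "finite A'" "\<forall>x\<in>A'. 0 < x \<and> poly p x = 0"
        using less.prems by (auto simp: A'_def)
      have deg: "degree p \<noteq> 0"
      proof
        assume "degree p = 0"
        then obtain c where c: "p = [:c:]" by (rule degree_eq_zeroE)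
        with ne A' less.prems(1) show False by auto
      qed
      then have p'0: "pderiv p \<noteq> 0" by (simp add: pderiv_eq_0_iff)
      obtain B where B: "finite B" "Suc (card B) = card A'" "B \<inter> A' = {}"
        "\<forall>y\<in>B. 0 < y \<and> y < Max A' \<and> poly (pderiv p) y = 0"
        using rolle_points[OF A'(1) ne A'(2)] by blast
      have "(\<Sum>x\<in>A'. order x p) = (\<Sum>x\<in>A'. Suc (order x (pderiv p)))"
        using A' less.prems by (intro sum.cong) (auto simp: order_pderiv)
      also have "\<dots> = Suc (card B) + (\<Sum>x\<in>A'. order x (pderiv p))"
        using B by (simp add: sum_Suc)
      also have "card B \<le> (\<Sum>x\<in>B. order x (pderiv p))"
        using B(4) p'0 by (subst card_eq_sum, intro sum_mono) (auto simp: Suc_le_eq order_gt_0_iff)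
      also have "Suc \<dots> + (\<Sum>x\<in>A'. order x (pderiv p)) = Suc (\<Sum>x\<in>A' \<union> B. order x (pderiv p))"
        using B A' by (subst sum.union_disjoint) auto
      also have "(\<Sum>x\<in>A' \<union> B. order x (pderiv p)) < card {i. coeff (pderiv p) i \<noteq> 0}"
        using less.hyps[of "pderiv p" "A' \<union> B"] p'0 A' B deg by (simp add: degree_pderiv Ball_def)
      also have "Suc (card {i. coeff (pderiv p) i \<noteq> 0}) = card {i. coeff p i \<noteq> 0}"
      proof -
        have "{i. coeff p i \<noteq> 0} = insert 0 (Suc ` {i. coeff (pderiv p) i \<noteq> 0})"
        proof (rule Set.set_eqI)
          fix i show "i \<in> {i. coeff p i \<noteq> 0} \<longleftrightarrow> i \<in> insert 0 (Suc ` {i. coeff (pderiv p) i \<noteq> 0})"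
            using False by (cases i) (auto simp: coeff_pderiv)
        qed
        then show ?thesis by (simp add: card_image fin)
      qed
      finally show ?thesis by simp
    qed
    ultimately show ?thesis by simp
  qed
qed

section \<open>Uniqueness for the Pade problem\<close>

text \<open>
  The polynomial \<open>(1 - aw)^n p(w / (1 - aw))\<close>: the pullback of \<open>p\<close>, as a form of degree \<open>n\<close>, under the
  inverse of \<open>w = z / (1 + az)\<close>.
\<close>

definition moebius_poly :: "real \<Rightarrow> nat \<Rightarrow> real poly \<Rightarrow> real poly" where
  "moebius_poly a n p = (\<Sum>i\<le>n. Polynomial.smult (coeff p i) (monom 1 i * [:1, - a:] ^ (n - i)))"

lemma poly_eq_sum_atMost:
  fixes p :: "'a::comm_semiring_1 poly"
  assumes "degree p \<le> n"
  shows "poly p x = (\<Sum>i\<le>n. coeff p i * x ^ i)"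
  unfolding poly_altdef using assms
  by (intro sum.mono_neutral_left) (auto simp: coeff_eq_0)

lemma poly_moebius_poly:
  assumes "degree p \<le> n" "1 - a * w \<noteq> 0"
  shows "poly (moebius_poly a n p) w = (1 - a * w) ^ n * poly p (w / (1 - a * w))"
proof -
  have "poly (moebius_poly a n p) w = (\<Sum>i\<le>n. coeff p i * (w ^ i * (1 - a * w) ^ (n - i)))"
    by (simp add: moebius_poly_def poly_sum poly_monom mult.commute)
  also have "\<dots> = (\<Sum>i\<le>n. (1 - a * w) ^ n * (coeff p i * (w / (1 - a * w)) ^ i))"
  proof (intro sum.cong refl)
    fix i assume "i \<in> {..n}"
    then have "(1 - a * w) ^ n = (1 - a * w) ^ i * (1 - a * w) ^ (n - i)"
      by (simp flip: power_add)
    then show "coeff p i * (w ^ i * (1 - a * w) ^ (n - i)) =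
        (1 - a * w) ^ n * (coeff p i * (w / (1 - a * w)) ^ i)"
      using assms(2) by (simp add: power_divide)
  qed
  also have "\<dots> = (1 - a * w) ^ n * poly p (w / (1 - a * w))"
    by (simp add: poly_eq_sum_atMost[OF assms(1)] sum_distrib_left)
  finally show ?thesis .
qed

lemma degree_moebius_poly: "degree (moebius_poly a n p) \<le> n"
  unfolding moebius_poly_def
proof (intro degree_sum_le)
  fix i assume "i \<in> {..n}"
  have "degree (monom 1 i * [:1, - a:] ^ (n - i)) \<le> i + (n - i)"
    by (intro order.trans[OF degree_mult_le] add_mono degree_monom_le
          order.trans[OF degree_power_le]) auto
  with \<open>i \<in> {..n}\<close> show "degree (Polynomial.smult (coeff p i) (monom 1 i * [:1, - a:] ^ (n - i))) \<le> n"
    by (intro order.trans[OF degree_smult_le]) auto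
qed auto

lemma poly_eqI_infinite:
  fixes p q :: "'a::idom poly"
  assumes "infinite A" "\<And>x. x \<in> A \<Longrightarrow> poly p x = poly q x"
  shows "p = q"
proof (rule ccontr)
  assume "p \<noteq> q"
  then have "finite {x. poly (p - q) x = 0}" by (intro poly_roots_finite) simp
  moreover have "A \<subseteq> {x. poly (p - q) x = 0}" using assms(2) by auto
  ultimately show False using assms(1) finite_subset by blast
qed

lemma moebius_poly_eq_0:
  assumes "degree p \<le> n" "0 < a" "moebius_poly a n p = 0"
  shows "p = 0"
proof (rule poly_eqI_infinite)
  show "infinite {0::real<..}" by (simp add: infinite_Ioi)
  fix z :: real assume "z \<in> {0<..}"
  with assms(2) have z: "1 + a * z > 0" by (simp add: add_pos_pos)
  define w where "w = z / (1 + a * z)"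
  have w: "1 - a * w = 1 / (1 + a * z)" using z by (simp add: w_def field_simps)
  then have "w / (1 - a * w) = z" using z by (simp add: w_def)
  moreover have "1 - a * w \<noteq> 0" using w z by simp
  ultimately show "poly p z = poly 0 z"
    using poly_moebius_poly[OF assms(1), of a w] assms(3) by simp
qed

text \<open>
  In the coordinate \<open>w = z / (1 + az)\<close> the factor \<open>(1 + az)^m\<close> is absorbed into the degree of the form, so
  the left-hand side becomes a polynomial with a gap: at most \<open>(d + 1) + (m - k + 1)\<close> coefficients.  On
  the right-hand side \<open>z - a\<close> becomes a root of order \<open>d + 1\<close> at \<open>a / (1 + a^2)\<close>, and the drop in degree
  becomes a root of order \<open>m - k + 1\<close> at \<open>1 / a\<close>, the image of infinity.  Both points are positive, so
  Descartes' bound leaves only the zero polynomial.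
\<close>

lemma pade_trivial_real:
  fixes P Y S :: "real poly"
  assumes a: "0 < a" and k: "1 \<le> k" "k \<le> m + 1" and P: "degree P \<le> d"
    and eq: "[:1, a:] ^ m * P + monom 1 (d + k) * Y = [:- a, 1:] ^ Suc d * S"
    and deg: "degree ([:- a, 1:] ^ Suc d * S) < d + k"
  shows "P = 0 \<and> Y = 0"
proof -
  \<comment> \<open>the degree bound on the residual limits the degrees of both unknown factors\<close>
  have S: "S = 0 \<or> degree S + 2 \<le> k"
  proof (rule disjCI)
    assume "\<not> degree S + 2 \<le> k"
    moreover have "S \<noteq> 0 \<Longrightarrow> degree ([:- a, 1:] ^ Suc d * S) = Suc d + degree S"
      by (subst degree_mult_eq) (auto simp: degree_linear_power simp del: power_Suc)
    ultimately show "S = 0" using deg k by linarith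
  qed
  have Y: "Y = 0 \<or> degree Y + k \<le> m"
  proof (rule disjCI)
    assume m: "\<not> degree Y + k \<le> m"
    have "degree ([:1, a:] ^ m * P) \<le> m + d"
      by (intro order.trans[OF degree_mult_le] add_mono P order.trans[OF degree_power_le]) simp
    moreover have "monom 1 (d + k) * Y = [:- a, 1:] ^ Suc d * S - [:1, a:] ^ m * P"
      using eq by (simp add: algebra_simps)
    moreover have "Y \<noteq> 0 \<Longrightarrow> degree (monom 1 (d + k) * Y) = d + k + degree Y"
      by (subst degree_mult_eq) (auto simp: degree_monom_eq)
    moreover have "degree ([:- a, 1:] ^ Suc d * S - [:1, a:] ^ m * P) \<le>
        max (degree ([:- a, 1:] ^ Suc d * S)) (degree ([:1, a:] ^ m * P))"
      by (rule degree_diff_le_max)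
    ultimately have "Y \<noteq> 0 \<Longrightarrow> d + k + degree Y \<le> max (degree ([:- a, 1:] ^ Suc d * S)) (m + d)"
      by (smt (verit) max.mono order.trans order_refl)
    then show "Y = 0" using deg m by linarith
  qed
  define R where "R = moebius_poly a d P + monom 1 (d + k) * moebius_poly a (m - k) Y"
  have "R = [:- a, 1 + a\<^sup>2:] ^ Suc d * [:1, - a:] ^ (m + 1 - k) * moebius_poly a (k - 2) S"
  proof (rule poly_eqI_infinite)
    show "infinite (- {1 / a})" by (simp add: Compl_eq_Diff_UNIV infinite_UNIV_char_0)
    fix w assume "w \<in> - {1 / a}"
    then have nz: "1 - a * w \<noteq> 0" using a by (auto simp: field_simps)
    define t where "t = 1 - a * w"
    define z where "z = w / t"
    have t: "t \<noteq> 0" using nz by (simp add: t_def)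
    have z1: "1 + a * z = 1 / t" using t by (simp add: z_def t_def field_simps)
    have z2: "z - a = (w - a * t) / t" using t by (simp add: z_def field_simps)
    have e: "(1 + a * z) ^ m * poly P z + z ^ (d + k) * poly Y z = (z - a) ^ Suc d * poly S z"
      using arg_cong[OF eq, of "\<lambda>p. poly p z"] by (simp add: poly_monom algebra_simps)
    have pP: "poly (moebius_poly a d P) w = t ^ d * poly P z"
      using poly_moebius_poly[OF P nz] by (simp add: t_def z_def)
    have pY: "w ^ (d + k) * poly (moebius_poly a (m - k) Y) w = t ^ (m + d) * z ^ (d + k) * poly Y z"
    proof (cases "Y = 0")
      case True
      then show ?thesis by (simp add: moebius_poly_def)
    next
      case False
      then have "poly (moebius_poly a (m - k) Y) w = t ^ (m - k) * poly Y z"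
        using Y poly_moebius_poly[OF _ nz, of Y "m - k"] by (simp add: t_def z_def)
      moreover have "t ^ (m + d) = t ^ (d + k) * t ^ (m - k)"
        using False Y by (simp add: add.commute flip: power_add)
      ultimately show ?thesis using t by (simp add: z_def power_divide)
    qed
    have pS: "(w - a * t) ^ Suc d * t ^ (m + 1 - k) * poly (moebius_poly a (k - 2) S) w =
        t ^ (m + d) * (z - a) ^ Suc d * poly S z"
    proof (cases "S = 0")
      case True
      then show ?thesis by (simp add: moebius_poly_def)
    next
      case False
      then have "poly (moebius_poly a (k - 2) S) w = t ^ (k - 2) * poly S z"
        using S poly_moebius_poly[OF _ nz, of S "k - 2"] by (simp add: t_def z_def)
      moreover have "t ^ (m + d) = t ^ Suc d * (t ^ (m + 1 - k) * t ^ (k - 2))"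
        using False S k by (simp add: add.commute flip: power_add power_Suc)
      ultimately show ?thesis unfolding z2 using t by (simp add: power_divide del: power_Suc)
    qed
    have "poly R w = t ^ d * poly P z + t ^ (m + d) * z ^ (d + k) * poly Y z"
      using pY by (simp add: R_def poly_monom pP)
    also have "t ^ d * poly P z = t ^ (m + d) * (1 + a * z) ^ m * poly P z"
      unfolding z1 using t by (simp add: power_add power_divide)
    also have "\<dots> + t ^ (m + d) * z ^ (d + k) * poly Y z = t ^ (m + d) * ((z - a) ^ Suc d * poly S z)"
      by (subst e[symmetric]) (simp add: algebra_simps)
    also have "\<dots> = (w - a * t) ^ Suc d * t ^ (m + 1 - k) * poly (moebius_poly a (k - 2) S) w"
      using pS by simp
    finally show "poly R w = poly ([:- a, 1 + a\<^sup>2:] ^ Suc d * [:1, - a:] ^ (m + 1 - k) * moebius_poly a (k - 2) S) w"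
      by (simp add: t_def power2_eq_square algebra_simps del: power_Suc)
  qed
  then have Rdvd: "[:- a, 1 + a\<^sup>2:] ^ Suc d dvd R" "[:1, - a:] ^ (m + 1 - k) dvd R"
    by (simp_all add: mult.assoc mult.left_commute del: power_Suc)
  define b where "b = a / (1 + a\<^sup>2)"
  have a2: "1 + a\<^sup>2 > 0" by (simp add: add_pos_nonneg)
  have "[:- a, 1 + a\<^sup>2:] = Polynomial.smult (1 + a\<^sup>2) [:- b, 1:]" using a2 by (simp add: b_def)
  then have "[:- b, 1:] dvd [:- a, 1 + a\<^sup>2:]" by (metis dvd_refl dvd_smult)
  then have d1: "[:- b, 1:] ^ Suc d dvd R"
    using Rdvd(1) dvd_power_same dvd_trans by blast
  have "[:1, - a:] = Polynomial.smult (- a) [:- (1 / a), 1:]" using a by simp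
  then have "[:- (1 / a), 1:] dvd [:1, - a:]" by (metis dvd_refl dvd_smult)
  then have d2: "[:- (1 / a), 1:] ^ (m + 1 - k) dvd R"
    using Rdvd(2) dvd_power_same dvd_trans by blast
  have ba: "b \<noteq> 1 / a" using a a2 by (simp add: b_def field_simps power2_eq_square)
  have R0: "R = 0"
  proof (rule ccontr)
    assume R: "R \<noteq> 0"
    have "Suc d + (m + 1 - k) \<le> order b R + order (1 / a) R"
      using d1 d2 R by (intro add_mono) (auto simp: order_divides simp del: power_Suc)
    also have "\<dots> = (\<Sum>x\<in>{b, 1 / a}. order x R)" using ba by simp
    also have "\<dots> < card {i. coeff R i \<noteq> 0}"
      using a a2 by (intro positive_root_orders_less_terms R) (auto simp: b_def)
    also have "\<dots> \<le> card ({..d} \<union> {d + k..<d + k + (m + 1 - k)})"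
    proof (intro card_mono subsetI, simp)
      fix i assume "i \<in> {i. coeff R i \<noteq> 0}"
      then have "coeff (moebius_poly a d P) i \<noteq> 0 \<or>
          (d + k \<le> i \<and> coeff (moebius_poly a (m - k) Y) (i - (d + k)) \<noteq> 0)"
        by (auto simp: R_def coeff_monom_mult split: if_splits)
      then show "i \<in> {..d} \<union> {d + k..<d + k + (m + 1 - k)}"
      proof (elim disjE conjE)
        assume "coeff (moebius_poly a d P) i \<noteq> 0"
        then have "i \<le> d" using degree_moebius_poly le_degree order.trans by metis
        then show ?thesis by simp
      next
        assume i: "d + k \<le> i" "coeff (moebius_poly a (m - k) Y) (i - (d + k)) \<noteq> 0"
        then have "Y \<noteq> 0" by (auto simp: moebius_poly_def)
        moreover have "i - (d + k) \<le> m - k" using i degree_moebius_poly le_degree order.trans by metis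
        ultimately show ?thesis using i Y by auto
      qed
    qed
    also have "\<dots> \<le> Suc d + (m + 1 - k)" by (rule order.trans[OF card_Un_le]) simp
    finally show False by simp
  qed
  have "moebius_poly a d P = 0"
  proof (rule poly_eqI)
    fix i show "coeff (moebius_poly a d P) i = coeff 0 i"
    proof (cases "i \<le> d")
      case True
      then have "coeff (monom 1 (d + k) * moebius_poly a (m - k) Y) i = 0"
        using k by (simp add: coeff_monom_mult)
      then show ?thesis using arg_cong[OF R0, of "\<lambda>p. coeff p i"] by (simp add: R_def)
    next
      case False
      then show ?thesis using degree_moebius_poly[of a d P] by (simp add: coeff_eq_0)
    qed
  qed
  then have P0: "P = 0" using moebius_poly_eq_0 P a by blast
  then have "monom 1 (d + k) * moebius_poly a (m - k) Y = 0" using R0 by (simp add: R_def moebius_poly_def)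
  then have "moebius_poly a (m - k) Y = 0" by simp
  then have "Y = 0" using moebius_poly_eq_0[of Y "m - k" a] Y a by (cases "Y = 0") (auto intro: add_le_imp_le_diff)
  with P0 show ?thesis by simp
qed

text \<open>
  Meant for \<open>f = Re\<close> and \<open>f = Im\<close>: a divisibility relation with real divisor passes to real and
  imaginary parts.
\<close>

lemma map_poly_mult_of_real:
  assumes "\<And>x y. f (x + y) = f x + f y" "f 0 = 0" "\<And>r z. f (of_real r * z) = r * f z"
  shows "map_poly f (map_poly complex_of_real D * E) = D * map_poly f E"
proof (rule poly_eqI)
  fix n
  have sum: "f (\<Sum>i\<in>A. g i) = (\<Sum>i\<in>A. f (g i))" if "finite A" for g and A :: "nat set"
    using that by (induction A rule: finite_induct) (auto simp: assms)
  show "coeff (map_poly f (map_poly complex_of_real D * E)) n = coeff (D * map_poly f E) n"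
    by (simp add: coeff_map_poly coeff_mult assms sum)
qed

lemma map_poly_of_real_linear_power:
  "map_poly complex_of_real ([:b, c:] ^ n) = [:of_real b, of_real c:] ^ n"
proof (induction n)
  case (Suc n)
  have "map_poly complex_of_real (p * q) = map_poly complex_of_real p * map_poly complex_of_real q" for p q
    by (intro poly_eqI) (simp add: coeff_map_poly coeff_mult)
  then show ?case by (simp only: power_Suc Suc) (simp add: map_poly_pCons)
qed simp

lemma pade_trivial:
  fixes P Y :: "complex poly" and a :: real and m d k :: nat
  defines "Q \<equiv> [:1, of_real a:] ^ m * P + monom 1 (d + k) * Y"
  assumes a: "0 < a" and k: "1 \<le> k" "k \<le> m + 1" and P: "degree P \<le> d"
    and dvd: "[:- of_real a, 1:] ^ Suc d dvd Q"
    and deg: "degree Q < d + k"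
  shows "P = 0 \<and> Y = 0"
proof -
  obtain S where S: "Q = [:- of_real a, 1:] ^ Suc d * S" using dvd by (rule dvdE)
  have part: "map_poly f P = 0 \<and> map_poly f Y = 0"
    if f: "\<And>x y. f (x + y) = f x + f y" "f 0 = 0" "\<And>r z. f (of_real r * z) = r * f z"
    for f :: "complex \<Rightarrow> real"
  proof (rule pade_trivial_real[OF a k])
    have deg_f: "degree (map_poly f p) \<le> degree p" for p
      by (rule degree_le) (simp add: coeff_map_poly f coeff_eq_0)
    show "degree (map_poly f P) \<le> d" using P deg_f order.trans by blast
    have "map_poly f Q = [:1, a:] ^ m * map_poly f P + monom 1 (d + k) * map_poly f Y"
    proof -
      have "map_poly f Q = map_poly f ([:1, of_real a:] ^ m * P) + map_poly f (monom 1 (d + k) * Y)"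
        unfolding Q_def by (intro poly_eqI) (simp add: coeff_map_poly f)
      also have "map_poly f ([:1, of_real a:] ^ m * P) = [:1, a:] ^ m * map_poly f P"
        using map_poly_mult_of_real[of f "[:1, a:] ^ m" P] f by (simp add: map_poly_of_real_linear_power)
      also have "map_poly f (monom 1 (d + k) * Y) = monom 1 (d + k) * map_poly f Y"
        by (intro poly_eqI) (simp add: coeff_map_poly coeff_monom_mult f)
      finally show ?thesis .
    qed
    moreover have fS: "map_poly f Q = [:- a, 1:] ^ Suc d * map_poly f S"
      using map_poly_mult_of_real[of f "[:- a, 1:] ^ Suc d" S] f
      by (simp only: map_poly_of_real_linear_power S) simp
    ultimately show "[:1, a:] ^ m * map_poly f P + monom 1 (d + k) * map_poly f Y =
        [:- a, 1:] ^ Suc d * map_poly f S" by simp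
    show "degree ([:- a, 1:] ^ Suc d * map_poly f S) < d + k"
      using deg deg_f[of Q] fS by simp
  qed
  have "map_poly Re P = 0 \<and> map_poly Re Y = 0" "map_poly Im P = 0 \<and> map_poly Im Y = 0"
    by (rule part; simp)+
  then have "Re (coeff P i) = 0 \<and> Im (coeff P i) = 0 \<and> Re (coeff Y i) = 0 \<and> Im (coeff Y i) = 0" for i
    by (metis coeff_0 coeff_map_poly zero_complex.simps)
  then show ?thesis by (auto simp: poly_eq_iff complex_eq_iff)
qed

section \<open>Curves across which continuous functions stay holomorphic\<close>

text \<open>
  Integrals along horizontal and vertical segments, addressed by real coordinates, so that rectangles
  can be cut along grid lines.
\<close>

definition hseg :: "(complex \<Rightarrow> complex) \<Rightarrow> real \<Rightarrow> real \<Rightarrow> real \<Rightarrow> complex" where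
  "hseg f x x' y = contour_integral (linepath (Complex x y) (Complex x' y)) f"

definition vseg :: "(complex \<Rightarrow> complex) \<Rightarrow> real \<Rightarrow> real \<Rightarrow> real \<Rightarrow> complex" where
  "vseg f x y y' = contour_integral (linepath (Complex x y) (Complex x y')) f"

definition rect_integral :: "(complex \<Rightarrow> complex) \<Rightarrow> real \<Rightarrow> real \<Rightarrow> real \<Rightarrow> real \<Rightarrow> complex" where
  "rect_integral f x x' y y' = hseg f x x' y + vseg f x' y y' - hseg f x x' y' - vseg f x y y'"

lemma hseg_subset: "x \<in> {a..b} \<Longrightarrow> x' \<in> {a..b} \<Longrightarrow> y \<in> {c..d} \<Longrightarrow>
    closed_segment (Complex x y) (Complex x' y) \<subseteq> cbox (Complex a c) (Complex b d)"
  by (intro closed_segment_subset convex_box) (auto simp: in_cbox_complex_iff)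

lemma vseg_subset: "x \<in> {a..b} \<Longrightarrow> y \<in> {c..d} \<Longrightarrow> y' \<in> {c..d} \<Longrightarrow>
    closed_segment (Complex x y) (Complex x y') \<subseteq> cbox (Complex a c) (Complex b d)"
  by (intro closed_segment_subset convex_box) (auto simp: in_cbox_complex_iff)

lemma hseg_split:
  assumes "continuous_on (cbox (Complex a c) (Complex b d)) f"
    "x \<in> {a..b}" "x' \<in> {a..b}" "x'' \<in> {x..x'}" "y \<in> {c..d}"
  shows "hseg f x x' y = hseg f x x'' y + hseg f x'' x' y"
  unfolding hseg_def
proof (rule contour_integral_split_linepath)
  show "continuous_on (closed_segment (Complex x y) (Complex x' y)) f"
    using assms by (intro continuous_on_subset[OF assms(1)] hseg_subset) auto
  show "Complex x'' y \<in> closed_segment (Complex x y) (Complex x' y)"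
    using assms(4) by (auto simp: closed_segment_same_Im closed_segment_eq_real_ivl)
qed

lemma vseg_split:
  assumes "continuous_on (cbox (Complex a c) (Complex b d)) f"
    "y \<in> {c..d}" "y' \<in> {c..d}" "y'' \<in> {y..y'}" "x \<in> {a..b}"
  shows "vseg f x y y' = vseg f x y y'' + vseg f x y'' y'"
  unfolding vseg_def
proof (rule contour_integral_split_linepath)
  show "continuous_on (closed_segment (Complex x y) (Complex x y')) f"
    using assms by (intro continuous_on_subset[OF assms(1)] vseg_subset) auto
  show "Complex x y'' \<in> closed_segment (Complex x y) (Complex x y')"
    using assms(4) by (auto simp: closed_segment_same_Re closed_segment_eq_real_ivl)
qed

lemma rect_integral_primitive:
  assumes g: "\<And>z. z \<in> cbox (Complex a c) (Complex b d) \<Longrightarrow>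
      (g has_field_derivative f z) (at z within cbox (Complex a c) (Complex b d))"
    and "a \<le> b" "c \<le> d"
  shows "rect_integral f a b c d = 0"
proof -
  let ?R = "cbox (Complex a c) (Complex b d)"
  have seg: "contour_integral (linepath p q) f = g q - g p" if "closed_segment p q \<subseteq> ?R" for p q
    using contour_integral_unique[OF contour_integral_primitive[OF g valid_path_linepath, of p q]] that by simp
  have h: "hseg f a b y = g (Complex b y) - g (Complex a y)" if "y \<in> {c..d}" for y
    unfolding hseg_def using assms that by (intro seg hseg_subset) auto
  have v: "vseg f x c d = g (Complex x d) - g (Complex x c)" if "x \<in> {a..b}" for x
    unfolding vseg_def using assms that by (intro seg vseg_subset) auto
  show ?thesis using assms by (simp add: rect_integral_def h v)
qed

lemma norm_rect_integral_le:
  assumes f: "continuous_on (cbox (Complex a c) (Complex b d)) f" and "a \<le> b" "c \<le> d"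
    and e: "0 \<le> e" "\<And>z. z \<in> cbox (Complex a c) (Complex b d) \<Longrightarrow> norm (f z - w) \<le> e"
  shows "norm (rect_integral f a b c d) \<le> 2 * e * ((b - a) + (d - c))"
proof -
  let ?R = "cbox (Complex a c) (Complex b d)"
  have int: "f contour_integrable_on linepath p q" if "closed_segment p q \<subseteq> ?R" for p q
    by (intro contour_integrable_continuous_linepath continuous_on_subset[OF f] that)
  have diff: "contour_integral (linepath p q) f =
      contour_integral (linepath p q) (\<lambda>z. f z - w) + w * (q - p)" if "closed_segment p q \<subseteq> ?R" for p q
  proof -
    have "contour_integral (linepath p q) (\<lambda>z. f z - w) =
        contour_integral (linepath p q) f - contour_integral (linepath p q) (\<lambda>z. w)"
      by (intro contour_integral_diff int that contour_integrable_continuous_linepath continuous_on_const)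
    moreover have "contour_integral (linepath p q) (\<lambda>z. w) = w * (q - p)"
      by (intro contour_integral_unique has_contour_integral_const_linepath)
    ultimately show ?thesis by simp
  qed
  have bound: "norm (contour_integral (linepath p q) (\<lambda>z. f z - w)) \<le> e * norm (q - p)"
    if "closed_segment p q \<subseteq> ?R" for p q
    using that e by (intro contour_integral_bound_linepath contour_integrable_continuous_linepath
        continuous_intros continuous_on_subset[OF f]) auto
  have h: "closed_segment (Complex a y) (Complex b y) \<subseteq> ?R" if "y \<in> {c..d}" for y
    using assms that by (intro hseg_subset) auto
  have v: "closed_segment (Complex x c) (Complex x d) \<subseteq> ?R" if "x \<in> {a..b}" for x
    using assms that by (intro vseg_subset) auto
  have nh: "norm (Complex b y - Complex a y) = b - a" for y
    using assms by (simp add: cmod_def complex_diff)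
  have nv: "norm (Complex x d - Complex x c) = d - c" for x
    using assms by (simp add: cmod_def complex_diff)
  define h' where "h' y = hseg (\<lambda>z. f z - w) a b y" for y
  define v' where "v' x = vseg (\<lambda>z. f z - w) x c d" for x
  have eq: "rect_integral f a b c d = h' c + v' b - h' d - v' a"
    unfolding rect_integral_def hseg_def vseg_def h'_def v'_def
    using assms by (simp add: diff h v algebra_simps complex_eq_iff)
  have "norm (h' c) \<le> e * (b - a)" "norm (h' d) \<le> e * (b - a)"
    unfolding h'_def hseg_def using bound[OF h[of c]] bound[OF h[of d]] assms by (simp_all add: nh)
  moreover have "norm (v' a) \<le> e * (d - c)" "norm (v' b) \<le> e * (d - c)"
    unfolding v'_def vseg_def using bound[OF v[of a]] bound[OF v[of b]] assms by (simp_all add: nv)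
  moreover have "norm (h' c + v' b - h' d - v' a) \<le> norm (h' c) + norm (v' b) + norm (h' d) + norm (v' a)"
    by (smt (verit) norm_triangle_ineq norm_triangle_ineq4)
  ultimately show ?thesis unfolding eq by (simp add: algebra_simps)
qed

text \<open>
  Inner edges are traversed twice in opposite directions: the horizontal parts telescope in one index
  and the vertical parts in the other.
\<close>

lemma rect_integral_grid:
  assumes f: "continuous_on (cbox (Complex a c) (Complex b d)) f"
    and x: "mono X" "X 0 = a" "X n = b" and y: "mono Y" "Y 0 = c" "Y n = d"
  shows "rect_integral f a b c d =
    (\<Sum>i<n. \<Sum>j<n. rect_integral f (X i) (X (Suc i)) (Y j) (Y (Suc j)))"
proof -
  have Xin: "X i \<in> {a..b}" if "i \<le> n" for i using monoD[OF x(1)] x that by force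
  have Yin: "Y i \<in> {c..d}" if "i \<le> n" for i using monoD[OF y(1)] y that by force
  have ab: "a \<le> b" "c \<le> d" using Xin[of 0] Yin[of 0] by auto
  have h: "hseg f a (X k) t = (\<Sum>i<k. hseg f (X i) (X (Suc i)) t)" if "t \<in> {c..d}" "k \<le> n" for t k
    using that(2)
  proof (induction k)
    case 0
    then show ?case using x by (simp add: hseg_def)
  next
    case (Suc k)
    have "hseg f a (X (Suc k)) t = hseg f a (X k) t + hseg f (X k) (X (Suc k)) t"
      by (rule hseg_split[OF f]) (use Xin[of k] Xin[of "Suc k"] Suc.prems that ab monoD[OF x(1), of k "Suc k"] in auto)
    then show ?case using Suc by simp
  qed
  have v: "vseg f t c (Y k) = (\<Sum>i<k. vseg f t (Y i) (Y (Suc i)))" if "t \<in> {a..b}" "k \<le> n" for t k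
    using that(2)
  proof (induction k)
    case 0
    then show ?case using y by (simp add: vseg_def)
  next
    case (Suc k)
    have "vseg f t c (Y (Suc k)) = vseg f t c (Y k) + vseg f t (Y k) (Y (Suc k))"
      by (rule vseg_split[OF f]) (use Yin[of k] Yin[of "Suc k"] Suc.prems that ab monoD[OF y(1), of k "Suc k"] in auto)
    then show ?case using Suc by simp
  qed
  have "(\<Sum>i<n. \<Sum>j<n. rect_integral f (X i) (X (Suc i)) (Y j) (Y (Suc j))) =
     (\<Sum>i<n. \<Sum>j<n. hseg f (X i) (X (Suc i)) (Y j) - hseg f (X i) (X (Suc i)) (Y (Suc j))) +
     (\<Sum>j<n. \<Sum>i<n. vseg f (X (Suc i)) (Y j) (Y (Suc j)) - vseg f (X i) (Y j) (Y (Suc j)))"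
    by (subst (2) sum.swap) (simp add: rect_integral_def sum.distrib sum_subtractf algebra_simps)
  also have "\<dots> = (\<Sum>i<n. hseg f (X i) (X (Suc i)) c - hseg f (X i) (X (Suc i)) d) +
     (\<Sum>j<n. vseg f b (Y j) (Y (Suc j)) - vseg f a (Y j) (Y (Suc j)))"
  proof -
    have "(\<Sum>j<n. hseg f (X i) (X (Suc i)) (Y j) - hseg f (X i) (X (Suc i)) (Y (Suc j))) =
        hseg f (X i) (X (Suc i)) c - hseg f (X i) (X (Suc i)) d" for i
      using sum_lessThan_telescope'[of "\<lambda>j. hseg f (X i) (X (Suc i)) (Y j)" n] y by simp
    moreover have "(\<Sum>i<n. vseg f (X (Suc i)) (Y j) (Y (Suc j)) - vseg f (X i) (Y j) (Y (Suc j))) =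
        vseg f b (Y j) (Y (Suc j)) - vseg f a (Y j) (Y (Suc j))" for j
      using sum_lessThan_telescope[of "\<lambda>i. vseg f (X i) (Y j) (Y (Suc j))" n] x by simp
    ultimately show ?thesis by simp
  qed
  also have "\<dots> = rect_integral f a b c d"
    using h[of c n] h[of d n] v[of a n] v[of b n] ab x y by (simp add: rect_integral_def sum_subtractf)
  finally show ?thesis ..
qed

lemma card_nat_interval_le:
  fixes l u :: real
  assumes "l \<le> u"
  shows "finite {i::nat. l \<le> real i \<and> real i \<le> u}" "real (card {i::nat. l \<le> real i \<and> real i \<le> u}) \<le> u - l + 1"
proof -
  let ?A = "{i::nat. l \<le> real i \<and> real i \<le> u}"
  have sub: "int ` ?A \<subseteq> {\<lceil>l\<rceil>..\<lfloor>u\<rfloor>}" by (auto simp: le_floor_iff ceiling_le_iff)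
  then have "finite (int ` ?A)" by (rule finite_subset) simp
  then show fin: "finite ?A" by (rule finite_imageD) simp
  have "card ?A = card (int ` ?A)" by (simp add: card_image)
  also have "\<dots> \<le> card {\<lceil>l\<rceil>..\<lfloor>u\<rfloor>}" by (rule card_mono[OF _ sub]) simp
  finally have "real (card ?A) \<le> real (nat (\<lfloor>u\<rfloor> - \<lceil>l\<rceil> + 1))" by simp
  also have "\<dots> \<le> u - l + 1" using assms by linarith
  finally show "real (card ?A) \<le> u - l + 1" .
qed

text \<open>
  What is needed of a rectifiable set: it can be covered by \<open>n\<close> discs of radius \<open>L / n\<close>, so a grid of
  mesh \<open>1 / n\<close> has only \<open>O(n)\<close> cells that meet it.
\<close>

definition linearly_covered :: "complex set \<Rightarrow> bool" where
  "linearly_covered C \<longleftrightarrow> (\<exists>L\<ge>0. \<forall>n>0. \<exists>w :: nat \<Rightarrow> complex. C \<subseteq> (\<Union>t<n. cball (w t) (L / real n)))"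

text \<open>
  Cut the rectangle into \<open>n \<times> n\<close> cells.  A cell off \<open>C\<close> contributes nothing by Cauchy's theorem.  A cell
  meeting \<open>C\<close> contributes at most its perimeter \<open>O(1/n)\<close> times the oscillation \<open>e\<close> of \<open>f\<close>, and there are
  \<open>O(n)\<close> of these, which leaves \<open>O(e)\<close>.
\<close>

lemma rect_integral_eq_0:
  assumes cov: "linearly_covered C"
    and f: "continuous_on (cbox (Complex a c) (Complex b d)) f"
    and hol: "\<And>z. z \<in> box (Complex a c) (Complex b d) - C \<Longrightarrow> f field_differentiable at z"
    and ab: "a \<le> b" "c \<le> d"
  shows "rect_integral f a b c d = 0"
proof (cases "a = b \<or> c = d")
  case True
  then show ?thesis by (auto simp: rect_integral_def hseg_def vseg_def)
next
  case False
  with ab have ab: "a < b" "c < d" by auto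
  let ?R = "cbox (Complex a c) (Complex b d)"
  define p where "p = b - a"
  define q where "q = d - c"
  have pq: "p > 0" "q > 0" using ab by (auto simp: p_def q_def)
  obtain L where L: "L \<ge> 0" "\<And>n. n > 0 \<Longrightarrow> \<exists>w :: nat \<Rightarrow> complex. C \<subseteq> (\<Union>t<n. cball (w t) (L / real n))"
    using cov unfolding linearly_covered_def by blast
  \<comment> \<open>bounds the number of cells that a single disc can meet\<close>
  define M where "M = (2 * L / p + 2) * (2 * L / q + 2)"
  have M: "M \<ge> 0" using L pq by (simp add: M_def)
  \<comment> \<open>the estimate for oscillation \<open>e\<close> on the cells\<close>
  have bound: "norm (rect_integral f a b c d) \<le> 2 * M * (p + q) * e" if e: "e > 0" for e
  proof -
    have "uniformly_continuous_on ?R f" by (intro compact_uniformly_continuous f) auto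
    then obtain \<delta> where \<delta>: "\<delta> > 0"
      "\<And>z z'. z \<in> ?R \<Longrightarrow> z' \<in> ?R \<Longrightarrow> dist z' z < \<delta> \<Longrightarrow> dist (f z') (f z) < e"
      using e unfolding uniformly_continuous_on_def by metis
    obtain n where n: "real n > (p + q) / \<delta>" using reals_Archimedean2 by blast
    have n0: "n > 0" using n \<delta> pq by (metis add_pos_pos divide_pos_pos gr0I not_less_iff_gr_or_eq of_nat_0 order_less_trans)
    have nd: "(p + q) / n < \<delta>" using n n0 \<delta> by (simp add: field_simps)
    obtain w :: "nat \<Rightarrow> complex" where w: "C \<subseteq> (\<Union>t<n. cball (w t) (L / real n))" using L(2)[OF n0] by blast
    define X where "X i = a + p * real i / n" for i
    define Y where "Y i = c + q * real i / n" for i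
    have mono: "mono X" "mono Y" using pq by (auto simp: mono_def X_def Y_def divide_right_mono mult_left_mono)
    have ends: "X 0 = a" "X n = b" "Y 0 = c" "Y n = d" using n0 by (auto simp: X_def Y_def p_def q_def)
    define cell where "cell i j = cbox (Complex (X i) (Y j)) (Complex (X (Suc i)) (Y (Suc j)))" for i j
    have XY: "X i \<le> X (Suc i)" "Y i \<le> Y (Suc i)" for i using mono by (auto intro: monoD)
    have cellR: "cell i j \<subseteq> ?R" if "i < n" "j < n" for i j
    proof -
      have "a \<le> X i" "X (Suc i) \<le> b" "c \<le> Y j" "Y (Suc j) \<le> d"
        using monoD[OF mono(1), of 0 i] monoD[OF mono(1), of "Suc i" n]
          monoD[OF mono(2), of 0 j] monoD[OF mono(2), of "Suc j" n] that ends by auto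
      then show ?thesis by (auto simp: cell_def in_cbox_complex_iff)
    qed
    define r where "r i j = rect_integral f (X i) (X (Suc i)) (Y j) (Y (Suc j))" for i j
    define hit where "hit t i j \<longleftrightarrow> cell i j \<inter> cball (w t) (L / n) \<noteq> {}" for t i j
    \<comment> \<open>a cell meeting \<open>C\<close> is charged to each disc that it meets, and it meets at least one\<close>
    have rbound: "norm (r i j) \<le> (\<Sum>t<n. if hit t i j then 2 * e * (p + q) / n else 0)"
      if ij: "i < n" "j < n" for i j
    proof (cases "cell i j \<inter> C = {}")
      case True
      have cont: "continuous_on (cell i j) f" by (rule continuous_on_subset[OF f cellR[OF ij]])
      have conv: "convex (cell i j)" by (simp add: cell_def)
      have fd: "f field_differentiable at z" if "z \<in> interior (cell i j) - {}" for z
      proof -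
        have "z \<in> interior ?R" using that interior_mono[OF cellR[OF ij]] by blast
        moreover have "z \<notin> C" using that True interior_subset by blast
        ultimately show ?thesis using hol by (simp add: interior_cbox)
      qed
      obtain g where g: "\<And>z. z \<in> cell i j \<Longrightarrow> (g has_field_derivative f z) (at z within cell i j)"
        using holomorphic_convex_primitive[OF conv finite.emptyI cont fd] by blast
      have "r i j = 0" unfolding r_def
        by (rule rect_integral_primitive) (use g XY in \<open>auto simp: cell_def\<close>)
      then show ?thesis using e pq by (auto intro!: sum_nonneg)
    next
      case False
      then obtain z where z: "z \<in> cell i j" "z \<in> C" by blast
      then obtain t where t: "t < n" "z \<in> cball (w t) (L / n)" using w by blast
      have "norm (r i j) \<le> 2 * e * ((X (Suc i) - X i) + (Y (Suc j) - Y j))"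
        unfolding r_def
      proof (rule norm_rect_integral_le)
        show "continuous_on (cbox (Complex (X i) (Y j)) (Complex (X (Suc i)) (Y (Suc j)))) f"
          using continuous_on_subset[OF f cellR[OF ij]] by (simp add: cell_def)
        fix z' assume "z' \<in> cbox (Complex (X i) (Y j)) (Complex (X (Suc i)) (Y (Suc j)))"
        then have z': "z' \<in> cell i j" by (simp add: cell_def)
        have "dist z' z \<le> \<bar>Re (z' - z)\<bar> + \<bar>Im (z' - z)\<bar>" using cmod_le[of "z' - z"] by (simp add: dist_norm)
        also have "\<dots> \<le> (X (Suc i) - X i) + (Y (Suc j) - Y j)"
          using z z' by (auto simp: cell_def in_cbox_complex_iff)
        also have "\<dots> = (p + q) / n" using n0 by (simp add: X_def Y_def field_simps)
        finally have "dist z' z < \<delta>" using nd by simp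
        then show "norm (f z' - f z) \<le> e"
          using \<delta>(2)[of z z'] z z' subsetD[OF cellR[OF ij], of z] subsetD[OF cellR[OF ij], of z']
          by (auto simp: dist_norm)
      qed (use e XY in auto)
      also have "\<dots> = 2 * e * (p + q) / n" using n0 by (simp add: X_def Y_def field_simps)
      also have "\<dots> = (\<Sum>s\<in>{t}. if hit s i j then 2 * e * (p + q) / n else 0)"
        using z t by (auto simp: hit_def)
      also have "\<dots> \<le> (\<Sum>s<n. if hit s i j then 2 * e * (p + q) / n else 0)"
        using t e pq by (intro sum_mono2) auto
      finally show ?thesis .
    qed
    have count: "(\<Sum>i<n. \<Sum>j<n. if hit t i j then 2 * e * (p + q) / n else 0) \<le> M * (2 * e * (p + q) / n)" for t
    proof -
      \<comment> \<open>rows and columns of the cells that the disc around \<open>w t\<close> may meet\<close>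
      define I where "I = {i::nat. (Re (w t) - L / n - a) * n / p - 1 \<le> i \<and> i \<le> (Re (w t) + L / n - a) * n / p}"
      define J where "J = {i::nat. (Im (w t) - L / n - c) * n / q - 1 \<le> i \<and> i \<le> (Im (w t) + L / n - c) * n / q}"
      have "L / n \<ge> 0" using L by simp
      then have lI: "(Re (w t) - L / n - a) * n / p - 1 \<le> (Re (w t) + L / n - a) * n / p"
        and lJ: "(Im (w t) - L / n - c) * n / q - 1 \<le> (Im (w t) + L / n - c) * n / q"
        using pq by (smt (verit) divide_right_mono mult_right_mono of_nat_0_le_iff)+
      have I: "finite I" "real (card I) \<le> 2 * L / p + 2"
      proof -
        have "(Re (w t) + L / n - a) * n / p - ((Re (w t) - L / n - a) * n / p - 1) + 1 = 2 * L / p + 2"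
          using pq n0 by (simp add: field_simps)
        then show "finite I" "real (card I) \<le> 2 * L / p + 2"
          using card_nat_interval_le[OF lI] unfolding I_def by simp_all
      qed
      have J: "finite J" "real (card J) \<le> 2 * L / q + 2"
      proof -
        have "(Im (w t) + L / n - c) * n / q - ((Im (w t) - L / n - c) * n / q - 1) + 1 = 2 * L / q + 2"
          using pq n0 by (simp add: field_simps)
        then show "finite J" "real (card J) \<le> 2 * L / q + 2"
          using card_nat_interval_le[OF lJ] unfolding J_def by simp_all
      qed
      have hitIJ: "i \<in> I \<and> j \<in> J" if hit: "hit t i j" for i j
      proof -
        obtain z where z: "z \<in> cell i j" "dist (w t) z \<le> L / n" using hit by (auto simp: hit_def)
        have "\<bar>Re (w t) - Re z\<bar> \<le> L / n" "\<bar>Im (w t) - Im z\<bar> \<le> L / n"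
          using z(2) abs_Re_le_cmod[of "w t - z"] abs_Im_le_cmod[of "w t - z"] by (auto simp: dist_norm)
        moreover have "X i \<le> Re z" "Re z \<le> X (Suc i)" "Y j \<le> Im z" "Im z \<le> Y (Suc j)"
          using z(1) by (auto simp: cell_def in_cbox_complex_iff)
        ultimately have *: "X i \<le> Re (w t) + L / n" "Re (w t) - L / n \<le> X (Suc i)"
           "Y j \<le> Im (w t) + L / n" "Im (w t) - L / n \<le> Y (Suc j)" by linarith+
        have "real i = (X i - a) * n / p" "real i = (X (Suc i) - a) * n / p - 1"
          "real j = (Y j - c) * n / q" "real j = (Y (Suc j) - c) * n / q - 1"
          using n0 pq by (auto simp: X_def Y_def field_simps)
        moreover have "(X i - a) * n / p \<le> (Re (w t) + L / n - a) * n / p"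
          "(Re (w t) - L / n - a) * n / p \<le> (X (Suc i) - a) * n / p"
          "(Y j - c) * n / q \<le> (Im (w t) + L / n - c) * n / q"
          "(Im (w t) - L / n - c) * n / q \<le> (Y (Suc j) - c) * n / q"
          using * pq by (auto intro!: divide_right_mono mult_right_mono)
        ultimately show ?thesis by (auto simp: I_def J_def)
      qed
      have "(\<Sum>i<n. \<Sum>j<n. if hit t i j then 2 * e * (p + q) / n else 0) =
          (\<Sum>(i, j)\<in>{..<n} \<times> {..<n}. if hit t i j then 2 * e * (p + q) / n else 0)"
        by (simp add: sum.cartesian_product)
      also have "\<dots> = (\<Sum>ij\<in>{ij \<in> {..<n} \<times> {..<n}. hit t (fst ij) (snd ij)}. 2 * e * (p + q) / n)"
        by (subst sum.inter_filter) (auto simp: case_prod_beta)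
      also have "\<dots> \<le> (\<Sum>ij\<in>I \<times> J. 2 * e * (p + q) / n)"
        using I J hitIJ e pq by (intro sum_mono2) auto
      also have "\<dots> = real (card I) * real (card J) * (2 * e * (p + q) / n)"
        by (simp add: card_cartesian_product)
      also have "\<dots> \<le> M * (2 * e * (p + q) / n)"
        unfolding M_def using I J L e pq by (intro mult_right_mono mult_mono) auto
      finally show ?thesis .
    qed
    have "rect_integral f a b c d = (\<Sum>i<n. \<Sum>j<n. r i j)"
      unfolding r_def by (rule rect_integral_grid[OF f]) (use mono ends in auto)
    also have "norm \<dots> \<le> (\<Sum>i<n. \<Sum>j<n. norm (r i j))"
      by (intro order.trans[OF norm_sum] sum_mono norm_sum)
    also have "\<dots> \<le> (\<Sum>i<n. \<Sum>j<n. \<Sum>t<n. if hit t i j then 2 * e * (p + q) / n else 0)"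
      by (intro sum_mono rbound) auto
    also have "\<dots> = (\<Sum>t<n. \<Sum>i<n. \<Sum>j<n. if hit t i j then 2 * e * (p + q) / n else 0)"
      by (subst (2) sum.swap, subst sum.swap) (rule refl)
    also have "\<dots> \<le> (\<Sum>t<n. M * (2 * e * (p + q) / n))" by (intro sum_mono count)
    also have "\<dots> = 2 * M * (p + q) * e" using n0 by simp
    finally show ?thesis .
  qed
  have "norm (rect_integral f a b c d) \<le> 0 + e" if "e > 0" for e
  proof -
    define s where "s = 2 * M * (p + q) + 1"
    have s: "s > 0" using M pq by (simp add: s_def add_nonneg_pos)
    have "norm (rect_integral f a b c d) \<le> 2 * M * (p + q) * (e / s)"
      using bound[of "e / s"] that s by simp
    also have "\<dots> \<le> s * (e / s)" using that s by (intro mult_right_mono) (auto simp: s_def)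
    finally show ?thesis using s by simp
  qed
  then have "norm (rect_integral f a b c d) \<le> 0" by (rule field_le_epsilon)
  then show ?thesis by simp
qed

lemma hseg_rev:
  assumes "continuous_on (closed_segment (Complex x y) (Complex x' y)) f"
  shows "hseg f x' x y = - hseg f x x' y"
  unfolding hseg_def using contour_integral_reverse_linepath[OF assms] by simp

lemma vseg_rev:
  assumes "continuous_on (closed_segment (Complex x y) (Complex x y')) f"
  shows "vseg f x y' y = - vseg f x y y'"
  unfolding vseg_def using contour_integral_reverse_linepath[OF assms] by simp

text \<open>
  Extends the additivity of oriented segment integrals from ordered to arbitrary triples of endpoints.
\<close>

lemma additive_if_additive_on_ordered:
  fixes H :: "real \<Rightarrow> real \<Rightarrow> complex"
  assumes split: "\<And>u v w. u \<in> I \<Longrightarrow> v \<in> I \<Longrightarrow> w \<in> I \<Longrightarrow> u \<le> v \<Longrightarrow> v \<le> w \<Longrightarrow> H u w = H u v + H v w"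
    and rev: "\<And>u v. u \<in> I \<Longrightarrow> v \<in> I \<Longrightarrow> H v u = - H u v"
    and I: "u \<in> I" "v \<in> I" "w \<in> I"
  shows "H u w = H u v + H v w"
proof -
  note r = rev[OF I(1,2)] rev[OF I(2,3)] rev[OF I(1,3)]
  consider "u \<le> v" "v \<le> w" | "u \<le> w" "w \<le> v" | "v \<le> u" "u \<le> w" | "v \<le> w" "w \<le> u"
    | "w \<le> u" "u \<le> v" | "w \<le> v" "v \<le> u" by linarith
  then show ?thesis
  proof cases
    case 1 then show ?thesis using split I by blast
  next
    case 2 then have "H u v = H u w + H w v" using split I by blast
    then show ?thesis using r by (auto simp: complex_eq_iff)
  next
    case 3 then have "H v w = H v u + H u w" using split I by blast
    then show ?thesis using r by (auto simp: complex_eq_iff)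
  next
    case 4 then have "H v u = H v w + H w u" using split I by blast
    then show ?thesis using r by (auto simp: complex_eq_iff)
  next
    case 5 then have "H w v = H w u + H u v" using split I by blast
    then show ?thesis using r by (auto simp: complex_eq_iff)
  next
    case 6 then have "H w u = H w v + H v u" using split I by blast
    then show ?thesis using r by (auto simp: complex_eq_iff)
  qed
qed

text \<open>
  Vanishing rectangle integrals give a primitive: integrate first horizontally, then vertically, from a
  base point.  The derivative of a holomorphic function is holomorphic.
\<close>

lemma holomorphic_on_box_if_covered:
  assumes cov: "linearly_covered C" and f: "continuous_on (box p q) f"
    and hol: "\<And>z. z \<in> box p q - C \<Longrightarrow> f field_differentiable at z"
  shows "f holomorphic_on box p q"
proof (cases "box p q = {}")
  case True
  then show ?thesis by (simp add: holomorphic_on_def)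
next
  case False
  then obtain z0 where z0: "z0 \<in> box p q" by blast
  define X where "X = {Re p<..<Re q}"
  define Y where "Y = {Im p<..<Im q}"
  have inB: "Complex x y \<in> box p q \<longleftrightarrow> x \<in> X \<and> y \<in> Y" for x y
    by (auto simp: in_box_complex_iff X_def Y_def)
  have inB': "z \<in> box p q \<longleftrightarrow> Re z \<in> X \<and> Im z \<in> Y" for z
    by (auto simp: in_box_complex_iff X_def Y_def)
  have cb: "cbox (Complex a c) (Complex b d) \<subseteq> box p q" if "a \<in> X" "b \<in> X" "c \<in> Y" "d \<in> Y" for a b c d
    using that by (auto simp: in_box_complex_iff in_cbox_complex_iff X_def Y_def)
  have seg: "closed_segment u v \<subseteq> box p q" if "u \<in> box p q" "v \<in> box p q" for u v
    using that by (intro closed_segment_subset convex_box)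
  have cont: "continuous_on (closed_segment u v) f" if "u \<in> box p q" "v \<in> box p q" for u v
    by (rule continuous_on_subset[OF f seg[OF that]])
  have hrev: "hseg f x' x y = - hseg f x x' y" if "x \<in> X" "x' \<in> X" "y \<in> Y" for x x' y
    by (rule hseg_rev, rule cont) (use that in \<open>auto simp: inB\<close>)
  have vrev: "vseg f x y' y = - vseg f x y y'" if "x \<in> X" "y \<in> Y" "y' \<in> Y" for x y y'
    by (rule vseg_rev, rule cont) (use that in \<open>auto simp: inB\<close>)
  have hadd: "hseg f x x' y = hseg f x x'' y + hseg f x'' x' y" if "x \<in> X" "x' \<in> X" "x'' \<in> X" "y \<in> Y" for x x' x'' y
  proof (rule additive_if_additive_on_ordered[where I = X])
    fix u v w assume "u \<in> X" "v \<in> X" "w \<in> X" "u \<le> v" "v \<le> w"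
    then show "hseg f u w y = hseg f u v y + hseg f v w y"
      using that by (intro hseg_split[where a = u and b = w and c = y and d = y]
          continuous_on_subset[OF f cb]) auto
  qed (use that hrev in blast)+
  have vadd: "vseg f x y y' = vseg f x y y'' + vseg f x y'' y'" if "y \<in> Y" "y' \<in> Y" "y'' \<in> Y" "x \<in> X" for y y' y'' x
  proof (rule additive_if_additive_on_ordered[where I = Y])
    fix u v w assume "u \<in> Y" "v \<in> Y" "w \<in> Y" "u \<le> v" "v \<le> w"
    then show "vseg f x u w = vseg f x u v + vseg f x v w"
      using that by (intro vseg_split[where c = u and d = w and a = x and b = x]
          continuous_on_subset[OF f cb]) auto
  qed (use that vrev in blast)+
  have rect_le: "rect_integral f x x' y y' = 0" if "x \<in> X" "x' \<in> X" "y \<in> Y" "y' \<in> Y" "x \<le> x'" "y \<le> y'" for x x' y y'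
  proof (rule rect_integral_eq_0[OF cov])
    have sub: "cbox (Complex x y) (Complex x' y') \<subseteq> box p q" using that by (intro cb)
    then show "continuous_on (cbox (Complex x y) (Complex x' y')) f" by (rule continuous_on_subset[OF f])
    fix z assume "z \<in> box (Complex x y) (Complex x' y') - C"
    then show "f field_differentiable at z" using sub hol box_subset_cbox by blast
  qed (use that in auto)
  have rect: "rect_integral f x x' y y' = 0" if "x \<in> X" "x' \<in> X" "y \<in> Y" "y' \<in> Y" for x x' y y'
  proof -
    have sx: "rect_integral f x' x y y' = - rect_integral f x x' y y'" if "x \<in> X" "x' \<in> X" "y \<in> Y" "y' \<in> Y" for x x' y y'
      using that hrev[of x x' y] hrev[of x x' y'] by (simp add: rect_integral_def)
    have sy: "rect_integral f x x' y' y = - rect_integral f x x' y y'" if "x \<in> X" "x' \<in> X" "y \<in> Y" "y' \<in> Y" for x x' y y'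
      using that vrev[of x y y'] vrev[of x' y y'] by (simp add: rect_integral_def)
    consider "x \<le> x'" "y \<le> y'" | "x' \<le> x" "y \<le> y'" | "x \<le> x'" "y' \<le> y" | "x' \<le> x" "y' \<le> y" by linarith
    then show ?thesis
    proof cases
      case 1 then show ?thesis using rect_le that by blast
    next
      case 2 then show ?thesis using rect_le[of x' x y y'] sx[of x' x y y'] that by simp
    next
      case 3 then show ?thesis using rect_le[of x x' y' y] sy[of x x' y' y] that by simp
    next
      case 4 then show ?thesis using rect_le[of x' x y' y] sx[of x' x y y'] sy[of x' x y' y] that by simp
    qed
  qed
  define G where "G z = hseg f (Re z0) (Re z) (Im z0) + vseg f (Re z) (Im z0) (Im z)" for z
  have Gdiff: "G w - G z = contour_integral (linepath z (Complex (Re w) (Im z))) f +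
      contour_integral (linepath (Complex (Re w) (Im z)) w) f" if "z \<in> box p q" "w \<in> box p q" for z w
  proof -
    have i: "Re z \<in> X" "Im z \<in> Y" "Re w \<in> X" "Im w \<in> Y" "Re z0 \<in> X" "Im z0 \<in> Y"
      using that z0 by (auto simp: inB')
    have "G w - G z = hseg f (Re z) (Re w) (Im z) + vseg f (Re w) (Im z) (Im w)"
      using rect[of "Re z" "Re w" "Im z0" "Im z"] hadd[of "Re z0" "Re w" "Re z" "Im z0"]
        vadd[of "Im z0" "Im w" "Im z" "Re w"] i
      by (simp add: G_def rect_integral_def algebra_simps)
    then show ?thesis by (simp add: hseg_def vseg_def)
  qed
  have "(G has_field_derivative f z) (at z)" if z: "z \<in> box p q" for z
    unfolding has_field_derivative_iff
  proof (rule tendstoI)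
    fix e :: real assume e: "e > 0"
    have "isCont f z" using f z continuous_on_eq_continuous_at[OF open_box] by blast
    then obtain \<delta> where \<delta>: "\<delta> > 0" "\<And>w. dist w z < \<delta> \<Longrightarrow> dist (f w) (f z) < e / 3"
      using e unfolding continuous_at_eps_delta by (metis zero_less_divide_iff zero_less_numeral)
    obtain r where r: "r > 0" "ball z r \<subseteq> box p q" using z open_box open_contains_ball by blast
    define s where "s = min \<delta> r"
    have s: "s > 0" "ball z s \<subseteq> box p q" using \<delta> r by (auto simp: s_def)
    show "\<forall>\<^sub>F w in at z. dist ((G w - G z) / (w - z)) (f z) < e"
      unfolding eventually_at
    proof (intro exI[of _ s] conjI ballI impI s(1))
      fix w assume w: "w \<noteq> z \<and> dist w z < s"
      define c where "c = Complex (Re w) (Im z)"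
      have nc: "norm (c - z) \<le> norm (w - z)" "norm (w - c) \<le> norm (w - z)"
        by (auto simp: c_def cmod_def intro!: real_sqrt_le_mono)
      then have cw: "c \<in> ball z s" "w \<in> ball z s" "z \<in> ball z s"
        using w s by (auto simp: dist_norm norm_minus_commute)
      have part: "norm (contour_integral (linepath u v) f - f z * (v - u)) \<le> e / 3 * norm (v - u)"
        if uv: "u \<in> ball z s" "v \<in> ball z s" for u v
      proof -
        have sub: "closed_segment u v \<subseteq> ball z s" using uv by (intro closed_segment_subset) auto
        have ci: "continuous_on (closed_segment u v) f" by (rule continuous_on_subset[OF f]) (use sub s in blast)
        have "contour_integral (linepath u v) (\<lambda>x. f x - f z) =
            contour_integral (linepath u v) f - contour_integral (linepath u v) (\<lambda>x. f z)"
          by (intro contour_integral_diff contour_integrable_continuous_linepath ci continuous_on_const)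
        moreover have "contour_integral (linepath u v) (\<lambda>x. f z) = f z * (v - u)"
          by (intro contour_integral_unique has_contour_integral_const_linepath)
        moreover have "norm (contour_integral (linepath u v) (\<lambda>x. f x - f z)) \<le> e / 3 * norm (v - u)"
        proof (rule contour_integral_bound_linepath)
          show "(\<lambda>x. f x - f z) contour_integrable_on linepath u v"
            by (intro contour_integrable_continuous_linepath continuous_intros ci)
          fix x assume "x \<in> closed_segment u v"
          then have "dist x z < \<delta>" using sub by (auto simp: s_def dist_commute)
          then show "norm (f x - f z) \<le> e / 3" using \<delta>(2)[of x] by (simp add: dist_norm)
        qed (use e in auto)
        ultimately show ?thesis by simp
      qed
      have "G w - G z - f z * (w - z) = (contour_integral (linepath z c) f - f z * (c - z)) +
          (contour_integral (linepath c w) f - f z * (w - c))"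
        using Gdiff[OF z, of w] cw s by (auto simp: c_def algebra_simps)
      also have "norm \<dots> \<le> e / 3 * norm (c - z) + e / 3 * norm (w - c)"
        by (intro order.trans[OF norm_triangle_ineq] add_mono part cw)
      also have "\<dots> \<le> e / 3 * norm (w - z) + e / 3 * norm (w - z)"
        using e nc by (intro add_mono mult_left_mono) auto
      also have "\<dots> < e * norm (w - z)" using e w by simp
      finally have "norm (G w - G z - f z * (w - z)) < e * norm (w - z)" .
      then have "norm (G w - G z - f z * (w - z)) / norm (w - z) < e" using w by (simp add: divide_less_eq)
      moreover have "(G w - G z) / (w - z) - f z = (G w - G z - f z * (w - z)) / (w - z)"
        using w by (simp add: field_simps)
      ultimately show "dist ((G w - G z) / (w - z)) (f z) < e"
        by (simp add: dist_norm norm_divide)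
    qed
  qed
  then show ?thesis by (rule derivative_is_holomorphic[OF open_box])
qed

lemma linearly_covered_lipschitz_image:
  fixes g :: "real \<Rightarrow> complex"
  assumes lip: "\<And>x y. x \<in> {s..t} \<Longrightarrow> y \<in> {s..t} \<Longrightarrow> dist (g x) (g y) \<le> B * \<bar>x - y\<bar>" and "0 \<le> B" "s < t"
  shows "linearly_covered (g ` {s..t})"
  unfolding linearly_covered_def
proof (intro exI[of _ "B * (t - s)"] conjI allI impI)
  fix n :: nat assume n: "0 < n"
  show "\<exists>w. g ` {s..t} \<subseteq> (\<Union>i<n. cball (w i) (B * (t - s) / real n))"
  proof (intro exI[of _ "\<lambda>i. g (s + (t - s) * real i / n)"] subsetI)
    fix z assume "z \<in> g ` {s..t}"
    then obtain x where x: "x \<in> {s..t}" "z = g x" by blast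
    define r where "r = (x - s) * n / (t - s)"
    have r: "0 \<le> r" "r \<le> n" using x n assms by (auto simp: r_def field_simps)
    have xr: "x = s + (t - s) * r / n" using n assms by (simp add: r_def)
    obtain i where i: "i < n" "real i \<le> r" "r \<le> real i + 1"
    proof (cases "r < n")
      case True
      then have "nat \<lfloor>r\<rfloor> < n" using r by linarith
      moreover have "real (nat \<lfloor>r\<rfloor>) \<le> r" "r \<le> real (nat \<lfloor>r\<rfloor>) + 1" using r by linarith+
      ultimately show ?thesis using that by blast
    next
      case False
      then show ?thesis using that[of "n - 1"] r n by (simp add: of_nat_diff)
    qed
    define y where "y = s + (t - s) * real i / n"
    have "(t - s) * real i \<le> (t - s) * n" using i assms by (intro mult_left_mono) auto
    then have "(t - s) * real i / n \<le> t - s" using n by (simp add: divide_le_eq)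
    moreover have "0 \<le> (t - s) * real i / n" using assms by simp
    ultimately have y: "y \<in> {s..t}" by (simp add: y_def)
    have "x - y = (t - s) * (r - real i) / n" unfolding xr y_def using n by (simp add: field_simps)
    moreover have "0 \<le> (t - s) * (r - real i)" "(t - s) * (r - real i) \<le> (t - s) * 1"
      using i assms by (auto intro: mult_left_mono)
    ultimately have "\<bar>x - y\<bar> \<le> (t - s) / n" using n by (auto simp: divide_right_mono)
    have "dist (g y) z \<le> B * \<bar>x - y\<bar>" using lip[OF y x(1)] x by (simp add: abs_minus_commute)
    also have "\<dots> \<le> B * ((t - s) / n)" by (rule mult_left_mono) (use \<open>\<bar>x - y\<bar> \<le> (t - s) / n\<close> assms in auto)
    finally show "z \<in> (\<Union>i<n. cball (g (s + (t - s) * real i / n)) (B * (t - s) / real n))"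
      using i by (auto simp: y_def)
  qed
qed (use assms in auto)

lemma linearly_covered_C1_image:
  fixes g :: "real \<Rightarrow> complex"
  assumes D: "\<And>x. x \<in> {s..t} \<Longrightarrow> (g has_vector_derivative D x) (at x)" "continuous_on {s..t} D" and "s < t"
  shows "linearly_covered (g ` {s..t})"
proof -
  have "bounded (D ` {s..t})" by (intro compact_imp_bounded compact_continuous_image D) simp
  then obtain B where B: "B > 0" "\<And>x. x \<in> {s..t} \<Longrightarrow> norm (D x) \<le> B"
    by (auto simp: bounded_pos)
  show ?thesis
  proof (rule linearly_covered_lipschitz_image[OF _ less_imp_le[OF B(1)] assms(3)])
    fix x y assume xy: "x \<in> {s..t}" "y \<in> {s..t}"
    have "norm (g x - g y) \<le> B * norm (x - y)"
    proof (rule differentiable_bound[OF _ _ _ xy])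
      fix u assume u: "u \<in> {s..t}"
      show "(g has_derivative (\<lambda>h. h *\<^sub>R D u)) (at u within {s..t})"
        using D(1)[OF u] by (simp add: has_vector_derivative_def has_derivative_at_withinI)
      show "onorm (\<lambda>h. h *\<^sub>R D u) \<le> B"
        by (rule onorm_le) (use mult_left_mono[OF B(2)[OF u] abs_ge_zero] in \<open>auto simp: mult.commute\<close>)
    qed simp
    then show "dist (g x) (g y) \<le> B * \<bar>x - y\<bar>" by (simp add: dist_norm)
  qed
qed

text \<open>
  The derivative of a valid path may be unbounded near the finitely many exceptional parameters, and
  the path need not be rectifiable there.  Near every other point the path is Lipschitz, and
  simplicity keeps the rest of the curve away; the finitely many exceptional points are isolated
  singularities at which the function is continuous.
\<close>

lemma holomorphic_on_across_simple_path:
  assumes \<gamma>: "valid_path \<gamma>" "simple_path \<gamma>" and \<Omega>: "open \<Omega>" and f: "continuous_on \<Omega> f"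
    and hol: "f holomorphic_on \<Omega> - path_image \<gamma>"
  shows "f holomorphic_on \<Omega>"
proof -
  obtain S D where S: "finite S" and D: "\<And>x. x \<in> {0..1} - S \<Longrightarrow> (\<gamma> has_vector_derivative D x) (at x)"
      "continuous_on ({0..1} - S) D"
    using \<gamma>(1) unfolding valid_path_def piecewise_C1_differentiable_on_def C1_differentiable_on_def by blast
  have cont: "continuous_on {0..1} \<gamma>" using \<gamma>(1) valid_path_imp_path path_def by blast
  define K where "K = \<gamma> ` (S \<union> {0, 1})"
  have K: "finite K" using S by (simp add: K_def)
  have "f field_differentiable at z" if z: "z \<in> \<Omega> - K" for z
  proof (cases "z \<in> path_image \<gamma>")
    case False
    have "open (\<Omega> - path_image \<gamma>)" using \<Omega> \<gamma> by (simp add: open_Diff closed_path_image valid_path_imp_path)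
    then show ?thesis using False z hol holomorphic_on_imp_differentiable_at by blast
  next
    case True
    then obtain t where t: "t \<in> {0..1}" "z = \<gamma> t" by (auto simp: path_image_def)
    then have "t \<in> {0<..<1} - S" using z by (auto simp: K_def order_le_less)
    moreover have "open ({0<..<1} - S)" using S by (intro open_Diff finite_imp_closed) auto
    ultimately obtain e where e: "e > 0" "cball t e \<subseteq> {0<..<1} - S"
      using open_contains_cball by blast
    define J where "J = {t - e..t + e}"
    have J: "J \<subseteq> {0<..<1} - S" using e by (simp add: J_def cball_eq_atLeastAtMost)
    \<comment> \<open>the part of the curve away from the parameter \<open>t\<close>; it is compact and misses \<open>z\<close>\<close>
    define R where "R = \<gamma> ` ({0..1} - {t - e<..<t + e})"
    have "compact ({0..1} - {t - e<..<t + e})" by (intro compact_diff) auto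
    then have "compact R" unfolding R_def
      by (intro compact_continuous_image continuous_on_subset[OF cont]) auto
    then have "open (\<Omega> - R)" using \<Omega> by (simp add: open_Diff compact_imp_closed)
    moreover have "z \<notin> R"
    proof
      assume "z \<in> R"
      then obtain t' where t': "t' \<in> {0..1}" "t' \<notin> {t - e<..<t + e}" "\<gamma> t' = \<gamma> t"
        using t by (auto simp: R_def)
      then have "t' = t \<or> t' = 0 \<and> t = 1 \<or> t' = 1 \<and> t = 0"
        using \<gamma>(2) t unfolding simple_path_def loop_free_def by blast
      moreover have "t \<in> J" using e by (simp add: J_def)
      then have "t \<in> {0<..<1}" using J by blast
      ultimately show False using t' e by auto
    qed
    ultimately obtain r where r: "r > 0" "ball z r \<subseteq> \<Omega> - R" using z open_contains_ball by blast
    obtain p q where pq: "z \<in> box p q" "box p q \<subseteq> ball z r" using rational_boxes[OF r(1), of z] by blast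
    have "f holomorphic_on box p q"
    proof (rule holomorphic_on_box_if_covered)
      show "linearly_covered (\<gamma> ` J)" unfolding J_def
        by (rule linearly_covered_C1_image[where D = D])
           (use J e D in \<open>auto simp: J_def subset_iff intro!: continuous_on_subset[OF D(2)]\<close>)
      show "continuous_on (box p q) f" using f pq r by (meson Diff_subset continuous_on_subset order_trans)
      fix x assume x: "x \<in> box p q - \<gamma> ` J"
      then have "x \<in> \<Omega> - R" using pq r by blast
      moreover have "path_image \<gamma> \<subseteq> R \<union> \<gamma> ` J" by (auto simp: path_image_def R_def J_def)
      ultimately have "x \<in> \<Omega> - path_image \<gamma>" using x by blast
      moreover have "open (\<Omega> - path_image \<gamma>)" using \<Omega> \<gamma> by (simp add: open_Diff closed_path_image valid_path_imp_path)
      ultimately show "f field_differentiable at x" using hol holomorphic_on_imp_differentiable_at by blast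
    qed
    then show ?thesis using pq holomorphic_on_imp_differentiable_at open_box by blast
  qed
  then have "f holomorphic_on \<Omega> - K" 
    unfolding holomorphic_on_def using field_differentiable_at_within by blast
  then show ?thesis by (rule no_isolated_singularity[OF f _ \<Omega> K])
qed

section \<open>Fredholm determinants of kernels with finitely many rows\<close>

text \<open>
  The Leibniz formula for the submatrix with rows and columns in \<open>I\<close>, free of any enumeration of \<open>I\<close>.
\<close>

definition principal_minor :: "(int \<Rightarrow> int \<Rightarrow> complex) \<Rightarrow> int set \<Rightarrow> complex" where
  "principal_minor A I = (\<Sum>\<sigma> | \<sigma> permutes I. of_int (sign \<sigma>) * (\<Prod>i\<in>I. A i (\<sigma> i)))"

text \<open>
  Conjugation by the enumeration \<open>n\<close> is a sign-preserving bijection between the permutations of the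
  positions and those of the index set; in particular the value is independent of the enumeration.
\<close>

lemma det_mat_eq_principal_minor:
  fixes A :: "int \<Rightarrow> int \<Rightarrow> complex" and n :: "nat \<Rightarrow> int"
  assumes inj: "inj_on n {0..<p}"
  shows "Determinant.det (Matrix.mat p p (\<lambda>(i, j). A (n i) (n j))) = principal_minor A (n ` {0..<p})"
proof -
  let ?S = "{0..<p}" and ?T = "n ` {0..<p}"
  have bij: "bij_betw n ?S ?T" using inj by (simp add: bij_betw_def)
  have bij': "bij_betw (inv_into ?S n) ?T ?S" by (rule bij_betw_inv_into[OF bij])
  have "Determinant.det (Matrix.mat p p (\<lambda>(i, j). A (n i) (n j))) =
      (\<Sum>\<sigma> | \<sigma> permutes ?S. of_int (sign \<sigma>) * (\<Prod>i\<in>?S. A (n i) (n (\<sigma> i))))"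
    by (subst Determinant.det_def'[where n = p])
       (auto intro!: sum.cong prod.cong simp: permutes_in_image dest: permutes_nat_less)
  also have "\<dots> = principal_minor A ?T"
    unfolding principal_minor_def
  proof (rule sum.reindex_bij_witness[where j = "map_permutation ?S n" and i = "map_permutation ?T (inv_into ?S n)"])
    fix \<sigma> assume "\<sigma> \<in> {\<sigma>. \<sigma> permutes ?S}"
    then have \<sigma>: "\<sigma> permutes ?S" by simp
    show "map_permutation ?T (inv_into ?S n) (map_permutation ?S n \<sigma>) = \<sigma>"
      by (rule map_permutation_compose_inv[OF bij \<sigma>]) (simp add: inj)
    show "map_permutation ?S n \<sigma> \<in> {\<sigma>. \<sigma> permutes ?T}"
      using map_permutation_permutes[OF bij \<sigma>] by simp
    have "(\<Prod>i\<in>?T. A i (map_permutation ?S n \<sigma> i)) = (\<Prod>i\<in>?S. A (n i) (map_permutation ?S n \<sigma> (n i)))"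
      by (simp add: prod.reindex[OF inj])
    also have "\<dots> = (\<Prod>i\<in>?S. A (n i) (n (\<sigma> i)))"
      by (intro prod.cong refl) (simp add: map_permutation_apply[OF inj])
    finally show "of_int (sign (map_permutation ?S n \<sigma>)) * (\<Prod>i\<in>?T. A i (map_permutation ?S n \<sigma> i)) =
        of_int (sign \<sigma>) * (\<Prod>i\<in>?S. A (n i) (n (\<sigma> i)))"
      by (simp add: sign_map_permutation[OF inj \<sigma>])
  next
    fix \<tau> assume "\<tau> \<in> {\<sigma>. \<sigma> permutes ?T}"
    then have \<tau>: "\<tau> permutes ?T" by simp
    show "map_permutation ?S n (map_permutation ?T (inv_into ?S n) \<tau>) = \<tau>"
      by (rule map_permutation_compose_inv[OF bij' \<tau>]) (simp add: f_inv_into_f)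
    show "map_permutation ?T (inv_into ?S n) \<tau> \<in> {\<sigma>. \<sigma> permutes ?S}"
      using map_permutation_permutes[OF bij' \<tau>] by simp
  qed
  finally show ?thesis .
qed

text \<open>
  Expand every factor of the Leibniz formula.  Choosing the identity off \<open>I\<close> forces the permutation to
  fix these points, so it is a permutation of \<open>I\<close>.
\<close>

lemma principal_minor_identity_minus:
  assumes S: "finite S"
  shows "principal_minor (\<lambda>i j. of_bool (i = j) - L i j) S = (\<Sum>I\<in>Pow S. (- 1) ^ card I * principal_minor L I)"
proof -
  have "principal_minor (\<lambda>i j. of_bool (i = j) - L i j) S =
      (\<Sum>\<sigma> | \<sigma> permutes S. of_int (sign \<sigma>) * (\<Prod>i\<in>S. - L i (\<sigma> i) + of_bool (i = \<sigma> i)))"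
    by (simp add: principal_minor_def)
  also have "\<dots> = (\<Sum>\<sigma> | \<sigma> permutes S. \<Sum>I\<in>Pow S. of_int (sign \<sigma>) *
      ((\<Prod>i\<in>I. - L i (\<sigma> i)) * (\<Prod>i\<in>S - I. of_bool (i = \<sigma> i))))"
    by (simp only: prod_add[OF S] sum_distrib_left)
  also have "\<dots> = (\<Sum>I\<in>Pow S. \<Sum>\<sigma> | \<sigma> permutes S. of_int (sign \<sigma>) *
      ((\<Prod>i\<in>I. - L i (\<sigma> i)) * (\<Prod>i\<in>S - I. of_bool (i = \<sigma> i))))"
    by (rule sum.swap)
  also have "\<dots> = (\<Sum>I\<in>Pow S. (- 1) ^ card I * principal_minor L I)"
  proof (intro sum.cong refl)
    fix I assume "I \<in> Pow S"
    then have I: "I \<subseteq> S" "finite I" using S finite_subset by auto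
    have "(\<Sum>\<sigma> | \<sigma> permutes S. of_int (sign \<sigma>) * ((\<Prod>i\<in>I. - L i (\<sigma> i)) * (\<Prod>i\<in>S - I. of_bool (i = \<sigma> i)))) =
        (\<Sum>\<sigma> | \<sigma> permutes I. of_int (sign \<sigma>) * ((\<Prod>i\<in>I. - L i (\<sigma> i)) * (\<Prod>i\<in>S - I. of_bool (i = \<sigma> i))))"
    proof (rule sum.mono_neutral_right)
      show "finite {\<sigma>. \<sigma> permutes S}" by (rule finite_permutations[OF S])
      show "{\<sigma>. \<sigma> permutes I} \<subseteq> {\<sigma>. \<sigma> permutes S}" using permutes_subset I by blast
      show "\<forall>\<sigma>\<in>{\<sigma>. \<sigma> permutes S} - {\<sigma>. \<sigma> permutes I}. of_int (sign \<sigma>) *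
          ((\<Prod>i\<in>I. - L i (\<sigma> i)) * (\<Prod>i\<in>S - I. of_bool (i = \<sigma> i))) = 0"
      proof
        fix \<sigma> assume "\<sigma> \<in> {\<sigma>. \<sigma> permutes S} - {\<sigma>. \<sigma> permutes I}"
        then obtain i where "i \<in> S - I" "\<sigma> i \<noteq> i" using permutes_superset by blast
        then have "(\<Prod>i\<in>S - I. of_bool (i = \<sigma> i)) = (0 :: complex)"
          using S by (intro prod_zero) (auto intro!: bexI[of _ i])
        then show "of_int (sign \<sigma>) * ((\<Prod>i\<in>I. - L i (\<sigma> i)) * (\<Prod>i\<in>S - I. of_bool (i = \<sigma> i))) = 0"
          by simp
      qed
    qed
    also have "\<dots> = (\<Sum>\<sigma> | \<sigma> permutes I. (- 1) ^ card I * (of_int (sign \<sigma>) * (\<Prod>i\<in>I. L i (\<sigma> i))))"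
    proof (intro sum.cong refl)
      fix \<sigma> assume "\<sigma> \<in> {\<sigma>. \<sigma> permutes I}"
      then have "(\<Prod>i\<in>S - I. of_bool (i = \<sigma> i)) = (1 :: complex)"
        by (intro prod.neutral) (auto simp: permutes_not_in)
      moreover have "(\<Prod>i\<in>I. - L i (\<sigma> i)) = (- 1) ^ card I * (\<Prod>i\<in>I. L i (\<sigma> i))"
        by (simp add: prod_uminus)
      ultimately show "of_int (sign \<sigma>) * ((\<Prod>i\<in>I. - L i (\<sigma> i)) * (\<Prod>i\<in>S - I. of_bool (i = \<sigma> i))) =
          (- 1) ^ card I * (of_int (sign \<sigma>) * (\<Prod>i\<in>I. L i (\<sigma> i)))" by simp
    qed
    finally show "(\<Sum>\<sigma> | \<sigma> permutes S. of_int (sign \<sigma>) *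
        ((\<Prod>i\<in>I. - L i (\<sigma> i)) * (\<Prod>i\<in>S - I. of_bool (i = \<sigma> i)))) = (- 1) ^ card I * principal_minor L I"
      by (simp add: principal_minor_def sum_distrib_left)
  qed
  finally show ?thesis .
qed

lemma card_inj_tuples:
  assumes "finite I" "card I = p"
  shows "card {n \<in> {0..<p} \<rightarrow>\<^sub>E I. inj_on n {0..<p}} = fact p"
proof -
  have "card {n \<in> {0..<p} \<rightarrow>\<^sub>E I. inj_on n {0..<p}} = (\<Prod>i\<in>{0..<p}. p - i)"
    using card_inj_on_subset_funcset[of "{0..<p}" I "{0..<p}"] assms by simp
  then show ?thesis using fact_prod_rev[of p, where ?'a = nat] by simp
qed

text \<open>
  Tuples with a repetition or with an entry above \<open>M\<close> give zero determinants; each remaining \<open>p\<close>-element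
  index set is enumerated by \<open>p!\<close> tuples with the same determinant.
\<close>

lemma fredholm_minor_sum_eq:
  fixes L :: "int \<Rightarrow> int \<Rightarrow> complex"
  assumes rows: "\<And>i j. i > M \<Longrightarrow> j \<ge> k \<Longrightarrow> L i j = 0"
  shows "fredholm_minor_sum L k p = fact p * (\<Sum>I | I \<subseteq> {k..M} \<and> card I = p. principal_minor L I)"
proof -
  let ?D = "\<lambda>n. Determinant.det (Matrix.mat p p (\<lambda>(i, j). L (n i) (n j)))"
  define T where "T = {n \<in> {0..<p} \<rightarrow>\<^sub>E {k..M}. inj_on n {0..<p}}"
  have T: "finite T" unfolding T_def by (intro finite_subset[OF _ finite_PiE[of "{0..<p}" "\<lambda>_. {k..M}"]]) auto
  have "fredholm_minor_sum L k p = infsum ?D T"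
    unfolding fredholm_minor_sum_def
  proof (rule infsum_cong_neutral)
    fix n assume n: "n \<in> ({0..<p} \<rightarrow>\<^sub>E {k..}) - T"
    show "?D n = 0"
    proof (cases "inj_on n {0..<p}")
      case True
      with n obtain i where i: "i < p" "n i > M" unfolding T_def by (force simp: PiE_iff)
      have "L (n i) (n j) = 0" if "j < p" for j using n i that by (intro rows) (auto simp: PiE_iff)
      then show ?thesis using i
        by (subst Determinant.det_def'[where n = p])
           (auto intro!: sum.neutral prod_zero bexI[of _ i] dest: permutes_nat_less)
    next
      case False
      then obtain i j where ij: "i < p" "j < p" "i \<noteq> j" "n i = n j" by (auto simp: inj_on_def)
      show ?thesis
        by (rule Determinant.det_identical_rows[of _ p i j]) (use ij in auto)
    qed
  qed (auto simp: T_def PiE_iff)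
  also have "\<dots> = (\<Sum>n\<in>T. ?D n)" by (rule infsum_finite[OF T])
  also have "\<dots> = (\<Sum>I | I \<subseteq> {k..M} \<and> card I = p. \<Sum>n\<in>{n \<in> T. n ` {0..<p} = I}. ?D n)"
  proof (rule sum.group[symmetric, OF T])
    show "finite {I. I \<subseteq> {k..M} \<and> card I = p}" by (rule finite_subset[of _ "Pow {k..M}"]) auto
    show "(\<lambda>n. n ` {0..<p}) ` T \<subseteq> {I. I \<subseteq> {k..M} \<and> card I = p}"
      by (auto simp: T_def card_image PiE_iff)
  qed
  also have "\<dots> = (\<Sum>I | I \<subseteq> {k..M} \<and> card I = p. fact p * principal_minor L I)"
  proof (intro sum.cong refl)
    fix I assume "I \<in> {I. I \<subseteq> {k..M} \<and> card I = p}"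
    then have I: "I \<subseteq> {k..M}" "card I = p" "finite I" by (auto intro: finite_subset)
    have eq: "{n \<in> T. n ` {0..<p} = I} = {n \<in> {0..<p} \<rightarrow>\<^sub>E I. inj_on n {0..<p}}"
    proof (intro equalityI subsetI)
      fix n assume "n \<in> {n \<in> T. n ` {0..<p} = I}"
      then show "n \<in> {n \<in> {0..<p} \<rightarrow>\<^sub>E I. inj_on n {0..<p}}" by (auto simp: T_def PiE_iff)
    next
      fix n assume n: "n \<in> {n \<in> {0..<p} \<rightarrow>\<^sub>E I. inj_on n {0..<p}}"
      then have "n ` {0..<p} \<subseteq> I" "card (n ` {0..<p}) = card I" using I by (auto simp: card_image)
      then have "n ` {0..<p} = I" using I card_subset_eq by blast
      then show "n \<in> {n \<in> T. n ` {0..<p} = I}" using n I by (auto simp: T_def PiE_iff)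
    qed
    have "(\<Sum>n\<in>{n \<in> T. n ` {0..<p} = I}. ?D n) = (\<Sum>n\<in>{n \<in> T. n ` {0..<p} = I}. principal_minor L I)"
      by (intro sum.cong refl) (auto simp: T_def det_mat_eq_principal_minor)
    also have "\<dots> = fact p * principal_minor L I"
      unfolding eq using card_inj_tuples[OF I(3,2)] by simp
    finally show "(\<Sum>n\<in>{n \<in> T. n ` {0..<p} = I}. ?D n) = fact p * principal_minor L I" .
  qed
  finally show ?thesis by (simp add: sum_distrib_left)
qed

lemma fredholm_det_finite_rows:
  fixes L :: "int \<Rightarrow> int \<Rightarrow> complex"
  assumes rows: "\<And>i j. i > M \<Longrightarrow> j \<ge> k \<Longrightarrow> L i j = 0"
  shows "fredholm_det L k = principal_minor (\<lambda>i j. of_bool (i = j) - L i j) {k..M}"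
proof -
  let ?S = "{k..M}"
  let ?F = "\<lambda>I. (- 1) ^ card I * principal_minor L I"
  define c where "c = card ?S"
  have minors: "(- 1) ^ p / fact p * fredholm_minor_sum L k p = (\<Sum>I | I \<subseteq> ?S \<and> card I = p. ?F I)" for p
    by (simp add: fredholm_minor_sum_eq[OF rows] sum_distrib_left)
  have zero: "{I. I \<subseteq> ?S \<and> card I = p} = {}" if "p > c" for p
    using that card_mono[of ?S] by (auto simp: c_def) (metis finite_atLeastAtMost_int leD)
  have "(\<Sum>q. (- 1) ^ Suc q / fact (Suc q) * fredholm_minor_sum L k (Suc q)) =
      (\<Sum>q<c. \<Sum>I | I \<subseteq> ?S \<and> card I = Suc q. ?F I)"
    unfolding minors
  proof (rule suminf_finite)
    fix q assume "q \<notin> {..<c}"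
    then have "{I. I \<subseteq> ?S \<and> card I = Suc q} = {}" by (intro zero) simp
    then show "(\<Sum>I | I \<subseteq> ?S \<and> card I = Suc q. ?F I) = 0" by (simp only: sum.empty)
  qed simp
  moreover have "(\<Sum>I | I \<subseteq> ?S \<and> card I = 0. ?F I) = 1"
  proof -
    have "{I. I \<subseteq> ?S \<and> card I = 0} = {{}}" by (auto dest: finite_subset)
    then show ?thesis by (simp add: principal_minor_def)
  qed
  ultimately have "fredholm_det L k = (\<Sum>p<Suc c. \<Sum>I | I \<subseteq> ?S \<and> card I = p. ?F I)"
    unfolding fredholm_det_def by (subst sum.lessThan_Suc_shift) simp
  also have "\<dots> = (\<Sum>p\<in>{..<Suc c}. \<Sum>I\<in>{I \<in> Pow ?S. card I = p}. ?F I)"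
    by simp
  also have "\<dots> = (\<Sum>I\<in>Pow ?S. ?F I)"
  proof (rule sum.group)
    show "card ` Pow ?S \<subseteq> {..<Suc c}" using card_mono[of ?S] by (auto simp: c_def less_Suc_eq_le simp del: card_atLeastAtMost_int)
  qed auto
  also have "\<dots> = principal_minor (\<lambda>i j. of_bool (i = j) - L i j) ?S"
    by (rule principal_minor_identity_minus[symmetric]) simp
  finally show ?thesis .
qed

lemma fredholm_det_eq_det:
  fixes L :: "int \<Rightarrow> int \<Rightarrow> complex"
  assumes rows: "\<And>i j. i \<ge> k + int s \<Longrightarrow> j \<ge> k \<Longrightarrow> L i j = 0"
  shows "fredholm_det L k = Determinant.det (Matrix.mat s s (\<lambda>(i, j). of_bool (i = j) - L (k + int i) (k + int j)))"
proof -
  have inj: "inj_on (\<lambda>i. k + int i) {0..<s}" by (auto simp: inj_on_def)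
  have "(\<lambda>i. k + int i) ` {0..<s} = {k..k + int s - 1}"
  proof (intro equalityI subsetI)
    fix x assume "x \<in> {k..k + int s - 1}"
    then show "x \<in> (\<lambda>i. k + int i) ` {0..<s}" by (intro image_eqI[of _ _ "nat (x - k)"]) auto
  qed auto
  moreover have "fredholm_det L k = principal_minor (\<lambda>i j. of_bool (i = j) - L i j) {k..k + int s - 1}"
    by (rule fredholm_det_finite_rows) (use rows in auto)
  ultimately show ?thesis
    using det_mat_eq_principal_minor[OF inj, of "\<lambda>i j. of_bool (i = j) - L i j"] by simp
qed

section \<open>The kernel as a finite matrix\<close>

lemma one_plus_mult_eq_0_iff:
  fixes a :: real and z :: complex
  assumes "0 < a"
  shows "1 + of_real a * z = 0 \<longleftrightarrow> z = - 1 / of_real a"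
proof -
  have "1 + of_real a * z = 0 \<longleftrightarrow> of_real a * z = - 1"
    by (metis add.commute eq_neg_iff_add_eq_0)
  also have "\<dots> \<longleftrightarrow> z = - 1 / of_real a"
    using assms by (metis nonzero_eq_divide_eq mult.commute of_real_eq_0_iff less_irrefl)
  finally show ?thesis .
qed

lemma has_contour_integral_powi:
  assumes \<gamma>: "valid_path \<gamma>" "pathfinish \<gamma> = pathstart \<gamma>" "a \<notin> path_image \<gamma>"
  shows "((\<lambda>z. (z - a) powi n) has_contour_integral
      (if n = - 1 then 2 * of_real pi * \<i> * winding_number \<gamma> a else 0)) \<gamma>"
proof (cases "n = - 1")
  case True
  then show ?thesis using has_contour_integral_winding_number[OF \<gamma>(1,3)]
    by (simp add: power_int_minus field_simps)
next
  case False
  then have nz: "of_int (n + 1) \<noteq> (0 :: complex)"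
    unfolding of_int_eq_0_iff by linarith
  have "((\<lambda>z. (z - a) powi n) has_contour_integral 0) \<gamma>"
  proof (rule Cauchy_theorem_primitive[where S = "- {a}" and f = "\<lambda>z. (z - a) powi (n + 1) / of_int (n + 1)"])
    fix x assume "x \<in> - {a}"
    then show "((\<lambda>z. (z - a) powi (n + 1) / of_int (n + 1)) has_field_derivative (x - a) powi n) (at x within - {a})"
      using nz by (auto intro!: derivative_eq_intros)
  qed (use \<gamma> in auto)
  then show ?thesis using False by simp
qed

text \<open>
  Induction on \<open>j\<close> with the partial fraction
  \<open>1 / ((v - a) (u - v)) = (1 / (v - a) + 1 / (u - v)) / (u - a)\<close>.
\<close>

lemma has_contour_integral_pole_times_cauchy:
  assumes \<gamma>: "valid_path \<gamma>" "pathfinish \<gamma> = pathstart \<gamma>" "a \<notin> path_image \<gamma>" "u \<notin> path_image \<gamma>"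
    and w: "winding_number \<gamma> a = 1" "winding_number \<gamma> u = 0"
  shows "((\<lambda>v. 1 / ((v - a) ^ j * (u - v))) has_contour_integral
      (if j = 0 then 0 else 2 * of_real pi * \<i> / (u - a) ^ j)) \<gamma>"
proof (induction j)
  case 0
  have "((\<lambda>v. - (1 / (v - u))) has_contour_integral - (2 * of_real pi * \<i> * winding_number \<gamma> u)) \<gamma>"
    using has_contour_integral_neg[OF has_contour_integral_winding_number[OF \<gamma>(1,4)]] by simp
  then have "((\<lambda>v. 1 / (u - v)) has_contour_integral - (2 * of_real pi * \<i> * winding_number \<gamma> u)) \<gamma>"
    by (rule has_contour_integral_eq) (metis minus_diff_eq minus_divide_right)
  then show ?case using w by simp
next
  case (Suc j)
  have ua: "u \<noteq> a" using w by auto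
  have "((\<lambda>v. (v - a) powi (- int (Suc j))) has_contour_integral
      (if j = 0 then 2 * of_real pi * \<i> else 0)) \<gamma>"
  proof -
    have "- int (Suc j) = - 1 \<longleftrightarrow> j = 0" by auto
    then show ?thesis using has_contour_integral_powi[OF \<gamma>(1-3), of "- int (Suc j)"]
      by (simp only: w mult_1_right cong: if_cong)
  qed
  from has_contour_integral_lmul[OF has_contour_integral_add[OF this Suc.IH], of "1 / (u - a)"]
  have "((\<lambda>v. 1 / (u - a) * ((v - a) powi (- int (Suc j)) + 1 / ((v - a) ^ j * (u - v)))) has_contour_integral
      2 * of_real pi * \<i> / (u - a) ^ Suc j) \<gamma>"
    by (auto simp: mult.commute split: if_splits)
  moreover have "1 / (u - a) * ((v - a) powi (- int (Suc j)) + 1 / ((v - a) ^ j * (u - v))) =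
      1 / ((v - a) ^ Suc j * (u - v))" if "v \<in> path_image \<gamma>" for v
  proof -
    have v: "v - a \<noteq> 0" "u - v \<noteq> 0" "u - a \<noteq> 0" using that \<gamma> ua by auto
    have "(v - a) powi (- int (Suc j)) = 1 / (v - a) ^ Suc j"
      by (simp add: power_int_minus power_int_of_nat divide_inverse del: power_Suc of_nat_Suc)
    moreover have "1 / (v - a) ^ Suc j + 1 / ((v - a) ^ j * (u - v)) = (u - a) / ((v - a) ^ Suc j * (u - v))"
      using v by (simp add: divide_simps)
    ultimately show ?thesis using v by simp
  qed
  ultimately show ?case by (auto intro: has_contour_integral_eq)
qed

text \<open>
  Cauchy's formula outside the contour: a proper fraction with its only pole inside is reproduced at
  exterior points.
\<close>

lemma has_contour_integral_principal_part:
  fixes p :: "complex poly"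
  assumes \<gamma>: "valid_path \<gamma>" "pathfinish \<gamma> = pathstart \<gamma>" "a \<notin> path_image \<gamma>" "u \<notin> path_image \<gamma>"
    and w: "winding_number \<gamma> a = 1" "winding_number \<gamma> u = 0" and p: "degree p \<le> d"
  shows "((\<lambda>v. poly p v / ((v - a) ^ Suc d * (u - v))) has_contour_integral
      2 * of_real pi * \<i> * poly p u / (u - a) ^ Suc d) \<gamma>"
proof -
  define c where "c i = coeff (pcompose p [:a, 1:]) i" for i
  have exp: "poly p v = (\<Sum>i\<le>d. c i * (v - a) ^ i)" for v
  proof -
    have "poly p v = poly (pcompose p [:a, 1:]) (v - a)" by (simp add: poly_pcompose)
    also have "\<dots> = (\<Sum>i\<le>d. c i * (v - a) ^ i)"
      unfolding poly_altdef c_def using p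
      by (intro sum.mono_neutral_left) (auto simp: degree_pcompose coeff_eq_0)
    finally show ?thesis .
  qed
  have red: "c i * (x - a) ^ i / (x - a) ^ Suc d = c i / (x - a) ^ (Suc d - i)" if "i \<le> d" "x \<noteq> a" for i x
  proof -
    have "(x - a) ^ Suc d = (x - a) ^ i * (x - a) ^ (Suc d - i)" using that by (simp flip: power_add power_Suc)
    then show ?thesis using that by simp
  qed
  have ua: "u \<noteq> a" using w by auto
  have "((\<lambda>v. \<Sum>i\<le>d. c i * (1 / ((v - a) ^ (Suc d - i) * (u - v)))) has_contour_integral
      (\<Sum>i\<le>d. c i * (2 * of_real pi * \<i> / (u - a) ^ (Suc d - i)))) \<gamma>"
  proof (intro has_contour_integral_sum has_contour_integral_lmul)
    fix i assume "i \<in> {..d}"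
    then show "((\<lambda>v. 1 / ((v - a) ^ (Suc d - i) * (u - v))) has_contour_integral
        2 * of_real pi * \<i> / (u - a) ^ (Suc d - i)) \<gamma>"
      using has_contour_integral_pole_times_cauchy[OF \<gamma> w, of "Suc d - i"] by (simp split: if_splits)
  qed simp
  moreover have "(\<Sum>i\<le>d. c i * (2 * of_real pi * \<i> / (u - a) ^ (Suc d - i))) =
      2 * of_real pi * \<i> * poly p u / (u - a) ^ Suc d"
  proof -
    have "2 * of_real pi * \<i> * poly p u / (u - a) ^ Suc d =
        (\<Sum>i\<le>d. 2 * of_real pi * \<i> * (c i * (u - a) ^ i / (u - a) ^ Suc d))"
      by (simp add: exp sum_distrib_left sum_divide_distrib del: power_Suc)
    also have "\<dots> = (\<Sum>i\<le>d. c i * (2 * of_real pi * \<i> / (u - a) ^ (Suc d - i)))"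
      using ua by (intro sum.cong refl) (subst red, auto)
    finally show ?thesis by simp
  qed
  moreover have "(\<Sum>i\<le>d. c i * (1 / ((v - a) ^ (Suc d - i) * (u - v)))) =
      poly p v / ((v - a) ^ Suc d * (u - v))" if "v \<in> path_image \<gamma>" for v
  proof -
    have va: "v \<noteq> a" using that \<gamma> by auto
    have "poly p v / ((v - a) ^ Suc d * (u - v)) = (\<Sum>i\<le>d. c i * (v - a) ^ i / (v - a) ^ Suc d / (u - v))"
      by (simp add: exp sum_divide_distrib del: power_Suc)
    also have "\<dots> = (\<Sum>i\<le>d. c i * (1 / ((v - a) ^ (Suc d - i) * (u - v))))"
      using va by (intro sum.cong refl) (subst red, auto)
    finally show ?thesis by simp
  qed
  ultimately show ?thesis by (auto intro: has_contour_integral_eq)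
qed

lemma has_contour_integral_laurent:
  fixes R :: "complex poly"
  assumes \<gamma>: "valid_path \<gamma>" "pathfinish \<gamma> = pathstart \<gamma>" "0 \<notin> path_image \<gamma>" "winding_number \<gamma> 0 = 1"
  shows "((\<lambda>u. poly R u / u ^ Suc l) has_contour_integral 2 * of_real pi * \<i> * coeff R l) \<gamma>"
proof -
  define n where "n = max (degree R) l"
  have exp: "poly R u = (\<Sum>i\<le>n. coeff R i * u ^ i)" for u
    unfolding poly_altdef by (intro sum.mono_neutral_left) (auto simp: n_def coeff_eq_0)
  have "((\<lambda>u. \<Sum>i\<le>n. coeff R i * u powi (int i - int (Suc l))) has_contour_integral
      (\<Sum>i\<le>n. coeff R i * (if i = l then 2 * of_real pi * \<i> else 0))) \<gamma>"
  proof (intro has_contour_integral_sum has_contour_integral_lmul)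
    fix i assume "i \<in> {..n}"
    then show "((\<lambda>u. u powi (int i - int (Suc l))) has_contour_integral (if i = l then 2 * of_real pi * \<i> else 0)) \<gamma>"
      using has_contour_integral_powi[OF \<gamma>(1-3), of "int i - int (Suc l)"] \<gamma>(4)
      by (cases "i = l") (auto split: if_splits)
  qed simp
  moreover have "(\<Sum>i\<le>n. coeff R i * (if i = l then 2 * of_real pi * \<i> else 0)) = 2 * of_real pi * \<i> * coeff R l"
    by (simp add: n_def if_distrib[of "\<lambda>x. _ * x"] cong: if_cong)
  moreover have "(\<Sum>i\<le>n. coeff R i * u powi (int i - int (Suc l))) = poly R u / u ^ Suc l" if "u \<in> path_image \<gamma>" for u
  proof -
    have u: "u \<noteq> 0" using that \<gamma> by auto
    have "u powi (int i - int (Suc l)) = u ^ i / u ^ Suc l" for i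
      using u by (simp add: power_int_diff del: of_nat_Suc power_Suc)
    then show ?thesis by (simp add: exp sum_divide_distrib del: power_Suc)
  qed
  ultimately show ?thesis by (auto intro: has_contour_integral_eq)
qed

text \<open>
  The topology used throughout: the plane is the disjoint union of the inside of the inner curve, the
  inner curve, the annular region, the outer curve and the outside of the outer curve.
\<close>

locale nested_contours =
  fixes \<gamma>1 \<gamma>2 :: "real \<Rightarrow> complex"
  assumes contour1: "positive_contour \<gamma>1" and contour2: "positive_contour \<gamma>2"
    and nested: "path_image \<gamma>1 \<subseteq> inside (path_image \<gamma>2)"
begin

abbreviation "\<Sigma>1 \<equiv> path_image \<gamma>1"
abbreviation "\<Sigma>2 \<equiv> path_image \<gamma>2"

lemmas jordan1 = Jordan_inside_outside[of \<gamma>1]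
lemmas jordan2 = Jordan_inside_outside[of \<gamma>2]

lemma paths:
  "valid_path \<gamma>1" "simple_path \<gamma>1" "pathfinish \<gamma>1 = pathstart \<gamma>1"
  "valid_path \<gamma>2" "simple_path \<gamma>2" "pathfinish \<gamma>2 = pathstart \<gamma>2"
  using contour1 contour2 by (auto simp: positive_contour_def)

lemma notin1: "z \<in> inside \<Sigma>1 \<or> z \<in> outside \<Sigma>1 \<Longrightarrow> z \<notin> \<Sigma>1"
  using inside_no_overlap outside_no_overlap by blast

text \<open>
  The outer curve together with its outside is the closure of a connected set, hence connected; it is
  unbounded and disjoint from the inner curve.
\<close>

lemma outer_subset_outside: "\<Sigma>2 \<union> outside \<Sigma>2 \<subseteq> outside \<Sigma>1"
proof -
  have J1: "inside \<Sigma>1 \<union> outside \<Sigma>1 = - \<Sigma>1" "bounded (inside \<Sigma>1)" using jordan1 paths by auto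
  have J2: "inside \<Sigma>2 \<union> outside \<Sigma>2 = - \<Sigma>2" "connected (outside \<Sigma>2)" "frontier (outside \<Sigma>2) = \<Sigma>2"
    "\<not> bounded (outside \<Sigma>2)" "inside \<Sigma>2 \<inter> outside \<Sigma>2 = {}" using jordan2 paths by auto
  have "closure (outside \<Sigma>2) = \<Sigma>2 \<union> outside \<Sigma>2"
    unfolding closure_Un_frontier J2(3) by blast
  then have conn: "connected (\<Sigma>2 \<union> outside \<Sigma>2)" using connected_imp_connected_closure[OF J2(2)] by simp
  have disj: "\<Sigma>1 \<inter> (\<Sigma>2 \<union> outside \<Sigma>2) = {}" using nested J2 by blast
  have "outside \<Sigma>1 \<inter> (\<Sigma>2 \<union> outside \<Sigma>2) \<noteq> {}"
  proof
    assume "outside \<Sigma>1 \<inter> (\<Sigma>2 \<union> outside \<Sigma>2) = {}"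
    then have "outside \<Sigma>2 \<subseteq> inside \<Sigma>1" using disj J1(1) by blast
    then show False using J1(2) J2(4) bounded_subset by blast
  qed
  then have "inside \<Sigma>1 \<inter> (\<Sigma>2 \<union> outside \<Sigma>2) = {}"
    using inside_outside_intersect_connected[OF conn] disj by blast
  then show ?thesis using disj J1(1) by blast
qed

lemma inner_subset_inside: "\<Sigma>1 \<union> inside \<Sigma>1 \<subseteq> inside \<Sigma>2"
proof -
  have "inside \<Sigma>1 \<union> outside \<Sigma>1 = - \<Sigma>1" "inside \<Sigma>1 \<inter> outside \<Sigma>1 = {}" using jordan1 paths by auto
  moreover have "inside \<Sigma>2 \<union> outside \<Sigma>2 = - \<Sigma>2" using jordan2 paths by auto
  ultimately show ?thesis using outer_subset_outside nested by blast
qed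

lemma winding1: "z \<in> inside \<Sigma>1 \<Longrightarrow> winding_number \<gamma>1 z = 1" "z \<in> outside \<Sigma>1 \<Longrightarrow> winding_number \<gamma>1 z = 0"
  using contour1 paths winding_number_zero_in_outside[of \<gamma>1 z]
  by (auto simp: positive_contour_def valid_path_imp_path)

lemma winding2: "z \<in> inside \<Sigma>2 \<Longrightarrow> winding_number \<gamma>2 z = 1"
  using contour2 by (auto simp: positive_contour_def)

text \<open>
  The polynomial identity splits \<open>v^n' W(v)\<close> into its principal part at \<open>a\<close> and a remainder that is
  holomorphic inside the inner contour.  The integral over \<open>v\<close> keeps only the principal part; dividing
  it by \<open>W(u)\<close> cancels the pole, and the integral over \<open>u\<close> reads off a coefficient.  If \<open>-1/a\<close> lies on
  the outer contour, the conventions for division by zero give \<open>1 / W\<close> its correct value there.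
\<close>

lemma kernel_eq_coeff:
  fixes a :: real and p q :: "complex poly"
  assumes a: "0 < a" "of_real a \<in> inside \<Sigma>1" "of_real (- 1 / a) \<in> outside \<Sigma>1" "0 \<in> inside \<Sigma>2"
    and pq: "monom 1 (n' + (N - m)) = [:1, of_real a:] ^ m * p + [:- of_real a, 1:] ^ Suc (N - m) * q"
      "degree p \<le> N - m"
  shows "K a N m \<gamma>1 \<gamma>2 (int n) (int n') = coeff ([:1, of_real a:] ^ m * p) (n + (N - m))"
proof -
  let ?a = "complex_of_real a" and ?d = "N - m" and ?c = "2 * of_real pi * \<i>"
  have inner: "((\<lambda>v. v powi (int n') * W a N m v / (u - v)) has_contour_integral
      ?c * poly p u / (u - ?a) ^ Suc ?d) \<gamma>1" if u: "u \<in> \<Sigma>2" for u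
  proof -
    have uo: "u \<in> outside \<Sigma>1" using u outer_subset_outside by blast
    have notin: "?a \<notin> \<Sigma>1" "u \<notin> \<Sigma>1" "- 1 / ?a \<notin> \<Sigma>1"
      using a(2,3) uo notin1 by auto
    have "((\<lambda>v. poly p v / ((v - ?a) ^ Suc ?d * (u - v))) has_contour_integral
        ?c * poly p u / (u - ?a) ^ Suc ?d) \<gamma>1"
      by (rule has_contour_integral_principal_part) (use paths notin winding1 a uo pq in auto)
    moreover have "((\<lambda>v. poly q v / ((1 + ?a * v) ^ m * (u - v))) has_contour_integral 0) \<gamma>1"
    proof (rule Cauchy_theorem_global[where S = "- {- 1 / ?a, u}"])
      show "(\<lambda>v. poly q v / ((1 + ?a * v) ^ m * (u - v))) holomorphic_on - {- 1 / ?a, u}"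
        by (intro holomorphic_intros) (auto simp: one_plus_mult_eq_0_iff[OF a(1)])
      show "\<And>w. w \<notin> - {- 1 / ?a, u} \<Longrightarrow> winding_number \<gamma>1 w = 0"
        using a(3) uo by (auto intro!: winding1(2))
    qed (use paths notin in auto)
    ultimately have "((\<lambda>v. poly p v / ((v - ?a) ^ Suc ?d * (u - v)) + poly q v / ((1 + ?a * v) ^ m * (u - v)))
        has_contour_integral ?c * poly p u / (u - ?a) ^ Suc ?d + 0) \<gamma>1"
      by (rule has_contour_integral_add)
    then have "((\<lambda>v. poly p v / ((v - ?a) ^ Suc ?d * (u - v)) + poly q v / ((1 + ?a * v) ^ m * (u - v)))
        has_contour_integral ?c * poly p u / (u - ?a) ^ Suc ?d) \<gamma>1" by (simp only: add_0_right)
    then show ?thesis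
    proof (rule has_contour_integral_eq)
      fix v assume v: "v \<in> \<Sigma>1"
      have v1: "(v - ?a) ^ Suc ?d \<noteq> 0" using v notin by auto
      have "v \<noteq> - 1 / ?a" using v notin(3) by blast
      then have v2: "(1 + ?a * v) ^ m \<noteq> 0" by (simp add: one_plus_mult_eq_0_iff[OF a(1)])
      have "v ^ (n' + ?d) = (1 + ?a * v) ^ m * poly p v + (v - ?a) ^ Suc ?d * poly q v"
        using arg_cong[OF pq(1), of "\<lambda>r. poly r v"] by (simp add: poly_monom algebra_simps)
      moreover have "v powi (int n') * W a N m v / (u - v) =
          v ^ (n' + ?d) / ((v - ?a) ^ Suc ?d * (1 + ?a * v) ^ m * (u - v))"
        by (simp add: W_def power_add power_int_of_nat)
      moreover have "x / (A * w) + y / (B * w) = (B * x + A * y) / (A * B * w)"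
        if "A \<noteq> 0" "B \<noteq> 0" for A B w x y :: complex
        using that by (cases "w = 0") (simp_all add: field_simps)
      note this[OF v1 v2]
      ultimately show "poly p v / ((v - ?a) ^ Suc ?d * (u - v)) + poly q v / ((1 + ?a * v) ^ m * (u - v)) =
          v powi (int n') * W a N m v / (u - v)"
        by simp
    qed
  qed
  have inner_val: "contour_integral \<gamma>1 (\<lambda>v. u powi (- int n - 1) * v powi (int n') / (u - v) * (W a N m v / W a N m u)) =
      ?c * (poly ([:1, ?a:] ^ m * p) u / u ^ Suc (n + ?d))" if u: "u \<in> \<Sigma>2" for u
  proof -
    have u0: "u \<noteq> 0" using u a(4) jordan2 paths by blast
    have "u \<noteq> ?a" using u a(2) outer_subset_outside inside_Int_outside[of \<Sigma>1] by blast
    then have ua: "(u - ?a) ^ Suc ?d \<noteq> 0" by simp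
    have "contour_integral \<gamma>1 (\<lambda>v. u powi (- int n - 1) * v powi (int n') / (u - v) * (W a N m v / W a N m u)) =
        contour_integral \<gamma>1 (\<lambda>v. u powi (- int n - 1) / W a N m u * (v powi (int n') * W a N m v / (u - v)))"
      by (intro contour_integral_eq) (simp add: mult_ac)
    also have "\<dots> = u powi (- int n - 1) / W a N m u * (?c * poly p u / (u - ?a) ^ Suc ?d)"
      by (intro contour_integral_unique has_contour_integral_lmul inner u)
    also have "\<dots> = ?c * (poly ([:1, ?a:] ^ m * p) u / u ^ Suc (n + ?d))"
    proof -
      have "- int n - 1 = - int (Suc n)" by simp
      then have "u powi (- int n - 1) = 1 / u ^ Suc n"
        by (simp only: power_int_minus power_int_of_nat inverse_eq_divide)
      then show ?thesis using u0 ua by (simp add: W_def power_add mult_ac)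
    qed
    finally show ?thesis .
  qed
  have "contour_integral \<gamma>2 (\<lambda>u. contour_integral \<gamma>1 (\<lambda>v.
      u powi (- int n - 1) * v powi (int n') / (u - v) * (W a N m v / W a N m u))) =
      contour_integral \<gamma>2 (\<lambda>u. ?c * (poly ([:1, ?a:] ^ m * p) u / u ^ Suc (n + ?d)))"
    by (intro contour_integral_eq inner_val)
  also have "\<dots> = ?c * (?c * coeff ([:1, ?a:] ^ m * p) (n + ?d))"
  proof (intro contour_integral_unique has_contour_integral_lmul has_contour_integral_laurent)
    show "0 \<notin> \<Sigma>2" using a(4) jordan2 paths by blast
  qed (use paths winding2 a(4) in auto)
  finally show ?thesis unfolding K_def by (simp add: power2_eq_square)
qed

end

section \<open>Solvability of the Pade problem\<close>

text \<open>
  Multiply the hypothesis by the induction hypothesis and collect the multiples of \<open>B\<close>.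
\<close>

lemma bezout_power:
  fixes A B :: "'a :: comm_ring_1"
  assumes "u * A + v * B = 1"
  shows "\<exists>u v. u * A ^ n + v * B = 1"
proof (induction n)
  case 0
  show ?case by (intro exI[of _ 1] exI[of _ 0]) simp
next
  case (Suc n)
  then obtain u' v' where "u' * A ^ n + v' * B = 1" by blast
  then have "(u * A + v * B) * (u' * A ^ n + v' * B) = 1" using assms by simp
  then have "(u * u') * A ^ Suc n + (u * A * v' + v * (u' * A ^ n + v' * B)) * B = 1"
    by (simp add: algebra_simps)
  then show ?case by blast
qed

lemma bezout_linear_powers:
  fixes a :: real
  shows "\<exists>x y. x * [:1, complex_of_real a:] ^ m + y * [:- complex_of_real a, 1:] ^ n = 1"
proof -
  define c where "c = 1 / (1 + complex_of_real a ^ 2)"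
  have "0 < 1 + a\<^sup>2" by (simp add: add_pos_nonneg)
  then have "complex_of_real (1 + a\<^sup>2) \<noteq> 0" by (metis of_real_eq_0_iff less_irrefl)
  then have c: "c * (1 + complex_of_real a ^ 2) = 1" by (simp add: c_def)
  have "[:c:] * [:1, complex_of_real a:] + [:- c * of_real a:] * [:- complex_of_real a, 1:] = 1"
    using c by (simp add: one_pCons algebra_simps power2_eq_square)
  from bezout_power[OF this] obtain u v where "u * [:1, complex_of_real a:] ^ m + v * [:- complex_of_real a, 1:] = 1"
    by blast
  then have "v * [:- complex_of_real a, 1:] + u * [:1, complex_of_real a:] ^ m = 1" by (simp add: add.commute)
  from bezout_power[OF this] show ?thesis by (metis add.commute)
qed

lemma partial_fraction_exists:
  fixes a :: real and H :: "complex poly"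
  shows "\<exists>p q. H = [:1, of_real a:] ^ m * p + [:- of_real a, 1:] ^ Suc d * q \<and> degree p \<le> d"
proof -
  let ?A = "[:1, complex_of_real a:] ^ m" and ?B = "[:- complex_of_real a, 1:] ^ Suc d"
  obtain x y where xy: "x * ?A + y * ?B = 1"
    using bezout_linear_powers[of a m "Suc d"] by blast
  define p where "p = (H * x) mod ?B"
  have "H = ?A * (H * x) + ?B * (H * y)"
    using arg_cong[OF xy, of "\<lambda>z. H * z"] by (simp add: algebra_simps del: power_Suc)
  also have "H * x = p + ?B * ((H * x) div ?B)"
    by (simp add: p_def del: power_Suc)
  finally have "H = ?A * p + ?B * (?A * ((H * x) div ?B) + H * y)"
    by (simp add: algebra_simps del: power_Suc)
  moreover have "degree p \<le> d"
    using degree_mod_less[of ?B "H * x"] by (auto simp: p_def degree_linear_power simp del: power_Suc)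
  ultimately show ?thesis by blast
qed

lemma det_mat_delete_first:
  "cofactor (Matrix.mat (Suc s) (Suc s) f) 0 0 = Determinant.det (Matrix.mat s s (\<lambda>(i, j). f (Suc i, Suc j)))"
proof -
  have "mat_delete (Matrix.mat (Suc s) (Suc s) f) 0 0 = Matrix.mat s s (\<lambda>(i, j). f (Suc i, Suc j))"
    by (rule eq_matI) (auto simp: mat_delete_def)
  then show ?thesis by (simp add: cofactor_def)
qed

text \<open>
  The linear problem behind both the Riemann--Hilbert problem and the Fredholm determinants.  The
  datum \<open>H\<close> prescribes the coefficients of the residual in the degrees \<open>\<ge> d + k\<close>.
\<close>

locale pade =
  fixes a :: real and m d k :: nat
  assumes a_pos: "0 < a" and k_pos: "1 \<le> k" and k_le: "k \<le> m + 1"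
begin

abbreviation residual :: "complex poly \<Rightarrow> complex poly \<Rightarrow> complex poly" where
  "residual P Y \<equiv> [:1, of_real a:] ^ m * P + monom 1 (d + k) * Y"

definition pade_solution :: "complex poly \<Rightarrow> complex poly \<Rightarrow> complex poly \<Rightarrow> bool" where
  "pade_solution H P Y \<longleftrightarrow> degree P \<le> d \<and> [:- of_real a, 1:] ^ Suc d dvd residual P Y \<and>
     degree (residual P Y - H) < d + k"

lemma pade_solution_unique:
  assumes "pade_solution H P Y" "pade_solution H P' Y'"
  shows "P = P' \<and> Y = Y'"
proof -
  have eq: "residual (P - P') (Y - Y') = residual P Y - residual P' Y'"
    by (simp add: algebra_simps)
  have "P - P' = 0 \<and> Y - Y' = 0"
  proof (rule pade_trivial[OF a_pos k_pos k_le])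
    show "degree (P - P') \<le> d" using assms by (intro degree_diff_le) (auto simp: pade_solution_def)
    show "[:- of_real a, 1:] ^ Suc d dvd residual (P - P') (Y - Y')"
      unfolding eq using assms by (intro dvd_diff) (auto simp: pade_solution_def)
    have "residual P Y - residual P' Y' = (residual P Y - H) - (residual P' Y' - H)" by simp
    then show "degree (residual (P - P') (Y - Y')) < d + k"
      unfolding eq using assms by (simp only: degree_diff_less pade_solution_def)
  qed
  then show ?thesis by simp
qed

text \<open>
  The numerator of the principal part of \<open>z^(j+d) / ((z - a)^(d+1) (1 + az)^m)\<close> at \<open>a\<close>.
\<close>

definition pole_numerator :: "nat \<Rightarrow> complex poly" where
  "pole_numerator j = (SOME p. degree p \<le> d \<and>
     (\<exists>q. monom 1 (j + d) = [:1, of_real a:] ^ m * p + [:- of_real a, 1:] ^ Suc d * q))"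

lemma pole_numerator:
  "degree (pole_numerator j) \<le> d"
  "\<exists>q. monom 1 (j + d) = [:1, of_real a:] ^ m * pole_numerator j + [:- of_real a, 1:] ^ Suc d * q"
proof -
  have "\<exists>p :: complex poly. degree p \<le> d \<and>
     (\<exists>q. monom 1 (j + d) = [:1, of_real a:] ^ m * p + [:- of_real a, 1:] ^ Suc d * q)"
    using partial_fraction_exists[where a = a and m = m and d = d and H = "monom 1 (j + d)"] by blast
  from someI_ex[OF this] show
    "degree (pole_numerator j) \<le> d"
    "\<exists>q. monom 1 (j + d) = [:1, of_real a:] ^ m * pole_numerator j + [:- of_real a, 1:] ^ Suc d * q"
    unfolding pole_numerator_def by blast+
qed

definition kernel_coeff :: "nat \<Rightarrow> nat \<Rightarrow> complex" where
  "kernel_coeff i j = coeff ([:1, of_real a:] ^ m * pole_numerator j) (i + d)"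

lemma degree_pole_numerator: "degree ([:1, of_real a:] ^ m * pole_numerator j) \<le> m + d"
  by (intro order.trans[OF degree_mult_le] add_mono pole_numerator order.trans[OF degree_power_le]) simp

lemma kernel_coeff_eq_0: "i > m \<Longrightarrow> kernel_coeff i j = 0"
  unfolding kernel_coeff_def by (intro coeff_eq_0 le_less_trans[OF degree_pole_numerator]) simp

definition section_matrix :: "nat \<Rightarrow> nat \<Rightarrow> complex mat" where
  "section_matrix l s = Matrix.mat s s (\<lambda>(i, j). of_bool (i = j) - kernel_coeff (l + i) (l + j))"

text \<open>
  The size of a section of \<open>1 - K\<close> with indices \<open>k, ..., m + 1\<close>.  Including the index \<open>m + 1\<close>, whose row is
  that of the identity, keeps the size positive also for \<open>k = m + 1\<close>.
\<close>

abbreviation section_size :: nat where "section_size \<equiv> m + 2 - k"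

definition Y_of :: "complex Matrix.vec \<Rightarrow> complex poly" where
  "Y_of x = (\<Sum>j<section_size. monom (vec_index x j) j)"

definition P_of :: "complex Matrix.vec \<Rightarrow> complex poly" where
  "P_of x = - (\<Sum>j<section_size. Polynomial.smult (vec_index x j) (pole_numerator (k + j)))"

lemma degree_P_of: "degree (P_of x) \<le> d"
  unfolding P_of_def by (auto intro!: degree_sum_le order.trans[OF degree_smult_le] pole_numerator)

lemma coeff_Y_of: "coeff (Y_of x) i = (if i < section_size then vec_index x i else 0)"
  by (simp add: Y_of_def coeff_sum)

lemma residual_of:
  "residual (P_of x) (Y_of x) =
     (\<Sum>j<section_size. Polynomial.smult (vec_index x j) (monom 1 (k + j + d) - [:1, of_real a:] ^ m * pole_numerator (k + j)))"
proof -
  have "monom 1 (d + k) * Y_of x = (\<Sum>j<section_size. Polynomial.smult (vec_index x j) (monom 1 (k + j + d)))"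
    unfolding Y_of_def sum_distrib_left
    by (intro sum.cong refl) (simp add: mult_monom smult_monom ac_simps)
  moreover have "[:1, of_real a:] ^ m * P_of x =
      - (\<Sum>j<section_size. Polynomial.smult (vec_index x j) ([:1, of_real a:] ^ m * pole_numerator (k + j)))"
    unfolding P_of_def mult_minus_right sum_distrib_left by simp
  ultimately show ?thesis by (simp only: smult_diff_right sum_subtractf) simp
qed

lemma dvd_residual_of: "[:- of_real a, 1:] ^ Suc d dvd residual (P_of x) (Y_of x)"
  unfolding residual_of
proof (intro dvd_sum dvd_smult)
  fix j
  obtain q where "monom 1 (k + j + d) = [:1, of_real a:] ^ m * pole_numerator (k + j) + [:- of_real a, 1:] ^ Suc d * q"
    using pole_numerator(2) by blast
  then have "monom 1 (k + j + d) - [:1, of_real a:] ^ m * pole_numerator (k + j) = [:- of_real a, 1:] ^ Suc d * q"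
    by (simp del: power_Suc)
  then show "[:- of_real a, 1:] ^ Suc d dvd monom 1 (k + j + d) - [:1, of_real a:] ^ m * pole_numerator (k + j)"
    by (metis dvd_triv_left)
qed

text \<open>
  The identity part of the section comes from \<open>z^(d+k) Y\<close> and the kernel part from \<open>(1 + az)^m P\<close>.
\<close>

lemma coeff_residual_of:
  assumes x: "x \<in> carrier_vec section_size"
  shows "i < section_size \<Longrightarrow> coeff (residual (P_of x) (Y_of x)) (d + k + i) = vec_index (section_matrix k section_size *\<^sub>v x) i"
    and "n \<ge> d + k + section_size \<Longrightarrow> coeff (residual (P_of x) (Y_of x)) n = 0"
proof -
  have c: "coeff (residual (P_of x) (Y_of x)) n = (\<Sum>j<section_size. vec_index x j *
      (of_bool (n = k + j + d) - coeff ([:1, of_real a:] ^ m * pole_numerator (k + j)) n))" for n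
    unfolding residual_of by (simp add: coeff_sum of_bool_def eq_commute)
  show "coeff (residual (P_of x) (Y_of x)) (d + k + i) = vec_index (section_matrix k section_size *\<^sub>v x) i" if i: "i < section_size"
  proof -
    have "vec_index (section_matrix k section_size *\<^sub>v x) i =
        (\<Sum>j\<in>{0..<section_size}. (of_bool (i = j) - kernel_coeff (k + i) (k + j)) * vec_index x j)"
      using i x by (simp add: section_matrix_def mult_mat_vec_def scalar_prod_def)
    also have "\<dots> = (\<Sum>j<section_size. vec_index x j *
      (of_bool (d + k + i = k + j + d) - coeff ([:1, of_real a:] ^ m * pole_numerator (k + j)) (d + k + i)))"
      unfolding kernel_coeff_def lessThan_atLeast0
      by (intro sum.cong refl) (simp add: add.commute add.left_commute mult.commute)
    finally show ?thesis using c by simp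
  qed
  show "coeff (residual (P_of x) (Y_of x)) n = 0" if n: "n \<ge> d + k + section_size"
  proof -
    have "coeff ([:1, of_real a:] ^ m * pole_numerator (k + j)) n = 0" for j
      using n k_le by (intro coeff_eq_0 le_less_trans[OF degree_pole_numerator]) linarith
    moreover have "n \<noteq> k + j + d" if "j < section_size" for j using n that by linarith
    ultimately show ?thesis unfolding c by (intro sum.neutral) auto
  qed
qed

lemma pade_solution_of:
  assumes x: "x \<in> carrier_vec section_size" and H: "degree H < d + k + section_size"
    and eq: "\<And>i. i < section_size \<Longrightarrow> vec_index (section_matrix k section_size *\<^sub>v x) i = coeff H (d + k + i)"
  shows "pade_solution H (P_of x) (Y_of x)"
  unfolding pade_solution_def
proof (intro conjI degree_P_of dvd_residual_of)
  show "degree (residual (P_of x) (Y_of x) - H) < d + k"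
  proof (rule degree_lessI)
    show "\<forall>n\<ge>d + k. coeff (residual (P_of x) (Y_of x) - H) n = 0"
    proof (intro allI impI)
      fix n assume n: "d + k \<le> n"
      show "coeff (residual (P_of x) (Y_of x) - H) n = 0"
      proof (cases "n < d + k + section_size")
        case True
        then have "n - (d + k) < section_size" "d + k + (n - (d + k)) = n" using n by auto
        then show ?thesis using coeff_residual_of(1)[OF x, of "n - (d + k)"] eq[of "n - (d + k)"]
          by (simp only: coeff_diff) simp
      next
        case False
        then have "coeff (residual (P_of x) (Y_of x)) n = 0" "coeff H n = 0"
          using coeff_residual_of(2)[OF x, of n] H by (auto intro: coeff_eq_0)
        then show ?thesis by (simp only: coeff_diff) simp
      qed
    qed
  qed (use k_pos in simp)
qed

lemma section_matrix_carrier: "section_matrix l s \<in> carrier_mat s s"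
  by (simp add: section_matrix_def)

lemma cofactor_section_matrix:
  "cofactor (section_matrix l (Suc s)) 0 0 = Determinant.det (section_matrix (Suc l) s)"
  unfolding section_matrix_def det_mat_delete_first by simp

text \<open>
  A null vector would give a nontrivial solution of the homogeneous Pade problem.
\<close>

lemma det_section_matrix_nonzero: "Determinant.det (section_matrix k section_size) \<noteq> 0"
proof
  assume "Determinant.det (section_matrix k section_size) = 0"
  then obtain x where x: "x \<in> carrier_vec section_size" "x \<noteq> 0\<^sub>v section_size" "section_matrix k section_size *\<^sub>v x = 0\<^sub>v section_size"
    using det_0_iff_vec_prod_zero_field[OF section_matrix_carrier] by blast
  have "pade_solution 0 (P_of x) (Y_of x)"
    by (rule pade_solution_of) (use x k_pos in auto)
  moreover have "pade_solution 0 0 0" using k_pos by (simp add: pade_solution_def)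
  ultimately have "Y_of x = 0" using pade_solution_unique by blast
  then have "vec_index x i = 0" if "i < section_size" for i using coeff_Y_of[of x i] that by simp
  then have "x = 0\<^sub>v section_size" using x(1) by (intro eq_vecI) auto
  then show False using x by simp
qed

text \<open>
  Solve the section by the adjugate matrix.  For \<open>H = z^(d+k)\<close> the right-hand side is the first unit
  vector, so the first component of the solution is the quotient of the first cofactor, which is the
  next smaller section, by the determinant.
\<close>

lemma pade_solution_exists:
  assumes H: "degree H < d + k + section_size"
  obtains P Y where "pade_solution H P Y"
    "H = monom 1 (d + k) \<Longrightarrow>
      coeff Y 0 = Determinant.det (section_matrix (Suc k) (section_size - 1)) / Determinant.det (section_matrix k section_size)"
proof -
  let ?M = "section_matrix k section_size"
  let ?D = "Determinant.det ?M"
  note M = section_matrix_carrier[of k section_size]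
  define c where "c = Matrix.vec section_size (\<lambda>i. coeff H (d + k + i))"
  define x where "x = (1 / ?D) \<cdot>\<^sub>v (adj_mat ?M *\<^sub>v c)"
  have c: "c \<in> carrier_vec section_size" by (simp add: c_def)
  have x: "x \<in> carrier_vec section_size" using adj_mat(1)[OF M] c by (simp add: x_def)
  have "?M *\<^sub>v x = (1 / ?D) \<cdot>\<^sub>v (?M *\<^sub>v (adj_mat ?M *\<^sub>v c))"
    unfolding x_def using M adj_mat(1)[OF M] c by (intro mult_mat_vec) auto
  also have "?M *\<^sub>v (adj_mat ?M *\<^sub>v c) = (?D \<cdot>\<^sub>m 1\<^sub>m section_size) *\<^sub>v c"
    using M adj_mat[OF M] c by (metis assoc_mult_mat_vec)
  also have "(1 / ?D) \<cdot>\<^sub>v \<dots> = c"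
  proof -
    have "(?D \<cdot>\<^sub>m 1\<^sub>m section_size) *\<^sub>v c = ?D \<cdot>\<^sub>v (1\<^sub>m section_size *\<^sub>v c)"
    proof (rule eq_vecI)
      fix i assume "i < dim_vec (?D \<cdot>\<^sub>v (1\<^sub>m section_size *\<^sub>v c))"
      then have i: "i < section_size" by simp
      then have "vec_index ((?D \<cdot>\<^sub>m 1\<^sub>m section_size) *\<^sub>v c) i =
          (\<Sum>j\<in>{0..<section_size}. (?D * (if j = i then 1 else 0)) * vec_index c j)"
        using c by (simp add: scalar_prod_def)
      also have "\<dots> = (\<Sum>j\<in>{0..<section_size}. if j = i then ?D * vec_index c i else 0)"
        by (intro sum.cong refl) simp
      finally show "vec_index ((?D \<cdot>\<^sub>m 1\<^sub>m section_size) *\<^sub>v c) i = vec_index (?D \<cdot>\<^sub>v (1\<^sub>m section_size *\<^sub>v c)) i"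
        using i c by simp
    qed simp
    then show ?thesis using c det_section_matrix_nonzero by (simp add: smult_smult_assoc)
  qed
  finally have Mx: "?M *\<^sub>v x = c" .
  have sol: "pade_solution H (P_of x) (Y_of x)"
    by (rule pade_solution_of[OF x H]) (simp only: Mx, simp add: c_def)
  have size_Suc: "section_size = Suc (section_size - 1)" using k_le by simp
  have "coeff (Y_of x) 0 = Determinant.det (section_matrix (Suc k) (section_size - 1)) / ?D" if "H = monom 1 (d + k)"
  proof -
    have ce: "vec_index c j = of_bool (j = 0)" if "j < section_size" for j
      using that \<open>H = monom 1 (d + k)\<close> by (simp add: c_def)
    have "coeff (Y_of x) 0 = vec_index x 0" using coeff_Y_of[of x 0] k_le by simp
    also have "\<dots> = (1 / ?D) * vec_index (adj_mat ?M *\<^sub>v c) 0"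
      using adj_mat(1)[OF M] c k_le by (simp add: x_def)
    also have "vec_index (adj_mat ?M *\<^sub>v c) 0 = (\<Sum>j\<in>{0..<section_size}. adj_mat ?M $$ (0, j) * vec_index c j)"
      using adj_mat(1)[OF M] c k_le by (simp add: mult_mat_vec_def scalar_prod_def)
    also have "\<dots> = (\<Sum>j\<in>{0..<section_size}. if j = 0 then adj_mat ?M $$ (0, 0) else 0)"
      by (intro sum.cong refl) (auto simp: ce)
    also have "\<dots> = adj_mat ?M $$ (0, 0)" using k_le by simp
    also have "\<dots> = cofactor ?M 0 0" using M k_le by (simp add: adj_mat_def)
    also have "\<dots> = Determinant.det (section_matrix (Suc k) (section_size - 1))"
      using cofactor_section_matrix[of k "section_size - 1"] by (simp only: size_Suc[symmetric])
    finally show ?thesis by simp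
  qed
  then show ?thesis using that sol by blast
qed

end

section \<open>Entire functions and gluing along a curve\<close>

lemma holomorphic_on_poly_fun: "poly p holomorphic_on A" for p :: "complex poly"
  unfolding holomorphic_on_def field_differentiable_def
  using poly_DERIV has_field_derivative_at_within by blast

lemma liouville_poly:
  fixes f :: "complex \<Rightarrow> complex"
  assumes "f holomorphic_on UNIV" "\<And>z. A \<le> norm z \<Longrightarrow> norm (f z) \<le> B * norm z ^ n"
  shows "\<exists>p. degree p \<le> n \<and> (\<forall>z. f z = poly p z)"
proof (intro exI conjI allI)
  let ?p = "\<Sum>i\<le>n. monom ((deriv ^^ i) f 0 / fact i) i"
  show "degree ?p \<le> n" by (intro degree_sum_le) (auto intro: order.trans[OF degree_monom_le])
  show "f z = poly ?p z" for z
    using Liouville_polynomial[OF assms, where \<xi> = z] by (simp add: poly_sum poly_monom)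
qed

lemma degree_le_if_bounded:
  fixes p :: "complex poly"
  assumes "\<And>z. A \<le> norm z \<Longrightarrow> norm (poly p z) \<le> B * norm z ^ n"
  shows "degree p \<le> n"
proof -
  obtain q where "degree q \<le> n" "\<forall>z. poly p z = poly q z"
    using liouville_poly[OF holomorphic_on_poly_fun[of p UNIV] assms] by blast
  then show ?thesis by (metis poly_eq_poly_eq_iff ext)
qed

text \<open>
  Otherwise, after cancelling the exact power of \<open>z - a\<close> in \<open>Q\<close>, the cofactor would tend to zero at \<open>a\<close>.
\<close>

lemma linear_power_dvd_if_factor:
  fixes Q :: "complex poly"
  assumes V: "open V" "a \<in> V" and phi: "isCont \<phi> a"
    and eq: "\<And>z. z \<in> V \<Longrightarrow> poly Q z = (z - a) ^ n * \<phi> z"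
  shows "[:- a, 1:] ^ n dvd Q"
proof (rule ccontr)
  assume ndvd: "\<not> [:- a, 1:] ^ n dvd Q"
  then have Q: "Q \<noteq> 0" by auto
  define r where "r = order a Q"
  have r: "r < n" using ndvd Q by (auto simp: r_def order_divides)
  obtain T where T: "Q = [:- a, 1:] ^ r * T" "\<not> [:- a, 1:] dvd T"
    using order_decomp[OF Q, of a] by (auto simp: r_def)
  have "((\<lambda>z. (z - a) ^ (n - r) * \<phi> z) \<longlongrightarrow> (a - a) ^ (n - r) * \<phi> a) (at a)"
    using phi by (intro tendsto_intros) (simp add: isCont_def)
  moreover have "\<forall>\<^sub>F z in at a. (z - a) ^ (n - r) * \<phi> z = poly T z"
  proof -
    have "\<forall>\<^sub>F z in at a. z \<in> V \<and> z \<noteq> a"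
      using V by (auto simp: eventually_at_topological)
    then show ?thesis
    proof eventually_elim
      case (elim z)
      have "(z - a) ^ n = (z - a) ^ r * (z - a) ^ (n - r)" using r by (simp flip: power_add)
      then have "(z - a) ^ r * poly T z = (z - a) ^ r * ((z - a) ^ (n - r) * \<phi> z)"
        using eq[of z] elim by (simp add: T(1))
      then show ?case using elim by simp
    qed
  qed
  ultimately have "(poly T \<longlongrightarrow> (a - a) ^ (n - r) * \<phi> a) (at a)" by (rule Lim_transform_eventually)
  moreover have "(a - a) ^ (n - r) * \<phi> a = 0" using r by (simp add: zero_power)
  ultimately have "(poly T \<longlongrightarrow> 0) (at a)" by (simp only:)
  moreover have "isCont (poly T) a" by simp
  then have "(poly T \<longlongrightarrow> poly T a) (at a)" by (simp only: isCont_def)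
  ultimately have "poly T a = 0" using tendsto_unique trivial_limit_at by blast
  then show False using T(2) by (simp add: poly_eq_0_iff_dvd)
qed

lemma poly_quotient_bigo:
  fixes R :: "complex poly"
  assumes "degree R < n"
  shows "(\<lambda>z. poly R z / (z - c) ^ n) \<in> O[at_infinity](\<lambda>z. 1 / z)"
proof (rule landau_o.bigI)
  define C where "C = (\<Sum>i\<le>n - 1. norm (coeff R i))"
  have C: "C \<ge> 0" by (simp add: C_def sum_nonneg)
  show "(C + 1) * 2 ^ n > 0" using C by simp
  show "\<forall>\<^sub>F z in at_infinity. norm (poly R z / (z - c) ^ n) \<le> (C + 1) * 2 ^ n * norm (1 / z)"
    unfolding eventually_at_infinity
  proof (intro exI[of _ "2 * norm c + 1"] allI impI)
    fix z :: complex assume z: "2 * norm c + 1 \<le> norm z"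
    have z1: "norm z \<ge> 1" using z norm_ge_zero[of c] by linarith
    have "norm (poly R z) \<le> (\<Sum>i\<le>n - 1. norm (coeff R i * z ^ i))"
      using assms by (subst poly_eq_sum_atMost[of R "n - 1"]) (auto intro: norm_sum)
    also have "\<dots> \<le> (\<Sum>i\<le>n - 1. norm (coeff R i) * norm z ^ (n - 1))"
      using z1 by (intro sum_mono) (auto simp: norm_mult norm_power intro!: mult_left_mono power_increasing)
    also have "\<dots> = C * norm z ^ (n - 1)" by (simp add: C_def sum_distrib_right)
    finally have num: "norm (poly R z) \<le> C * norm z ^ (n - 1)" .
    have "norm z / 2 \<le> norm (z - c)" using z norm_triangle_ineq2[of z c] norm_ge_zero[of c] by linarith
    then have den: "(norm z / 2) ^ n \<le> norm ((z - c) ^ n)" unfolding norm_power using z1 by (intro power_mono) auto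
    have "norm (poly R z / (z - c) ^ n) \<le> (C * norm z ^ (n - 1)) / (norm z / 2) ^ n"
      unfolding norm_divide using num den z1 C by (intro frac_le zero_less_power) auto
    also have "\<dots> = C * 2 ^ n * (norm z ^ (n - 1) / norm z ^ n)" by (simp add: power_divide)
    also have "norm z ^ (n - 1) / norm z ^ n = 1 / norm z"
      using assms z1 by (cases n) auto
    also have "C * 2 ^ n * (1 / norm z) \<le> (C + 1) * 2 ^ n * (1 / norm z)"
      by (intro mult_right_mono) auto
    finally show "norm (poly R z / (z - c) ^ n) \<le> (C + 1) * 2 ^ n * norm (1 / z)" by (simp add: norm_divide)
  qed
qed

lemma tendsto_within_transform:
  assumes "(f \<longlongrightarrow> l) (at z within S)" "open V" "z \<in> V"
    "\<And>w. w \<in> S \<Longrightarrow> w \<in> V \<Longrightarrow> w \<noteq> z \<Longrightarrow> g w = f w"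
  shows "(g \<longlongrightarrow> l) (at z within S)"
  using assms(1)
proof (rule Lim_transform_eventually)
  show "\<forall>\<^sub>F w in at z within S. f w = g w"
    unfolding eventually_at_topological using assms(2-4) by auto
qed

text \<open>
  Equal limits from both sides, continuously varying along the curve, make the function continuous.
\<close>

lemma holomorphic_on_glue:
  assumes \<gamma>: "valid_path \<gamma>" "simple_path \<gamma>" "pathfinish \<gamma> = pathstart \<gamma>"
    and \<Omega>: "open \<Omega>" "path_image \<gamma> \<subseteq> \<Omega>" and G: "G holomorphic_on \<Omega> - path_image \<gamma>"
    and cont: "continuous_on (path_image \<gamma>) G"
    and lim: "\<And>z. z \<in> path_image \<gamma> \<Longrightarrow> (G \<longlongrightarrow> G z) (at z within inside (path_image \<gamma>))"
      "\<And>z. z \<in> path_image \<gamma> \<Longrightarrow> (G \<longlongrightarrow> G z) (at z within outside (path_image \<gamma>))"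
  shows "G holomorphic_on \<Omega>"
proof (rule holomorphic_on_across_simple_path[OF \<gamma>(1,2) \<Omega>(1) _ G])
  have "isCont G z" if z: "z \<in> \<Omega>" for z
  proof (cases "z \<in> path_image \<gamma>")
    case True
    have "(G \<longlongrightarrow> G z) (at z within path_image \<gamma>)" using cont True by (simp add: continuous_on_def)
    then have "(G \<longlongrightarrow> G z) (at z within (path_image \<gamma> \<union> inside (path_image \<gamma>) \<union> outside (path_image \<gamma>)))"
      using lim[OF True] by (intro Lim_Un)
    moreover have "path_image \<gamma> \<union> inside (path_image \<gamma>) \<union> outside (path_image \<gamma>) = UNIV"
      using inside_Un_outside[of "path_image \<gamma>"] by blast
    ultimately show ?thesis by (simp add: isCont_def)
  next
    case False
    have "open (\<Omega> - path_image \<gamma>)" using \<Omega> \<gamma> by (simp add: open_Diff closed_path_image valid_path_imp_path)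
    then show ?thesis using False z G
      by (meson DiffI continuous_on_eq_continuous_at holomorphic_on_imp_continuous_on)
  qed
  then show "continuous_on \<Omega> G" by (simp add: continuous_at_imp_continuous_on)
qed

section \<open>Rows of a solution as polynomials\<close>

locale rhp_setting = nested_contours \<gamma>1 \<gamma>2 + pade a m "N - m" k
  for \<gamma>1 \<gamma>2 :: "real \<Rightarrow> complex" and a :: real and N m k :: nat +
  assumes a_in: "of_real a \<in> inside (path_image \<gamma>1)"
    and pole_out: "of_real (- 1 / a) \<in> outside (path_image \<gamma>1)"
    and zero_in: "0 \<in> inside (path_image \<gamma>2)"
begin

abbreviation d :: nat where "d \<equiv> N - m"
abbreviation a' :: complex where "a' \<equiv> of_real a"

lemma K_eq_kernel_coeff: "K a N m \<gamma>1 \<gamma>2 (int i) (int j) = kernel_coeff i j"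
proof -
  obtain q where "monom 1 (j + d) = [:1, a':] ^ m * pole_numerator j + [:- a', 1:] ^ Suc d * q"
    using pole_numerator(2) by blast
  then show ?thesis unfolding kernel_coeff_def
    by (rule kernel_eq_coeff[OF a_pos a_in pole_out zero_in]) (rule pole_numerator)
qed

lemma fredholm_det_kernel:
  assumes "m < l + s"
  shows "fredholm_det (K a N m \<gamma>1 \<gamma>2) (int l) = Determinant.det (section_matrix l s)"
proof -
  have "fredholm_det (K a N m \<gamma>1 \<gamma>2) (int l) = Determinant.det (Matrix.mat s s
      (\<lambda>(i, j). of_bool (i = j) - K a N m \<gamma>1 \<gamma>2 (int l + int i) (int l + int j)))"
  proof (rule fredholm_det_eq_det)
    fix i j :: int assume ij: "int l + int s \<le> i" "int l \<le> j"
    then have "K a N m \<gamma>1 \<gamma>2 i j = kernel_coeff (nat i) (nat j)"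
      using K_eq_kernel_coeff[of "nat i" "nat j"] by simp
    then show "K a N m \<gamma>1 \<gamma>2 i j = 0" using ij assms by (simp add: kernel_coeff_eq_0)
  qed
  then show ?thesis
    by (simp add: section_matrix_def K_eq_kernel_coeff flip: of_nat_add)
qed

abbreviation f_jump :: "complex \<Rightarrow> complex" where
  "f_jump z \<equiv> z ^ (d + k) / ((z - a') ^ (d + 1) * (1 + a' * z) ^ m)"

abbreviation g_jump :: "complex \<Rightarrow> complex" where
  "g_jump z \<equiv> (z - a') ^ (d + 1) * (1 + a' * z) ^ m / z ^ (d + k)"

text \<open>
  A row \<open>(u1, u2)\<close> of the Riemann--Hilbert problem without its normalisation at infinity, with boundary
  values \<open>p\<close> from the left and \<open>m\<close> from the right.  The jump acts from the right, so the rows decouple.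
\<close>

definition row_jumps :: "(complex \<Rightarrow> complex) \<Rightarrow> (complex \<Rightarrow> complex) \<Rightarrow> (complex \<Rightarrow> complex) \<Rightarrow>
    (complex \<Rightarrow> complex) \<Rightarrow> (complex \<Rightarrow> complex) \<Rightarrow> (complex \<Rightarrow> complex) \<Rightarrow> bool" where
  "row_jumps u1 u2 p1 p2 m1 m2 \<longleftrightarrow>
     u1 analytic_on - (\<Sigma>1 \<union> \<Sigma>2) \<and> u2 analytic_on - (\<Sigma>1 \<union> \<Sigma>2) \<and>
     continuous_on (\<Sigma>1 \<union> \<Sigma>2) p1 \<and> continuous_on (\<Sigma>1 \<union> \<Sigma>2) p2 \<and>
     continuous_on (\<Sigma>1 \<union> \<Sigma>2) m1 \<and> continuous_on (\<Sigma>1 \<union> \<Sigma>2) m2 \<and>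
     (\<forall>z\<in>\<Sigma>1. (u1 \<longlongrightarrow> p1 z) (at z within inside \<Sigma>1) \<and> (u2 \<longlongrightarrow> p2 z) (at z within inside \<Sigma>1) \<and>
             (u1 \<longlongrightarrow> m1 z) (at z within outside \<Sigma>1) \<and> (u2 \<longlongrightarrow> m2 z) (at z within outside \<Sigma>1) \<and>
             p1 z = m1 z \<and> p2 z = m1 z * f_jump z + m2 z) \<and>
     (\<forall>z\<in>\<Sigma>2. (u1 \<longlongrightarrow> p1 z) (at z within inside \<Sigma>2) \<and> (u2 \<longlongrightarrow> p2 z) (at z within inside \<Sigma>2) \<and>
             (u1 \<longlongrightarrow> m1 z) (at z within outside \<Sigma>2) \<and> (u2 \<longlongrightarrow> m2 z) (at z within outside \<Sigma>2) \<and>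
             p1 z = m1 z - m2 z * g_jump z \<and> p2 z = m2 z)"

lemma jordan_facts:
  "open (inside \<Sigma>1)" "open (outside \<Sigma>1)" "open (inside \<Sigma>2)" "open (outside \<Sigma>2)"
  "inside \<Sigma>1 \<union> outside \<Sigma>1 = - \<Sigma>1" "inside \<Sigma>2 \<union> outside \<Sigma>2 = - \<Sigma>2"
  "inside \<Sigma>1 \<inter> outside \<Sigma>1 = {}" "inside \<Sigma>2 \<inter> outside \<Sigma>2 = {}"
  "closed \<Sigma>1" "closed \<Sigma>2" "bounded (inside \<Sigma>2)" "bounded \<Sigma>2"
  using jordan1 jordan2 paths by (auto simp: closed_path_image bounded_path_image valid_path_imp_path)

lemma regions:
  "z \<in> inside \<Sigma>1 \<Longrightarrow> z \<in> inside \<Sigma>2" "z \<in> \<Sigma>1 \<Longrightarrow> z \<in> inside \<Sigma>2"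
  "z \<in> outside \<Sigma>2 \<Longrightarrow> z \<in> outside \<Sigma>1" "z \<in> \<Sigma>2 \<Longrightarrow> z \<in> outside \<Sigma>1"
  "z \<in> inside \<Sigma>1 \<Longrightarrow> z \<notin> outside \<Sigma>1" "z \<in> inside \<Sigma>2 \<Longrightarrow> z \<notin> outside \<Sigma>2"
  "z \<in> inside \<Sigma>1 \<Longrightarrow> z \<notin> \<Sigma>1" "z \<in> outside \<Sigma>1 \<Longrightarrow> z \<notin> \<Sigma>1"
  "z \<in> inside \<Sigma>2 \<Longrightarrow> z \<notin> \<Sigma>2" "z \<in> outside \<Sigma>2 \<Longrightarrow> z \<notin> \<Sigma>2"
  "z \<notin> \<Sigma>1 \<Longrightarrow> z \<notin> inside \<Sigma>1 \<Longrightarrow> z \<in> outside \<Sigma>1"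
  "z \<notin> \<Sigma>2 \<Longrightarrow> z \<notin> inside \<Sigma>2 \<Longrightarrow> z \<in> outside \<Sigma>2"
  using inner_subset_inside outer_subset_outside jordan_facts(5-8) by blast+

lemma complement_split:
  "- (\<Sigma>1 \<union> \<Sigma>2) = inside \<Sigma>1 \<union> (outside \<Sigma>1 - \<Sigma>2)"
  "- (\<Sigma>1 \<union> \<Sigma>2) = outside \<Sigma>2 \<union> (inside \<Sigma>2 - \<Sigma>1)"
  using jordan_facts(5,6) regions(1,3,9) regions(8)[OF regions(3)] by blast+

lemma nonzero:
  "z \<in> \<Sigma>1 \<or> z \<in> outside \<Sigma>1 \<Longrightarrow> z \<noteq> a'"
  "z \<in> inside \<Sigma>1 \<or> z \<in> \<Sigma>1 \<Longrightarrow> 1 + a' * z \<noteq> 0"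
  "z \<in> \<Sigma>2 \<or> z \<in> outside \<Sigma>2 \<Longrightarrow> z \<noteq> 0"
proof -
  show "z \<noteq> a'" if "z \<in> \<Sigma>1 \<or> z \<in> outside \<Sigma>1" using that a_in regions(5,7) by blast
  show "z \<noteq> 0" if "z \<in> \<Sigma>2 \<or> z \<in> outside \<Sigma>2" using that zero_in regions(6,9) by blast
  show "1 + a' * z \<noteq> 0" if "z \<in> inside \<Sigma>1 \<or> z \<in> \<Sigma>1"
  proof
    assume "1 + a' * z = 0"
    then have "z = of_real (- 1 / a)" using one_plus_mult_eq_0_iff[OF a_pos] by simp
    then show False using that pole_out regions(5,8) by blast
  qed
qed

lemma far_outside: "\<exists>r. \<forall>z. r \<le> norm z \<longrightarrow> z \<in> outside \<Sigma>2"
proof -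
  have "bounded (inside \<Sigma>2 \<union> \<Sigma>2)" using jordan_facts by simp
  then obtain r where r: "\<And>z. z \<in> inside \<Sigma>2 \<union> \<Sigma>2 \<Longrightarrow> norm z \<le> r" by (auto simp: bounded_iff)
  have "z \<in> outside \<Sigma>2" if "r + 1 \<le> norm z" for z
    using r[of z] that regions(12)[of z] by force
  then show ?thesis by blast
qed

text \<open>
  With both entries vanishing at infinity, removing the jumps yields a homogeneous Pade problem.
\<close>

lemma row_zero:
  assumes row: "row_jumps u1 u2 p1 p2 m1 m2"
    and O1: "u1 \<in> O[at_infinity](\<lambda>z. 1 / z)" and O2: "u2 \<in> O[at_infinity](\<lambda>z. 1 / z)"
    and z: "z \<in> - (\<Sigma>1 \<union> \<Sigma>2)"
  shows "u1 z = 0 \<and> u2 z = 0"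
proof -
  let ?E = "- (\<Sigma>1 \<union> \<Sigma>2)"
  have an: "u1 analytic_on ?E" "u2 analytic_on ?E" and cont: "continuous_on (\<Sigma>1 \<union> \<Sigma>2) p1" "continuous_on (\<Sigma>1 \<union> \<Sigma>2) m2"
    using row by (auto simp: row_jumps_def)
  \<comment> \<open>the limits and jump relations on the inner and on the outer contour\<close>
  note R1 = row[unfolded row_jumps_def, THEN conjunct2, THEN conjunct2, THEN conjunct2, THEN conjunct2, THEN conjunct2, THEN conjunct2, THEN conjunct1, rule_format]
  note R2 = row[unfolded row_jumps_def, THEN conjunct2, THEN conjunct2, THEN conjunct2, THEN conjunct2, THEN conjunct2, THEN conjunct2, THEN conjunct2, rule_format]
  have sub: "inside \<Sigma>1 \<subseteq> ?E" "outside \<Sigma>1 - \<Sigma>2 \<subseteq> ?E" "inside \<Sigma>2 - \<Sigma>1 \<subseteq> ?E" "outside \<Sigma>2 \<subseteq> ?E"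
    using regions(1-10) by blast+
  have hol: "u1 holomorphic_on S" "u2 holomorphic_on S" if "S \<subseteq> ?E" for S
    using an that by (blast intro: analytic_imp_holomorphic analytic_on_subset)+
  note holA = hol[OF sub(1)] and holB = hol[OF sub(2)] and holC = hol(1)[OF sub(3)] hol[OF sub(4)]
  obtain r0 where r0: "\<And>z. r0 \<le> norm z \<Longrightarrow> z \<in> outside \<Sigma>2" using far_outside by blast
  obtain c1 b1 where cb1: "c1 > 0" "\<And>z. b1 \<le> norm z \<Longrightarrow> norm (u1 z) \<le> c1 * norm (1 / z)"
    using O1 by (elim landau_o.bigE) (auto simp: eventually_at_infinity)
  obtain c2 b2 where cb2: "c2 > 0" "\<And>z. b2 \<le> norm z \<Longrightarrow> norm (u2 z) \<le> c2 * norm (1 / z)"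
    using O2 by (elim landau_o.bigE) (auto simp: eventually_at_infinity)
  \<comment> \<open>beyond radius \<open>r\<close> all estimates at infinity are available\<close>
  define r where "r = Max {r0, b1, b2, 1, a}"
  have r: "z \<in> outside \<Sigma>2" "norm (u1 z) \<le> c1 / norm z" "norm (u2 z) \<le> c2 / norm z" "1 \<le> norm z" "a \<le> norm z"
    if "r \<le> norm z" for z
    using that r0[of z] cb1(2)[of z] cb2(2)[of z] by (auto simp: r_def norm_divide)
  have lin: "norm (z - a') \<le> 2 * norm z" "norm (1 + a' * z) \<le> (1 + a) * norm z" if "r \<le> norm z" for z
  proof -
    have "norm (z - a') \<le> norm z + norm a'" by (rule norm_triangle_ineq4)
    then show "norm (z - a') \<le> 2 * norm z" using r[OF that] a_pos by simp
    have "norm (1 + a' * z) \<le> 1 + a * norm z"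
      using norm_triangle_ineq[of 1 "a' * z"] a_pos by (simp add: norm_mult)
    then show "norm (1 + a' * z) \<le> (1 + a) * norm z" using r(4)[OF that] by (simp add: algebra_simps)
  qed
  \<comment> \<open>removing the jump of the second entry on the inner contour, and its pole at \<open>a\<close>\<close>
  define h where "h z = z ^ (d + k) / (1 + a' * z) ^ m" for z
  define G where "G z = (if z \<in> inside \<Sigma>1 then (z - a') ^ Suc d * u2 z - h z * u1 z
      else if z \<in> \<Sigma>1 \<union> \<Sigma>2 then (z - a') ^ Suc d * m2 z else (z - a') ^ Suc d * u2 z)" for z
  have holh: "h holomorphic_on inside \<Sigma>1"
    unfolding h_def by (intro holomorphic_intros) (auto simp: nonzero(2))
  have hcont: "isCont h z" if "z \<in> \<Sigma>1" for z
    unfolding h_def using nonzero(2)[of z] that by (intro continuous_intros) auto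
  have G_hol: "G holomorphic_on ?E"
  proof -
    have "(\<lambda>z. (z - a') ^ Suc d * u2 z - h z * u1 z) holomorphic_on inside \<Sigma>1"
      by (intro holomorphic_intros holA holh)
    then have A: "G holomorphic_on inside \<Sigma>1" by (rule holomorphic_transform) (simp add: G_def)
    have "(\<lambda>z. (z - a') ^ Suc d * u2 z) holomorphic_on outside \<Sigma>1 - \<Sigma>2"
      by (intro holomorphic_intros holB)
    then have B: "G holomorphic_on outside \<Sigma>1 - \<Sigma>2"
      by (rule holomorphic_transform) (auto simp: G_def dest: regions(1-10))
    show ?thesis
      unfolding complement_split(1) using holomorphic_on_Un[OF A B jordan_facts(1) open_Diff[OF jordan_facts(2,10)]] by simp
  qed
  have G_cont: "continuous_on (\<Sigma>1 \<union> \<Sigma>2) G"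
  proof -
    have "continuous_on (\<Sigma>1 \<union> \<Sigma>2) (\<lambda>z. (z - a') ^ Suc d * m2 z)" by (intro continuous_intros cont)
    then show ?thesis
      by (rule continuous_on_eq) (auto simp: G_def dest: regions(1-10))
  qed
  have G1: "G holomorphic_on - \<Sigma>2"
  proof (rule holomorphic_on_glue[of \<gamma>1])
    show "G holomorphic_on - \<Sigma>2 - \<Sigma>1" using G_hol by (simp add: Diff_eq Int_commute)
    show "continuous_on \<Sigma>1 G" by (rule continuous_on_subset[OF G_cont]) simp
    fix z assume z: "z \<in> \<Sigma>1"
    have Gz: "G z = (z - a') ^ Suc d * m2 z" using z by (auto simp: G_def dest: regions(1-10))
    have "((\<lambda>w. (w - a') ^ Suc d * u2 w - h w * u1 w) \<longlongrightarrow> (z - a') ^ Suc d * p2 z - h z * p1 z) (at z within inside \<Sigma>1)"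
    proof (intro tendsto_intros)
      show "(h \<longlongrightarrow> h z) (at z within inside \<Sigma>1)"
        using hcont[OF z] unfolding isCont_def by (rule Lim_at_imp_Lim_at_within)
    qed (use R1[OF z] in auto)
    moreover have "(z - a') ^ Suc d * p2 z - h z * p1 z = G z"
      using R1[OF z] nonzero(1)[of z] z by (simp add: Gz h_def distrib_left)
    ultimately show "(G \<longlongrightarrow> G z) (at z within inside \<Sigma>1)"
      by (auto intro: tendsto_within_transform[where V = UNIV] simp: G_def)
    have "((\<lambda>w. (w - a') ^ Suc d * u2 w) \<longlongrightarrow> G z) (at z within outside \<Sigma>1)"
      unfolding Gz using R1[OF z] by (intro tendsto_intros) auto
    then show "(G \<longlongrightarrow> G z) (at z within outside \<Sigma>1)"
      by (rule tendsto_within_transform[where V = "inside \<Sigma>2"])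
         (use z jordan_facts(1-4,9,10) in \<open>auto simp: G_def dest: regions(1-10)\<close>)
  qed (use paths jordan_facts(1-4,9,10) in \<open>auto simp: open_Compl dest: regions(1-10)\<close>)
  have G2: "G holomorphic_on UNIV"
  proof (rule holomorphic_on_glue[of \<gamma>2])
    show "G holomorphic_on UNIV - \<Sigma>2" using G1 by (simp add: Compl_eq_Diff_UNIV)
    show "continuous_on \<Sigma>2 G" by (rule continuous_on_subset[OF G_cont]) simp
    fix z assume z: "z \<in> \<Sigma>2"
    have Gz: "G z = (z - a') ^ Suc d * m2 z" using z by (auto simp: G_def dest: regions(1-10))
    have "((\<lambda>w. (w - a') ^ Suc d * u2 w) \<longlongrightarrow> G z) (at z within inside \<Sigma>2)"
      unfolding Gz using R2[OF z] by (intro tendsto_intros) auto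
    then show "(G \<longlongrightarrow> G z) (at z within inside \<Sigma>2)"
      by (rule tendsto_within_transform[where V = "outside \<Sigma>1"])
         (use z jordan_facts(1-4,9,10) in \<open>auto simp: G_def dest: regions(1-10)\<close>)
    have "((\<lambda>w. (w - a') ^ Suc d * u2 w) \<longlongrightarrow> G z) (at z within outside \<Sigma>2)"
      unfolding Gz using R2[OF z] by (intro tendsto_intros) auto
    then show "(G \<longlongrightarrow> G z) (at z within outside \<Sigma>2)"
      by (rule tendsto_within_transform[where V = UNIV])
         (use z jordan_facts(1-4,9,10) in \<open>auto simp: G_def dest: regions(1-10)\<close>)
  qed (use paths in auto)
  have "norm (G z) \<le> 2 ^ Suc d * c2 * norm z ^ d" if z: "r \<le> norm z" for z
  proof -
    have "G z = (z - a') ^ Suc d * u2 z" using r(1)[OF z] by (auto simp: G_def dest: regions(1-10))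
    then have "norm (G z) = norm (z - a') ^ Suc d * norm (u2 z)" by (simp add: norm_mult norm_power)
    also have "\<dots> \<le> (2 * norm z) ^ Suc d * (c2 / norm z)"
      using r[OF z] lin[OF z] by (intro mult_mono power_mono) auto
    also have "\<dots> = 2 ^ Suc d * c2 * norm z ^ d"
    proof -
      have "z \<noteq> 0" using r(4)[OF z] by auto
      then show ?thesis by (simp add: power_mult_distrib)
    qed
    finally show ?thesis .
  qed
  then obtain P where P: "degree P \<le> d" "\<And>z. G z = poly P z" using liouville_poly[OF G2] by blast
  \<comment> \<open>removing the jump of the first entry on the outer contour\<close>
  define F where "F z = (if z \<in> outside \<Sigma>2 then u1 z - g_jump z * u2 z
      else if z \<in> \<Sigma>1 \<union> \<Sigma>2 then p1 z else u1 z)" for z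
  have holg: "g_jump holomorphic_on outside \<Sigma>2"
    by (intro holomorphic_intros) (auto simp: nonzero(3))
  have gcont: "isCont g_jump z" if "z \<in> \<Sigma>2" for z
    using nonzero(3)[of z] that by (intro continuous_intros) auto
  have F_hol: "F holomorphic_on ?E"
  proof -
    have "(\<lambda>z. u1 z - g_jump z * u2 z) holomorphic_on outside \<Sigma>2"
      by (intro holomorphic_on_diff holomorphic_on_mult holC holg)
    then have A: "F holomorphic_on outside \<Sigma>2" by (rule holomorphic_transform) (simp add: F_def)
    have B: "F holomorphic_on inside \<Sigma>2 - \<Sigma>1"
      using holC(1) by (rule holomorphic_transform) (auto simp: F_def dest: regions(1-10))
    show ?thesis
      unfolding complement_split(2) using holomorphic_on_Un[OF A B jordan_facts(4) open_Diff[OF jordan_facts(3,9)]] by simp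
  qed
  have F_cont: "continuous_on (\<Sigma>1 \<union> \<Sigma>2) F"
    using cont(1) by (rule continuous_on_eq) (auto simp: F_def dest: regions(1-10))
  have F1: "F holomorphic_on - \<Sigma>2"
  proof (rule holomorphic_on_glue[of \<gamma>1])
    show "F holomorphic_on - \<Sigma>2 - \<Sigma>1" using F_hol by (simp add: Diff_eq Int_commute)
    show "continuous_on \<Sigma>1 F" by (rule continuous_on_subset[OF F_cont]) simp
    fix z assume z: "z \<in> \<Sigma>1"
    have Fz: "F z = p1 z" using z by (auto simp: F_def dest: regions(1-10))
    have near: "F w = u1 w" if "w \<in> inside \<Sigma>2" "w \<notin> \<Sigma>1" for w
      using that by (auto simp: F_def dest: regions(1-10))
    have "(u1 \<longlongrightarrow> F z) (at z within inside \<Sigma>1)" using R1[OF z] unfolding Fz by blast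
    then show "(F \<longlongrightarrow> F z) (at z within inside \<Sigma>1)"
      by (rule tendsto_within_transform[where V = "inside \<Sigma>2"])
         (use z regions(2) jordan_facts(3) in \<open>auto intro!: near dest: regions(7)\<close>)
    have "p1 z = m1 z" using R1[OF z] by blast
    then have "(u1 \<longlongrightarrow> F z) (at z within outside \<Sigma>1)" using R1[OF z] unfolding Fz by simp
    then show "(F \<longlongrightarrow> F z) (at z within outside \<Sigma>1)"
      by (rule tendsto_within_transform[where V = "inside \<Sigma>2"])
         (use z regions(2) jordan_facts(3) in \<open>auto intro!: near dest: regions(8)\<close>)
  qed (use paths jordan_facts(1-4,9,10) in \<open>auto simp: open_Compl dest: regions(1-10)\<close>)
  have F2: "F holomorphic_on UNIV"
  proof (rule holomorphic_on_glue[of \<gamma>2])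
    show "F holomorphic_on UNIV - \<Sigma>2" using F1 by (simp add: Compl_eq_Diff_UNIV)
    show "continuous_on \<Sigma>2 F" by (rule continuous_on_subset[OF F_cont]) simp
    fix z assume z: "z \<in> \<Sigma>2"
    have Fz: "F z = p1 z" using z by (auto simp: F_def dest: regions(1-10))
    have "(u1 \<longlongrightarrow> F z) (at z within inside \<Sigma>2)" using R2[OF z] by (auto simp: Fz)
    then show "(F \<longlongrightarrow> F z) (at z within inside \<Sigma>2)"
      by (rule tendsto_within_transform[where V = "outside \<Sigma>1"])
         (use z jordan_facts(1-4,9,10) in \<open>auto simp: F_def dest: regions(1-10)\<close>)
    have "((\<lambda>w. u1 w - g_jump w * u2 w) \<longlongrightarrow> m1 z - g_jump z * m2 z) (at z within outside \<Sigma>2)"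
    proof (intro tendsto_diff tendsto_mult)
      show "(g_jump \<longlongrightarrow> g_jump z) (at z within outside \<Sigma>2)"
        using gcont[OF z] unfolding isCont_def by (rule Lim_at_imp_Lim_at_within)
    qed (use R2[OF z] in auto)
    moreover have "m1 z - g_jump z * m2 z = F z" using R2[OF z] by (simp add: Fz mult.commute)
    ultimately show "(F \<longlongrightarrow> F z) (at z within outside \<Sigma>2)"
      by (auto intro: tendsto_within_transform[where V = UNIV] simp: F_def)
  qed (use paths in auto)
  have "norm (F z) \<le> (c1 + 2 ^ Suc d * (1 + a) ^ m * c2) * norm z ^ (Suc d + m)" if z: "r \<le> norm z" for z
  proof -
    have nz: "norm z \<ge> 1" using r[OF z] by simp
    have "F z = u1 z - g_jump z * u2 z" using r(1)[OF z] by (simp add: F_def)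
    then have "norm (F z) \<le> norm (u1 z) + norm (g_jump z) * norm (u2 z)"
      by (metis norm_mult norm_triangle_ineq4)
    also have "\<dots> \<le> c1 * norm z ^ (Suc d + m) + (2 ^ Suc d * (1 + a) ^ m * norm z ^ (Suc d + m)) * c2"
    proof (intro add_mono mult_mono)
      have "norm (u1 z) \<le> c1 / norm z" by (rule r[OF z])
      also have "\<dots> \<le> c1 * 1" using divide_left_mono[of 1 "norm z" c1] nz cb1(1) by (simp del: zero_less_norm_iff)
      also have "\<dots> \<le> c1 * norm z ^ (Suc d + m)" using nz cb1 by (intro mult_left_mono one_le_power) auto
      finally show "norm (u1 z) \<le> c1 * norm z ^ (Suc d + m)" .
      have "norm (u2 z) \<le> c2 / norm z" by (rule r[OF z])
      also have "\<dots> \<le> c2" using divide_left_mono[of 1 "norm z" c2] nz cb2(1) by (simp del: zero_less_norm_iff)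
      finally show "norm (u2 z) \<le> c2" .
      have "norm (g_jump z) = norm (z - a') ^ Suc d * norm (1 + a' * z) ^ m / norm z ^ (d + k)"
        by (simp add: norm_mult norm_divide norm_power)
      also have "\<dots> \<le> (2 * norm z) ^ Suc d * ((1 + a) * norm z) ^ m / 1"
        using lin[OF z] nz a_pos by (intro frac_le mult_mono power_mono one_le_power) auto
      also have "\<dots> = 2 ^ Suc d * (1 + a) ^ m * norm z ^ (Suc d + m)"
        by (simp add: power_mult_distrib power_add)
      finally show "norm (g_jump z) \<le> 2 ^ Suc d * (1 + a) ^ m * norm z ^ (Suc d + m)" .
    qed (use a_pos in auto)
    finally show ?thesis by (simp add: algebra_simps)
  qed
  then obtain Y where Y: "\<And>z. F z = poly Y z" using liouville_poly[OF F2] by blast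
  have outer: "u2 z = poly P z / (z - a') ^ Suc d \<and> u1 z = poly (residual P Y) z / z ^ (d + k)"
    if z: "z \<in> outside \<Sigma>2" for z
  proof -
    have "poly P z = (z - a') ^ Suc d * u2 z" unfolding P(2)[symmetric] using z by (auto simp: G_def dest: regions(1-10))
    then have u2: "u2 z = poly P z / (z - a') ^ Suc d" using nonzero(1)[of z] regions(3)[of z] z by simp
    have "poly Y z = u1 z - g_jump z * u2 z" using Y[of z] z by (simp add: F_def)
    then have "u1 z = poly Y z + (1 + a' * z) ^ m * poly P z / z ^ (d + k)"
      using nonzero(1)[of z] regions(3)[of z] z by (simp add: u2)
    then show ?thesis using u2 nonzero(3)[of z] z by (simp add: poly_monom field_simps)
  qed
  have dvd: "[:- a', 1:] ^ Suc d dvd residual P Y"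
  proof (rule linear_power_dvd_if_factor[OF jordan_facts(1) a_in])
    show "isCont (\<lambda>z. (1 + a' * z) ^ m * u2 z) a'"
      using holA(2) a_in jordan_facts(1)
      by (intro continuous_intros) (meson continuous_on_eq_continuous_at holomorphic_on_imp_continuous_on)
    fix z assume z: "z \<in> inside \<Sigma>1"
    have "poly Y z = u1 z" unfolding Y[symmetric] using z by (auto simp: F_def dest: regions(1-10))
    moreover have "poly P z = (z - a') ^ Suc d * u2 z - h z * u1 z" using P(2)[of z] z by (simp add: G_def)
    ultimately show "poly (residual P Y) z = (z - a') ^ Suc d * ((1 + a' * z) ^ m * u2 z)"
      using nonzero(2)[of z] z by (simp add: poly_monom h_def field_simps)
  qed
  have "degree (residual P Y) \<le> d + k - 1"
  proof (rule degree_le_if_bounded)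
    fix z :: complex assume z: "r \<le> norm z"
    have z0: "z \<noteq> 0" using r(4)[OF z] by auto
    have "poly (residual P Y) z = z ^ (d + k) * u1 z" using outer[OF r(1)[OF z]] z0 by simp
    then have "norm (poly (residual P Y) z) = norm z ^ (d + k) * norm (u1 z)"
      by (simp add: norm_mult norm_power)
    also have "\<dots> \<le> norm z ^ (d + k) * (c1 / norm z)" using r[OF z] by (intro mult_left_mono) auto
    also have "norm z ^ (d + k) = norm z ^ (d + k - 1) * norm z" using k_pos by (simp flip: power_Suc2)
    also have "\<dots> * (c1 / norm z) = c1 * norm z ^ (d + k - 1)" using z0 by simp
    finally show "norm (poly (residual P Y) z) \<le> c1 * norm z ^ (d + k - 1)" .
  qed
  then have "pade_solution 0 P Y" using P(1) dvd k_pos by (simp add: pade_solution_def del: power_Suc)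
  moreover have "pade_solution 0 0 0" using k_pos by (simp add: pade_solution_def)
  ultimately have PY: "P = 0" "Y = 0" using pade_solution_unique by blast+
  have G0: "G z = 0" and F0: "F z = 0" for z using P Y PY by auto
  consider "z \<in> outside \<Sigma>2" | "z \<in> inside \<Sigma>2" "z \<in> outside \<Sigma>1" | "z \<in> inside \<Sigma>1"
    using z jordan_facts(5,6) by blast
  then show ?thesis
  proof cases
    case 1
    then show ?thesis using outer[OF 1] PY by simp
  next
    case 2
    then have "G z = (z - a') ^ Suc d * u2 z" "F z = u1 z"
      using z by (auto simp: G_def F_def dest: regions(1-10))
    then show ?thesis using F0[of z] G0[of z] 2 nonzero(1)[of z] by simp
  next
    case 3
    have "F w = u1 w" if "w \<in> inside \<Sigma>1" for w using that by (auto simp: F_def dest: regions(1-10))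
    then have u1: "u1 w = 0" if "w \<in> inside \<Sigma>1" for w using F0[of w] that by simp
    have u2: "u2 w = 0" if "w \<in> inside \<Sigma>1" "w \<noteq> a'" for w
      using G0[of w] u1[of w] that by (simp add: G_def)
    have "u2 a' = 0"
    proof -
      have "isCont u2 a'" using holA(2) a_in jordan_facts(1)
        by (meson continuous_on_eq_continuous_at holomorphic_on_imp_continuous_on)
      moreover have "(u2 \<longlongrightarrow> 0) (at a')"
        by (rule tendsto_within_transform[where f = "\<lambda>_. 0" and V = "inside \<Sigma>1"])
           (use u2 a_in jordan_facts in auto)
      ultimately show ?thesis using tendsto_unique trivial_limit_at unfolding isCont_def by blast
    qed
    then show ?thesis using u1 u2 3 by (cases "z = a'") auto
  qed
qed

definition row1 :: "complex poly \<Rightarrow> complex poly \<Rightarrow> complex \<Rightarrow> complex" where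
  "row1 P Y z = (if z \<in> outside \<Sigma>2 then poly (residual P Y) z / z ^ (d + k) else poly Y z)"

definition row2 :: "complex poly \<Rightarrow> complex poly \<Rightarrow> complex \<Rightarrow> complex" where
  "row2 P S z = (if z \<in> inside \<Sigma>1 then poly S z / (1 + a' * z) ^ m else poly P z / (z - a') ^ Suc d)"

text \<open>
  The converse of the reduction: divisibility of the residual is what makes \<open>u\<^sub>2 = S / (1 + az)^m\<close> regular
  inside the inner contour.
\<close>

lemma row_jumps_of_polys:
  assumes S: "residual P Y = [:- a', 1:] ^ Suc d * S"
  shows "\<exists>p1 p2 m1 m2. row_jumps (row1 P Y) (row2 P S) p1 p2 m1 m2"
proof -
  define q where "q z = poly (residual P Y) z / z ^ (d + k)" for z
  define s where "s z = poly S z / (1 + a' * z) ^ m" for z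
  define x where "x z = poly P z / (z - a') ^ Suc d" for z
  have cq: "isCont q z" if "z \<in> \<Sigma>2 \<union> outside \<Sigma>2" for z
    unfolding q_def using nonzero(3)[of z] that by (intro continuous_intros) auto
  have cs: "isCont s z" if "z \<in> \<Sigma>1 \<union> inside \<Sigma>1" for z
    unfolding s_def using nonzero(2)[of z] that by (intro continuous_intros) auto
  have cx: "isCont x z" if "z \<in> \<Sigma>1 \<union> outside \<Sigma>1" for z
    unfolding x_def using nonzero(1)[of z] that by (intro continuous_intros) (auto simp del: power_Suc)
  have eqs: "w \<in> outside \<Sigma>2 \<Longrightarrow> row1 P Y w = q w" "w \<notin> outside \<Sigma>2 \<Longrightarrow> row1 P Y w = poly Y w"
    "w \<in> inside \<Sigma>1 \<Longrightarrow> row2 P S w = s w" "w \<notin> inside \<Sigma>1 \<Longrightarrow> row2 P S w = x w" for w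
    by (simp_all add: row1_def row2_def q_def s_def x_def)
  have cY: "isCont (poly Y) z" for z by simp
  have lim: "(g \<longlongrightarrow> g z) (at z within S)" if "isCont g z" for g :: "complex \<Rightarrow> complex" and z S
    using that unfolding isCont_def by (rule Lim_at_imp_Lim_at_within)
  have opE: "open (- (\<Sigma>1 \<union> \<Sigma>2))" using jordan_facts(9,10) by (intro open_Compl closed_Un)
  have disj: "\<Sigma>1 \<inter> \<Sigma>2 = {}" using regions(2,9) by blast
  have glue: "continuous_on (\<Sigma>1 \<union> \<Sigma>2) (\<lambda>z. if z \<in> \<Sigma>1 then g z else g' z)"
    if "continuous_on \<Sigma>1 g" "continuous_on \<Sigma>2 g'" for g g' :: "complex \<Rightarrow> complex"
    by (rule continuous_on_cases) (use that jordan_facts disj in auto)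
  have "row_jumps (row1 P Y) (row2 P S) (poly Y) (\<lambda>z. if z \<in> \<Sigma>1 then s z else x z)
      (\<lambda>z. if z \<in> \<Sigma>1 then poly Y z else q z) x"
    unfolding row_jumps_def
  proof (intro conjI ballI)
    have "q holomorphic_on outside \<Sigma>2" unfolding q_def
      by (intro holomorphic_intros) (auto simp: nonzero(3))
    then have A: "row1 P Y holomorphic_on outside \<Sigma>2"
      by (rule holomorphic_transform) (simp add: row1_def q_def)
    have "poly Y holomorphic_on inside \<Sigma>2 - \<Sigma>1" by (intro holomorphic_intros)
    then have B: "row1 P Y holomorphic_on inside \<Sigma>2 - \<Sigma>1"
      by (rule holomorphic_transform) (auto simp: row1_def dest: regions(1-10))
    have "row1 P Y holomorphic_on - (\<Sigma>1 \<union> \<Sigma>2)"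
      unfolding complement_split(2) by (rule holomorphic_on_Un[OF A B jordan_facts(4) open_Diff[OF jordan_facts(3,9)]])
    then show "row1 P Y analytic_on - (\<Sigma>1 \<union> \<Sigma>2)"
      using analytic_on_open[OF opE] by blast
    have "s holomorphic_on inside \<Sigma>1" unfolding s_def
      by (intro holomorphic_intros) (auto simp: nonzero(2))
    then have A: "row2 P S holomorphic_on inside \<Sigma>1"
      by (rule holomorphic_transform) (simp add: row2_def s_def)
    have "x holomorphic_on outside \<Sigma>1 - \<Sigma>2" unfolding x_def
      by (intro holomorphic_intros) (auto simp: nonzero(1))
    then have B: "row2 P S holomorphic_on outside \<Sigma>1 - \<Sigma>2"
      by (rule holomorphic_transform) (auto simp: row2_def x_def dest: regions(1-10))
    have "row2 P S holomorphic_on - (\<Sigma>1 \<union> \<Sigma>2)"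
      unfolding complement_split(1) by (rule holomorphic_on_Un[OF A B jordan_facts(1) open_Diff[OF jordan_facts(2,10)]])
    then show "row2 P S analytic_on - (\<Sigma>1 \<union> \<Sigma>2)"
      using analytic_on_open[OF opE] by blast
  next
    show "continuous_on (\<Sigma>1 \<union> \<Sigma>2) (poly Y)" by (intro continuous_intros)
    show "continuous_on (\<Sigma>1 \<union> \<Sigma>2) (\<lambda>z. if z \<in> \<Sigma>1 then s z else x z)"
      by (rule glue) (use cs cx in \<open>auto intro!: continuous_at_imp_continuous_on dest: regions(1-10)\<close>)
    show "continuous_on (\<Sigma>1 \<union> \<Sigma>2) (\<lambda>z. if z \<in> \<Sigma>1 then poly Y z else q z)"
      by (rule glue) (use cq in \<open>auto intro!: continuous_at_imp_continuous_on\<close>)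
    show "continuous_on (\<Sigma>1 \<union> \<Sigma>2) x"
      using cx by (auto intro!: continuous_at_imp_continuous_on dest: regions(1-10))
  next
    fix z assume z: "z \<in> \<Sigma>1"
    show "(row1 P Y \<longlongrightarrow> poly Y z) (at z within inside \<Sigma>1)"
      by (rule tendsto_within_transform[OF lim[OF cY], where V = UNIV]) (auto intro!: eqs dest: regions(1-10))
    show "(row2 P S \<longlongrightarrow> (if z \<in> \<Sigma>1 then s z else x z)) (at z within inside \<Sigma>1)"
      by (rule tendsto_within_transform[where V = UNIV and f = s])
         (use z cs in \<open>auto intro!: lim eqs dest: regions(1-10)\<close>)
    show "(row1 P Y \<longlongrightarrow> (if z \<in> \<Sigma>1 then poly Y z else q z)) (at z within outside \<Sigma>1)"
      by (rule tendsto_within_transform[where V = "inside \<Sigma>2" and f = "poly Y"])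
         (use z jordan_facts(1-4,9,10) in \<open>auto intro!: lim eqs dest: regions(1-10)\<close>)
    show "(row2 P S \<longlongrightarrow> x z) (at z within outside \<Sigma>1)"
      by (rule tendsto_within_transform[where V = UNIV and f = x])
         (use z cx in \<open>auto intro!: lim eqs dest: regions(1-10)\<close>)
    show "poly Y z = (if z \<in> \<Sigma>1 then poly Y z else q z)" using z by simp
    have "(z - a') ^ Suc d * poly S z = (1 + a' * z) ^ m * poly P z + z ^ (d + k) * poly Y z"
      using arg_cong[OF S, of "\<lambda>p. poly p z"] by (simp add: poly_monom algebra_simps)
    then have "poly S z = ((1 + a' * z) ^ m * poly P z + z ^ (d + k) * poly Y z) / (z - a') ^ Suc d"
      using nonzero(1)[of z] z by (simp add: field_simps)
    then have "s z = poly Y z * f_jump z + x z"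
      using nonzero(1,2)[of z] z by (simp add: s_def x_def add_divide_distrib mult_ac)
    then show "(if z \<in> \<Sigma>1 then s z else x z) = (if z \<in> \<Sigma>1 then poly Y z else q z) * f_jump z + x z"
      using z by simp
  next
    fix z assume z: "z \<in> \<Sigma>2"
    have z1: "z \<notin> \<Sigma>1" using z disj by blast
    show "(row1 P Y \<longlongrightarrow> poly Y z) (at z within inside \<Sigma>2)"
      by (rule tendsto_within_transform[OF lim[OF cY], where V = UNIV]) (auto intro!: eqs dest: regions(1-10))
    show "(row2 P S \<longlongrightarrow> (if z \<in> \<Sigma>1 then s z else x z)) (at z within inside \<Sigma>2)"
      by (rule tendsto_within_transform[where V = "outside \<Sigma>1" and f = x])
         (use z z1 cx jordan_facts(1-4,9,10) in \<open>auto intro!: lim eqs dest: regions(1-10)\<close>)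
    show "(row1 P Y \<longlongrightarrow> (if z \<in> \<Sigma>1 then poly Y z else q z)) (at z within outside \<Sigma>2)"
      by (rule tendsto_within_transform[where V = UNIV and f = q])
         (use z z1 cq in \<open>auto intro!: lim eqs dest: regions(1-10)\<close>)
    show "(row2 P S \<longlongrightarrow> x z) (at z within outside \<Sigma>2)"
      by (rule tendsto_within_transform[where V = UNIV and f = x])
         (use z cx in \<open>auto intro!: lim eqs dest: regions(1-10)\<close>)
    show "(if z \<in> \<Sigma>1 then s z else x z) = x z" using z1 by simp
    have "q z = poly Y z + (1 + a' * z) ^ m * poly P z / z ^ (d + k)"
      using nonzero(3)[of z] z by (simp add: q_def poly_monom field_simps)
    moreover have "x z * g_jump z = (1 + a' * z) ^ m * poly P z / z ^ (d + k)"
      using nonzero(1)[of z] regions(4)[of z] z by (simp add: x_def mult_ac)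
    ultimately have "poly Y z = q z - x z * g_jump z" by (simp only: add_diff_cancel_right')
    then show "poly Y z = (if z \<in> \<Sigma>1 then poly Y z else q z) - x z * g_jump z"
      using z1 by (simp only: if_False)
  qed
  then show ?thesis by blast
qed

end

section \<open>Uniqueness, existence and the value at the origin\<close>

context rhp_setting
begin

lemma matrix_entries_J_inner:
  "(M ** J_inner a N m k z) $ i $ 1 = M $ i $ 1"
  "(M ** J_inner a N m k z) $ i $ 2 = M $ i $ 1 * f_jump z + M $ i $ 2"
  by (simp_all add: matrix_matrix_mult_def J_inner_def sum_2)

lemma matrix_entries_J_outer:
  "(M ** J_outer a N m k z) $ i $ 1 = M $ i $ 1 - M $ i $ 2 * g_jump z"
  "(M ** J_outer a N m k z) $ i $ 2 = M $ i $ 2"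
  by (simp_all add: matrix_matrix_mult_def J_outer_def sum_2)

lemma RHP_solution_unique:
  assumes U: "RHP_solution a N m k \<Sigma>1 \<Sigma>2 U" and V: "RHP_solution a N m k \<Sigma>1 \<Sigma>2 V"
    and z: "z \<in> - (\<Sigma>1 \<union> \<Sigma>2)"
  shows "V z = U z"
proof -
  obtain Up Um where
    U': "continuous_on (\<Sigma>1 \<union> \<Sigma>2) Up" "continuous_on (\<Sigma>1 \<union> \<Sigma>2) Um"
    "\<And>z. z \<in> \<Sigma>1 \<Longrightarrow> (U \<longlongrightarrow> Up z) (at z within inside \<Sigma>1)" "\<And>z. z \<in> \<Sigma>1 \<Longrightarrow> (U \<longlongrightarrow> Um z) (at z within outside \<Sigma>1)"
    "\<And>z. z \<in> \<Sigma>1 \<Longrightarrow> Up z = Um z ** J_inner a N m k z"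
    "\<And>z. z \<in> \<Sigma>2 \<Longrightarrow> (U \<longlongrightarrow> Up z) (at z within inside \<Sigma>2)" "\<And>z. z \<in> \<Sigma>2 \<Longrightarrow> (U \<longlongrightarrow> Um z) (at z within outside \<Sigma>2)"
    "\<And>z. z \<in> \<Sigma>2 \<Longrightarrow> Up z = Um z ** J_outer a N m k z"
    using U unfolding RHP_solution_def by blast
  obtain Vp Vm where
    V': "continuous_on (\<Sigma>1 \<union> \<Sigma>2) Vp" "continuous_on (\<Sigma>1 \<union> \<Sigma>2) Vm"
    "\<And>z. z \<in> \<Sigma>1 \<Longrightarrow> (V \<longlongrightarrow> Vp z) (at z within inside \<Sigma>1)" "\<And>z. z \<in> \<Sigma>1 \<Longrightarrow> (V \<longlongrightarrow> Vm z) (at z within outside \<Sigma>1)"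
    "\<And>z. z \<in> \<Sigma>1 \<Longrightarrow> Vp z = Vm z ** J_inner a N m k z"
    "\<And>z. z \<in> \<Sigma>2 \<Longrightarrow> (V \<longlongrightarrow> Vp z) (at z within inside \<Sigma>2)" "\<And>z. z \<in> \<Sigma>2 \<Longrightarrow> (V \<longlongrightarrow> Vm z) (at z within outside \<Sigma>2)"
    "\<And>z. z \<in> \<Sigma>2 \<Longrightarrow> Vp z = Vm z ** J_outer a N m k z"
    using V unfolding RHP_solution_def by blast
  have an: "(\<lambda>z. U z $ i $ j) analytic_on - (\<Sigma>1 \<union> \<Sigma>2)" "(\<lambda>z. V z $ i $ j) analytic_on - (\<Sigma>1 \<union> \<Sigma>2)"
    and O: "(\<lambda>z. U z $ i $ j - (Finite_Cartesian_Product.mat 1 :: complex ^ 2 ^ 2) $ i $ j) \<in> O[at_infinity](\<lambda>z. 1 / z)"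
      "(\<lambda>z. V z $ i $ j - (Finite_Cartesian_Product.mat 1 :: complex ^ 2 ^ 2) $ i $ j) \<in> O[at_infinity](\<lambda>z. 1 / z)" for i j
    using U V unfolding RHP_solution_def by blast+
  have Odiff: "(\<lambda>z. V z $ i $ j - U z $ i $ j) \<in> O[at_infinity](\<lambda>z. 1 / z)" for i j
    using sum_in_bigo(2)[OF O(2)[of i j] O(1)[of i j]] by simp
  have entry: "((\<lambda>w. V w $ i $ j - U w $ i $ j) \<longlongrightarrow> B $ i $ j - A $ i $ j) F"
    if "(U \<longlongrightarrow> A) F" "(V \<longlongrightarrow> B) F" for A B :: "complex ^ 2 ^ 2" and F i j
    using that by (intro tendsto_diff tendsto_vec_nth)
  have cont: "continuous_on (\<Sigma>1 \<union> \<Sigma>2) (\<lambda>w. B w $ i $ j - A w $ i $ j)"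
    if "continuous_on (\<Sigma>1 \<union> \<Sigma>2) A" "continuous_on (\<Sigma>1 \<union> \<Sigma>2) B" for A B :: "complex \<Rightarrow> complex ^ 2 ^ 2" and i j
    using that unfolding continuous_on_def by (auto intro!: tendsto_diff tendsto_vec_nth)
  have lin: "(x * c + y) - (x' * c + y') = (x - x') * c + (y - y')"
    "(x - y * c) - (x' - y' * c) = (x - x') - (y - y') * c" for x y x' y' c :: complex
    by (simp_all add: algebra_simps)
  have "V z $ i $ 1 - U z $ i $ 1 = 0 \<and> V z $ i $ 2 - U z $ i $ 2 = 0" for i
  proof (rule row_zero[OF _ Odiff Odiff z])
    show "row_jumps (\<lambda>z. V z $ i $ 1 - U z $ i $ 1) (\<lambda>z. V z $ i $ 2 - U z $ i $ 2)
        (\<lambda>z. Vp z $ i $ 1 - Up z $ i $ 1) (\<lambda>z. Vp z $ i $ 2 - Up z $ i $ 2)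
        (\<lambda>z. Vm z $ i $ 1 - Um z $ i $ 1) (\<lambda>z. Vm z $ i $ 2 - Um z $ i $ 2)"
      unfolding row_jumps_def
      by (intro conjI ballI analytic_on_diff an cont entry U'(1-4,6,7) V'(1-4,6,7))
         (simp_all only: U'(5,8) V'(5,8) matrix_entries_J_inner matrix_entries_J_outer lin)
  qed
  then show ?thesis by (simp add: Finite_Cartesian_Product.vec_eq_iff forall_2)
qed

definition matrix_of :: "complex \<Rightarrow> complex \<Rightarrow> complex \<Rightarrow> complex \<Rightarrow> complex ^ 2 ^ 2" where
  "matrix_of p q r s = (\<chi> i j. if i = 1 then if j = 1 then p else q else if j = 1 then r else s)"

lemma matrix_2_eqI:
  fixes A B :: "complex ^ 2 ^ 2"
  assumes "A $ 1 $ 1 = B $ 1 $ 1" "A $ 1 $ 2 = B $ 1 $ 2" "A $ 2 $ 1 = B $ 2 $ 1" "A $ 2 $ 2 = B $ 2 $ 2"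
  shows "A = B"
  using assms by (simp add: Finite_Cartesian_Product.vec_eq_iff forall_2)

lemma matrix_of_nth:
  "matrix_of p q r s $ 1 $ 1 = p" "matrix_of p q r s $ 1 $ 2 = q"
  "matrix_of p q r s $ 2 $ 1 = r" "matrix_of p q r s $ 2 $ 2 = s"
  by (simp_all add: matrix_of_def)

lemma tendsto_matrix_of:
  assumes "(p \<longlongrightarrow> p') F" "(q \<longlongrightarrow> q') F" "(r \<longlongrightarrow> r') F" "(s \<longlongrightarrow> s') F"
  shows "((\<lambda>z. matrix_of (p z) (q z) (r z) (s z)) \<longlongrightarrow> matrix_of p' q' r' s') F"
  unfolding matrix_of_def using assms
  by (intro vec_tendstoI) auto

lemma continuous_on_matrix_of:
  assumes "continuous_on S p" "continuous_on S q" "continuous_on S r" "continuous_on S s"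
  shows "continuous_on S (\<lambda>z. matrix_of (p z) (q z) (r z) (s z))"
  using assms unfolding continuous_on_def by (auto intro: tendsto_matrix_of)

lemma RHP_solution_of_rows:
  assumes 1: "row_jumps u1 u2 p1 p2 m1 m2" and 2: "row_jumps v1 v2 q1 q2 n1 n2"
    and O: "(\<lambda>z. u1 z - 1) \<in> O[at_infinity](\<lambda>z. 1 / z)" "u2 \<in> O[at_infinity](\<lambda>z. 1 / z)"
      "v1 \<in> O[at_infinity](\<lambda>z. 1 / z)" "(\<lambda>z. v2 z - 1) \<in> O[at_infinity](\<lambda>z. 1 / z)"
  shows "RHP_solution a N m k \<Sigma>1 \<Sigma>2 (\<lambda>z. matrix_of (u1 z) (u2 z) (v1 z) (v2 z))"
  unfolding RHP_solution_def
proof (intro conjI)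
  show "\<forall>i j. (\<lambda>z. matrix_of (u1 z) (u2 z) (v1 z) (v2 z) $ i $ j) analytic_on - (\<Sigma>1 \<union> \<Sigma>2)"
    using 1 2 by (simp add: forall_2 matrix_of_nth row_jumps_def)
  show "\<forall>i j. (\<lambda>z. matrix_of (u1 z) (u2 z) (v1 z) (v2 z) $ i $ j -
      (Finite_Cartesian_Product.mat 1 :: complex ^ 2 ^ 2) $ i $ j) \<in> O[at_infinity](\<lambda>z. 1 / z)"
    using O by (simp add: forall_2 matrix_of_nth Finite_Cartesian_Product.mat_def)
  show "\<exists>Up Um. continuous_on (\<Sigma>1 \<union> \<Sigma>2) Up \<and> continuous_on (\<Sigma>1 \<union> \<Sigma>2) Um \<and>
        (\<forall>z \<in> \<Sigma>1. ((\<lambda>z. matrix_of (u1 z) (u2 z) (v1 z) (v2 z)) \<longlongrightarrow> Up z) (at z within inside \<Sigma>1) \<and>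
                  ((\<lambda>z. matrix_of (u1 z) (u2 z) (v1 z) (v2 z)) \<longlongrightarrow> Um z) (at z within outside \<Sigma>1) \<and>
                  Up z = Um z ** J_inner a N m k z) \<and>
        (\<forall>z \<in> \<Sigma>2. ((\<lambda>z. matrix_of (u1 z) (u2 z) (v1 z) (v2 z)) \<longlongrightarrow> Up z) (at z within inside \<Sigma>2) \<and>
                  ((\<lambda>z. matrix_of (u1 z) (u2 z) (v1 z) (v2 z)) \<longlongrightarrow> Um z) (at z within outside \<Sigma>2) \<and>
                  Up z = Um z ** J_outer a N m k z)"
  proof (intro exI conjI ballI)
    let ?p = "\<lambda>z. matrix_of (p1 z) (p2 z) (q1 z) (q2 z)" and ?m = "\<lambda>z. matrix_of (m1 z) (m2 z) (n1 z) (n2 z)"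
    show "continuous_on (\<Sigma>1 \<union> \<Sigma>2) ?p" "continuous_on (\<Sigma>1 \<union> \<Sigma>2) ?m"
      using 1 2 by (auto intro!: continuous_on_matrix_of simp: row_jumps_def)
    fix z assume z: "z \<in> \<Sigma>1"
    show "((\<lambda>z. matrix_of (u1 z) (u2 z) (v1 z) (v2 z)) \<longlongrightarrow> ?p z) (at z within inside \<Sigma>1)"
      "((\<lambda>z. matrix_of (u1 z) (u2 z) (v1 z) (v2 z)) \<longlongrightarrow> ?m z) (at z within outside \<Sigma>1)"
      using 1 2 z by (auto intro!: tendsto_matrix_of simp: row_jumps_def)
    have "p1 z = m1 z \<and> p2 z = m1 z * f_jump z + m2 z \<and> q1 z = n1 z \<and> q2 z = n1 z * f_jump z + n2 z"
      using 1 2 z unfolding row_jumps_def by blast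
    then show "?p z = ?m z ** J_inner a N m k z"
      by (intro matrix_2_eqI) (simp_all only: matrix_entries_J_inner matrix_of_nth)
  next
    let ?p = "\<lambda>z. matrix_of (p1 z) (p2 z) (q1 z) (q2 z)" and ?m = "\<lambda>z. matrix_of (m1 z) (m2 z) (n1 z) (n2 z)"
    fix z assume z: "z \<in> \<Sigma>2"
    show "((\<lambda>z. matrix_of (u1 z) (u2 z) (v1 z) (v2 z)) \<longlongrightarrow> ?p z) (at z within inside \<Sigma>2)"
      "((\<lambda>z. matrix_of (u1 z) (u2 z) (v1 z) (v2 z)) \<longlongrightarrow> ?m z) (at z within outside \<Sigma>2)"
      using 1 2 z by (auto intro!: tendsto_matrix_of simp: row_jumps_def)
    have "p1 z = m1 z - m2 z * g_jump z \<and> p2 z = m2 z \<and> q1 z = n1 z - n2 z * g_jump z \<and> q2 z = n2 z"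
      using 1 2 z unfolding row_jumps_def by blast
    then show "?p z = ?m z ** J_outer a N m k z"
      by (intro matrix_2_eqI) (simp_all only: matrix_entries_J_outer matrix_of_nth)
  qed
qed

lemma eventually_outside: "\<forall>\<^sub>F z in at_infinity. z \<in> outside \<Sigma>2"
  using far_outside by (simp add: eventually_at_infinity)

lemma bigo_outside:
  assumes "\<And>z. z \<in> outside \<Sigma>2 \<Longrightarrow> g z = poly R z / (z - c) ^ n" "degree R < n"
  shows "g \<in> O[at_infinity](\<lambda>z. 1 / z)"
proof -
  have "\<forall>\<^sub>F z in at_infinity. g z = poly R z / (z - c) ^ n"
    using eventually_outside by eventually_elim (rule assms)
  then show ?thesis using poly_quotient_bigo[OF assms(2), of c] by (simp cong: landau_o.big.in_cong)
qed

text \<open>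
  The first row solves the Pade problem with datum \<open>z^(d+k)\<close>.  In the second row \<open>P\<close> is monic of degree
  \<open>d + 1\<close>; subtracting \<open>(z - a)^(d+1)\<close> from it lowers the degree, keeps the divisibility, and moves
  \<open>(1 + az)^m (z - a)^(d+1)\<close> into the datum.
\<close>

lemma RHP_solution_exists:
  obtains U where "RHP_solution a N m k \<Sigma>1 \<Sigma>2 U"
    "\<exists>Y. poly Y 0 = fredholm_det (K a N m \<gamma>1 \<gamma>2) (int k + 1) / fredholm_det (K a N m \<gamma>1 \<gamma>2) (int k) \<and>
       (\<forall>z \<in> inside \<Sigma>2. U z $ 1 $ 1 = poly Y z)"
proof -
  have "degree (monom (1 :: complex) (d + k)) < d + k + section_size" using k_le by (simp add: degree_monom_eq)
  then obtain P1 Y1 where s1: "pade_solution (monom 1 (d + k)) P1 Y1" and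
    Y1: "coeff Y1 0 = Determinant.det (section_matrix (Suc k) (section_size - 1)) / Determinant.det (section_matrix k section_size)"
    by (rule pade_solution_exists) blast
  obtain S1 where S1: "residual P1 Y1 = [:- a', 1:] ^ Suc d * S1" using s1 unfolding pade_solution_def by (blast elim: dvdE)
  obtain p1 p2 m1 m2 where row1: "row_jumps (row1 P1 Y1) (row2 P1 S1) p1 p2 m1 m2"
    using row_jumps_of_polys[OF S1] by blast
  \<comment> \<open>the second row, with \<open>P = P2 + (z - a)^(d+1)\<close>\<close>
  let ?B = "[:- a', 1:] ^ Suc d" and ?A = "[:1, a':] ^ m"
  have "degree (- (?A * ?B)) \<le> m + Suc d"
    unfolding degree_minus
    by (intro order.trans[OF degree_mult_le] add_mono order.trans[OF degree_power_le]) auto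
  then have "degree (- (?A * ?B)) < d + k + section_size" using k_le by linarith
  then obtain P2 Y2 where s2: "pade_solution (- (?A * ?B)) P2 Y2"
    by (rule pade_solution_exists)
  obtain S2 where S2: "residual P2 Y2 = ?B * S2" using s2 unfolding pade_solution_def by (blast elim: dvdE)
  have res2: "residual (P2 + ?B) Y2 = residual P2 Y2 + ?A * ?B" by (simp add: algebra_simps del: power_Suc)
  then have S2': "residual (P2 + ?B) Y2 = ?B * (S2 + ?A)" using S2 by (simp add: algebra_simps del: power_Suc)
  obtain q1 q2 n1 n2 where row2: "row_jumps (row1 (P2 + ?B) Y2) (row2 (P2 + ?B) (S2 + ?A)) q1 q2 n1 n2"
    using row_jumps_of_polys[OF S2'] by blast
  let ?U = "\<lambda>z. matrix_of (row1 P1 Y1 z) (row2 P1 S1 z) (row1 (P2 + ?B) Y2 z) (row2 (P2 + ?B) (S2 + ?A) z)"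
  have "RHP_solution a N m k \<Sigma>1 \<Sigma>2 ?U"
  proof (rule RHP_solution_of_rows[OF row1 row2])
    show "(\<lambda>z. row1 P1 Y1 z - 1) \<in> O[at_infinity](\<lambda>z. 1 / z)"
    proof (rule bigo_outside)
      show "degree (residual P1 Y1 - monom 1 (d + k)) < d + k" using s1 by (simp add: pade_solution_def)
      show "row1 P1 Y1 z - 1 = poly (residual P1 Y1 - monom 1 (d + k)) z / (z - 0) ^ (d + k)" if "z \<in> outside \<Sigma>2" for z
        using that nonzero(3)[of z] by (simp add: row1_def poly_monom diff_divide_distrib add_divide_distrib)
    qed
    show "row2 P1 S1 \<in> O[at_infinity](\<lambda>z. 1 / z)"
    proof (rule bigo_outside)
      show "degree P1 < Suc d" using s1 by (simp add: pade_solution_def)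
      show "row2 P1 S1 z = poly P1 z / (z - a') ^ Suc d" if "z \<in> outside \<Sigma>2" for z
        using regions(3)[OF that] regions(5)[of z] by (auto simp: row2_def)
    qed
    show "row1 (P2 + ?B) Y2 \<in> O[at_infinity](\<lambda>z. 1 / z)"
    proof (rule bigo_outside)
      show "degree (residual (P2 + ?B) Y2) < d + k" unfolding res2 using s2 by (simp add: pade_solution_def)
      show "row1 (P2 + ?B) Y2 z = poly (residual (P2 + ?B) Y2) z / (z - 0) ^ (d + k)" if "z \<in> outside \<Sigma>2" for z
        using that by (simp add: row1_def)
    qed
    show "(\<lambda>z. row2 (P2 + ?B) (S2 + ?A) z - 1) \<in> O[at_infinity](\<lambda>z. 1 / z)"
    proof (rule bigo_outside)
      show "degree P2 < Suc d" using s2 by (simp add: pade_solution_def)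
      show "row2 (P2 + ?B) (S2 + ?A) z - 1 = poly P2 z / (z - a') ^ Suc d" if z: "z \<in> outside \<Sigma>2" for z
      proof -
        have "z \<noteq> a'" using nonzero(1)[of z] regions(3)[OF z] by blast
        moreover have "z \<notin> inside \<Sigma>1" using regions(3)[OF z] regions(5) by blast
        moreover have "poly ?B z = (z - a') ^ Suc d" by (simp del: power_Suc)
        ultimately show ?thesis by (simp add: row2_def add_divide_distrib del: power_Suc)
      qed
    qed
  qed
  moreover have "poly Y1 0 = fredholm_det (K a N m \<gamma>1 \<gamma>2) (int k + 1) / fredholm_det (K a N m \<gamma>1 \<gamma>2) (int k)"
  proof -
    have "fredholm_det (K a N m \<gamma>1 \<gamma>2) (int (Suc k)) = Determinant.det (section_matrix (Suc k) (section_size - 1))"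
      by (rule fredholm_det_kernel) (use k_le in linarith)
    moreover have "fredholm_det (K a N m \<gamma>1 \<gamma>2) (int k) = Determinant.det (section_matrix k section_size)"
      by (rule fredholm_det_kernel) (use k_le in linarith)
    moreover have "int (Suc k) = int k + 1" by simp
    ultimately show ?thesis using Y1 by (simp only: poly_0_coeff_0)
  qed
  moreover have "?U z $ 1 $ 1 = poly Y1 z" if "z \<in> inside \<Sigma>2" for z
    using regions(6)[OF that] by (simp add: matrix_of_nth row1_def)
  ultimately show ?thesis using that[of ?U] by blast
qed

lemma fredholm_det_nonzero: "fredholm_det (K a N m \<gamma>1 \<gamma>2) (int k) \<noteq> 0"
proof -
  have "fredholm_det (K a N m \<gamma>1 \<gamma>2) (int k) = Determinant.det (section_matrix k section_size)"
    by (rule fredholm_det_kernel) (use k_le in linarith)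
  then show ?thesis using det_section_matrix_nonzero by simp
qed

end

theorem proposition1p9:
  fixes a :: real and N m k :: nat and \<gamma>1 \<gamma>2 :: "real \<Rightarrow> complex"
  assumes "0 < a" and "a \<le> 1"
    and "1 \<le> N" and "1 \<le> m" and "m \<le> N" and "1 \<le> k" and "k \<le> m + 1"
    and "positive_contour \<gamma>1"
    and "complex_of_real a \<in> inside (path_image \<gamma>1)"
    and "complex_of_real (- 1 / a) \<in> outside (path_image \<gamma>1)"
    and "positive_contour \<gamma>2"
    and "path_image \<gamma>1 \<subseteq> inside (path_image \<gamma>2)"
    and "0 \<in> inside (path_image \<gamma>2)"
  shows "(\<exists>U. RHP_solution a N m k (path_image \<gamma>1) (path_image \<gamma>2) U \<and>
            (\<forall>V. RHP_solution a N m k (path_image \<gamma>1) (path_image \<gamma>2) V \<longrightarrow>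
                 (\<forall>z \<in> - (path_image \<gamma>1 \<union> path_image \<gamma>2). V z = U z))) \<and>
         fredholm_det (K a N m \<gamma>1 \<gamma>2) (int k) \<noteq> 0 \<and>
         (\<forall>U. RHP_solution a N m k (path_image \<gamma>1) (path_image \<gamma>2) U \<longrightarrow>
            (let r = fredholm_det (K a N m \<gamma>1 \<gamma>2) (int k + 1) / fredholm_det (K a N m \<gamma>1 \<gamma>2) (int k)
             in if 0 \<in> path_image \<gamma>1
                then ((\<lambda>z. U z $ 1 $ 1) \<longlongrightarrow> r) (at 0 within - (path_image \<gamma>1 \<union> path_image \<gamma>2))
                else U 0 $ 1 $ 1 = r))"
proof -
  interpret rhp_setting \<gamma>1 \<gamma>2 a N m k
    by unfold_locales (use assms in auto)
  let ?r = "fredholm_det (K a N m \<gamma>1 \<gamma>2) (int k + 1) / fredholm_det (K a N m \<gamma>1 \<gamma>2) (int k)"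
  obtain U0 Y where U0: "RHP_solution a N m k \<Sigma>1 \<Sigma>2 U0" and Y: "poly Y 0 = ?r"
    "\<And>z. z \<in> inside \<Sigma>2 \<Longrightarrow> U0 z $ 1 $ 1 = poly Y z"
    by (rule RHP_solution_exists) blast
  have inner: "U z $ 1 $ 1 = poly Y z" if "RHP_solution a N m k \<Sigma>1 \<Sigma>2 U" "z \<in> inside \<Sigma>2" "z \<notin> \<Sigma>1" for U z
    using RHP_solution_unique[OF U0 that(1), of z] Y(2)[OF that(2)] regions(9)[OF that(2)] that(3) by simp
  have U11_at_0: "if 0 \<in> \<Sigma>1 then ((\<lambda>z. U z $ 1 $ 1) \<longlongrightarrow> ?r) (at 0 within - (\<Sigma>1 \<union> \<Sigma>2)) else U 0 $ 1 $ 1 = ?r"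
    if U: "RHP_solution a N m k \<Sigma>1 \<Sigma>2 U" for U
  proof -
    have "(poly Y \<longlongrightarrow> ?r) (at 0 within - (\<Sigma>1 \<union> \<Sigma>2))"
    proof -
      have "isCont (poly Y) 0" by simp
      then show ?thesis unfolding isCont_def Y(1) by (rule Lim_at_imp_Lim_at_within)
    qed
    then have "((\<lambda>z. U z $ 1 $ 1) \<longlongrightarrow> ?r) (at 0 within - (\<Sigma>1 \<union> \<Sigma>2))"
      by (rule tendsto_within_transform[OF _ jordan_facts(3) zero_in]) (use inner[OF U] in auto)
    then show ?thesis using inner[OF U zero_in] Y(1) by simp
  qed
  show ?thesis
    unfolding Let_def using U0 RHP_solution_unique[OF U0] fredholm_det_nonzero U11_at_0 by blast
qed

end
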